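(* (Going up a level) Let $f,g\in\mathbb K[x_1^{\pm1},\dots,x_n^{\pm1}]^{W_{\mathrm{fin}}}$ and $P_0=1$. Then \begin{align*} (f,g)_+&=\frac{W_0(t,t_n)}{W_0(t,t_n)}\,(P_0f,P_0g)_+, & (f,g)_\pm&=\frac{W_0(t,qt_n)}{W_0(t,t_n^{-1})}\,(A^\pm_\omega f,A^\pm_\omega g)_+,\\ (f,g)_-&=\frac{W_0(qt,qt_n)}{W_0(t^{-1},t_n^{-1})}\,(A_\rho f,A_\rho g)_+, & (f,g)_\mp&=\frac{W_0(qt,t_n)}{W_0(t^{-1},t_n)}\,(A^\mp_\pi f,A^\mp_\pi g)_+. \end{align*}
   Context: Let $n\ge1$, $\mathbb K=\mathbb C(q^{1/2},t^{1/2},t_0^{1/2},u_0^{1/2},t_n^{1/2},u_n^{1/2})$ (independent parameters). $W_{\mathrm{fin}}$ is the group of signed permutations, acting on $\mathbb K[x]=\mathbb K[x_1^{\pm1},\dots,x_n^{\pm1}]$ by permuting the $x_i$ and inverting them; simple reflections $s_i$ ($1\le i<n$) swap $x_i,x_{i+1}$, $s_n$ inverts $x_n$; $\ell_s(w)$, $\ell_d(w)$ are the numbers of factors $s_i$ ($i<n$), resp. $s_n$, in a reduced word of $w$. $W_0(t,t_n)=\sum_{w\in W_{\mathrm{fin}}}t^{\ell_s(w)}t_n^{\ell_d(w)}$, and $W_0(z_1,z_2)$ denotes the same polynomial with $t,t_n$ replaced by $z_1,z_2$. **Weyl denominators.** With $\omega=(1,\dots,1)$, $\pi=(n-1,\dots,1,0)$,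 $\rho=(n,\dots,2,1)$ and $x^{\mu}=x_1^{\mu_1}\cdots x_n^{\mu_n}$: $A^\pm_\omega=x^{-\omega}\prod_{i=1}^n(1-t_n^{1/2}u_n^{1/2}x_i)(1+t_n^{1/2}u_n^{-1/2}x_i)$, $A^\mp_\pi=x^{-\pi}\prod_{1\le i<j\le n}(1-tx_ix_j)(1-tx_ix_j^{-1})$, $A_\rho=A^\mp_\pi A^\pm_\omega$. **Inner products.** Let $a=q^{1/2}t_0^{1/2}u_0^{1/2}$, $b=-q^{1/2}t_0^{1/2}u_0^{-1/2}$, $c=t_n^{1/2}u_n^{1/2}$, $d=-t_n^{1/2}u_n^{-1/2}$, $(z;q)_\infty=\prod_{r\ge0}(1-zq^r)$, and $$\Delta^+_{CC}=\prod_{1\le i<j\le n}\frac{(tx_ix_j^{-1};q)_\infty(tx_ix_j;q)_\infty(tqx_i^{-1}x_j;q)_\infty(tqx_i^{-1}x_j^{-1};q)_\infty}{(x_ix_j^{-1};q)_\infty(x_ix_j;q)_\infty(qx_i^{-1}x_j;q)_\infty(qx_i^{-1}x_j^{-1};q)_\infty}$$ $$\times\prod_{i=1}^n\frac{(cx_i;q)_\infty(qcx_i^{-1};q)_\infty(dx_i;q)_\infty(qdx_i^{-1};q)_\infty(ax_i;q)_\infty(ax_i^{-1};q)_\infty(bx_i;q)_\infty(bx_i^{-1};q)_\infty}{(x_i^2;q)_\infty(qx_i^{-2};q)_\infty}.$$ The bar involution on $\mathbb K[x]$ sends each $x_i$ and each of $q^{1/2},t^{1/2},t_0^{1/2},u_0^{1/2},t_n^{1/2},u_n^{1/2}$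 to its inverse. Then $(f_1,f_2)_+=\mathrm{ct}\big(f_1\overline{f_2}/\Delta^+_{CC}\big)$, where $\mathrm{ct}$ is the constant term in $x_1,\dots,x_n$. The products $(\ ,\ )_\pm$, $(\ ,\ )_\mp$, $(\ ,\ )_-$ are defined by the same formula with the parameter tuple $(t,t_0^{1/2},u_0^{1/2},t_n^{1/2},u_n^{1/2})$ in the kernel $\Delta^+_{CC}$ replaced, respectively, by $(t,t_0^{1/2},u_0^{1/2},qt_n^{1/2},u_n^{1/2})$, by $(qt,t_0^{1/2},u_0^{1/2},t_n^{1/2},u_n^{1/2})$, and by $(qt,t_0^{1/2},u_0^{1/2},qt_n^{1/2},u_n^{1/2})$ ($q$ is unchanged).
   Formalization: In the (f,g)_± and (f,g)_- identities the numerators are W_0(t,q^2 t_n) and W_0(qt,q^2 t_n) instead of W_0(t,q t_n) and W_0(qt,q t_n), matching the shift of t_n^{1/2} to q t_n^{1/2}; the ± formula as printed fails for n=1, f=g=1. *)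

theory Defs
  imports
    "HOL-Analysis.Analysis"
    "HOL-Library.Poly_Mapping"
    "HOL-Computational_Algebra.Fraction_Field"
    "HOL-Computational_Algebra.Formal_Laurent_Series"
begin

section \<open>The field of rational functions in six independent parameters\<close>

text \<open>
  The names stand for \<open>q\<^sup>1\<^sup>/\<^sup>2, t\<^sup>1\<^sup>/\<^sup>2, t\<^sub>0\<^sup>1\<^sup>/\<^sup>2, u\<^sub>0\<^sup>1\<^sup>/\<^sup>2, t\<^sub>n\<^sup>1\<^sup>/\<^sup>2, u\<^sub>n\<^sup>1\<^sup>/\<^sup>2\<close>.
  The linear order on the names has no mathematical meaning; it only serves to make the polynomial
  ring an instance of \<open>idom\<close>, so that the field of fractions can be formed.
\<close>

datatype param = Qh | Th | T0h | U0h | Tnh | Unh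

primrec param_rank :: "param \<Rightarrow> nat" where
  "param_rank Qh = 0" | "param_rank Th = 1" | "param_rank T0h = 2"
| "param_rank U0h = 3" | "param_rank Tnh = 4" | "param_rank Unh = 5"

lemma param_rank_inject: "param_rank p = param_rank p' \<Longrightarrow> p = p'"
  by (cases p; cases p') simp_all

instantiation param :: linorder
begin
definition "p \<le> p' \<longleftrightarrow> param_rank p \<le> param_rank p'"
definition "p < p' \<longleftrightarrow> param_rank p < param_rank p'"
instance
  by standard (auto simp: less_eq_param_def less_param_def intro: param_rank_inject)
end

lemma UNIV_param: "(UNIV :: param set) = {Qh, Th, T0h, U0h, Tnh, Unh}"
  using param.exhaust by auto

instance param :: finite
  by standard (simp add: UNIV_param)

type_synonym parampoly = "(param \<Rightarrow>\<^sub>0 nat) \<Rightarrow>\<^sub>0 complex"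
type_synonym ratfun = "parampoly fract"

definition cst :: "complex \<Rightarrow> ratfun" where
  "cst c = Fract (Poly_Mapping.single 0 c) 1"

definition par :: "param \<Rightarrow> ratfun" where
  "par p = Fract (Poly_Mapping.single (Poly_Mapping.single p 1) 1) 1"

definition poly_subst :: "(complex \<Rightarrow> 'b) \<Rightarrow> (param \<Rightarrow> 'b) \<Rightarrow> parampoly \<Rightarrow> 'b::comm_semiring_1" where
  "poly_subst \<phi> v p =
     (\<Sum>e\<in>Poly_Mapping.keys p. \<phi> (Poly_Mapping.lookup p e) * (\<Prod>k\<in>UNIV. v k ^ Poly_Mapping.lookup e k))"

text \<open>
  Substitution into a rational function. It is independent of the chosen fraction, and a field
  homomorphism, as soon as \<open>\<phi>\<close> is a ring homomorphism and the values \<open>v\<close> are algebraically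
  independent over its image; this is so in the two uses below.
\<close>

definition rat_subst :: "(complex \<Rightarrow> 'b) \<Rightarrow> (param \<Rightarrow> 'b) \<Rightarrow> ratfun \<Rightarrow> 'b::field" where
  "rat_subst \<phi> v r =
     (SOME w. \<exists>a b. b \<noteq> 0 \<and> r = Fract a b \<and> w = poly_subst \<phi> v a / poly_subst \<phi> v b)"

abbreviation par_q :: ratfun where "par_q \<equiv> par Qh ^ 2"
abbreviation par_t :: ratfun where "par_t \<equiv> par Th ^ 2"
abbreviation par_tn :: ratfun where "par_tn \<equiv> par Tnh ^ 2"

section \<open>Laurent polynomials\<close>

text \<open>
  Elements of the group algebra of finitely supported integer exponent vectors;
  \<open>Poly_Mapping.single \<nu> c\<close> is the term \<open>c x\<^sup>\<nu>\<close>. The ring in \<open>x\<^sub>1, \<dots>, x\<^sub>n\<close> is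
  the subring in which only the indices \<open>1, \<dots>, n\<close> occur.
\<close>

type_synonym expo = "nat \<Rightarrow>\<^sub>0 int"
type_synonym laurent = "expo \<Rightarrow>\<^sub>0 ratfun"

definition laurent_ring :: "nat \<Rightarrow> laurent set" where
  "laurent_ring n = {f. \<forall>\<nu>\<in>Poly_Mapping.keys f. Poly_Mapping.keys \<nu> \<subseteq> {1..n}}"

definition eps :: "nat \<Rightarrow> expo" where
  "eps i = Poly_Mapping.single i 1"

definition bar_par :: "ratfun \<Rightarrow> ratfun" where
  "bar_par = rat_subst cst (\<lambda>p. inverse (par p))"

definition bar :: "laurent \<Rightarrow> laurent" where
  "bar f = (\<Sum>\<nu>\<in>Poly_Mapping.keys f. Poly_Mapping.single (- \<nu>) (bar_par (Poly_Mapping.lookup f \<nu>)))"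

section \<open>Signed permutations\<close>

definition W_fin :: "nat \<Rightarrow> (int \<Rightarrow> int) set" where
  "W_fin n = {w. w permutes {- int n..int n} \<and> (\<forall>k. w (- k) = - w k)}"

text \<open>\<open>w\<close> maps \<open>x\<^sub>i\<close> to \<open>x\<^bsub>w(i)\<^esub>\<close>, where \<open>x\<^bsub>-k\<^esub>\<close> is the inverse of \<open>x\<^sub>k\<close>.\<close>

definition act_expo :: "(int \<Rightarrow> int) \<Rightarrow> expo \<Rightarrow> expo" where
  "act_expo w \<nu> = (\<Sum>i\<in>Poly_Mapping.keys \<nu>.
     Poly_Mapping.single (nat \<bar>w (int i)\<bar>) (sgn (w (int i)) * Poly_Mapping.lookup \<nu> i))"

definition act :: "(int \<Rightarrow> int) \<Rightarrow> laurent \<Rightarrow> laurent" where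
  "act w f = (\<Sum>\<nu>\<in>Poly_Mapping.keys f. Poly_Mapping.single (act_expo w \<nu>) (Poly_Mapping.lookup f \<nu>))"

definition invariants :: "nat \<Rightarrow> laurent set" where
  "invariants n = {f \<in> laurent_ring n. \<forall>w\<in>W_fin n. act w f = f}"

definition simple_refl :: "nat \<Rightarrow> nat \<Rightarrow> int \<Rightarrow> int" where
  "simple_refl n i =
     (if i < n
      then Transposition.transpose (int i) (int i + 1) \<circ> Transposition.transpose (- int i) (- (int i + 1))
      else Transposition.transpose (int n) (- int n))"

definition is_word :: "nat \<Rightarrow> (int \<Rightarrow> int) \<Rightarrow> nat list \<Rightarrow> bool" where
  "is_word n w is \<longleftrightarrow> set is \<subseteq> {1..n} \<and> foldr (\<circ>) (map (simple_refl n) is) id = w"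

definition reduced_word :: "nat \<Rightarrow> (int \<Rightarrow> int) \<Rightarrow> nat list" where
  "reduced_word n w = arg_min length (is_word n w)"

definition len_s :: "nat \<Rightarrow> (int \<Rightarrow> int) \<Rightarrow> nat" where
  "len_s n w = length (filter (\<lambda>i. i < n) (reduced_word n w))"

definition len_d :: "nat \<Rightarrow> (int \<Rightarrow> int) \<Rightarrow> nat" where
  "len_d n w = length (filter (\<lambda>i. i = n) (reduced_word n w))"

definition W0 :: "nat \<Rightarrow> ratfun \<Rightarrow> ratfun \<Rightarrow> ratfun" where
  "W0 n z1 z2 = (\<Sum>w\<in>W_fin n. z1 ^ len_s n w * z2 ^ len_d n w)"

section \<open>Weyl denominators\<close>

definition P_zero :: laurent where
  "P_zero = 1"

definition A_omega :: "nat \<Rightarrow> laurent" where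
  "A_omega n = Poly_Mapping.single (- (\<Sum>i=1..n. eps i)) 1 *
     (\<Prod>i=1..n. (1 - Poly_Mapping.single (eps i) (par Tnh * par Unh)) *
                (1 + Poly_Mapping.single (eps i) (par Tnh * inverse (par Unh))))"

definition A_pi :: "nat \<Rightarrow> laurent" where
  "A_pi n = Poly_Mapping.single (- (\<Sum>i=1..n. Poly_Mapping.single i (int n - int i))) 1 *
     (\<Prod>i=1..n. \<Prod>j=i+1..n. (1 - Poly_Mapping.single (eps i + eps j) par_t) *
                            (1 - Poly_Mapping.single (eps i - eps j) par_t))"

definition A_rho :: "nat \<Rightarrow> laurent" where
  "A_rho n = A_pi n * A_omega n"

section \<open>The kernel and the inner products\<close>

text \<open>
  The reciprocal of the kernel is expanded as a formal power series in the small parameters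
  \<open>q\<^sup>1\<^sup>/\<^sup>2, t\<^sup>1\<^sup>/\<^sup>2, t\<^sub>0\<^sup>1\<^sup>/\<^sup>2, t\<^sub>n\<^sup>1\<^sup>/\<^sup>2\<close>, whose coefficients are Laurent polynomials in
  the \<open>x\<^sub>i\<close> and in \<open>u\<^sub>0\<^sup>1\<^sup>/\<^sup>2, u\<^sub>n\<^sup>1\<^sup>/\<^sup>2\<close>, so that the constant term in the \<open>x\<^sub>i\<close> can be taken
  coefficientwise. The expansion is organised by total degree: each of the four small parameters
  is multiplied by the variable of a power series ring, which is thus a mere degree marker.
  By the same substitution, \<open>expand\<close> embeds the parameter field into the
  field of formal Laurent series in the degree marker.
\<close>

definition gpar :: "param \<Rightarrow> ratfun fps" where
  "gpar p = (if p = U0h \<or> p = Unh then fps_const (par p) else fps_const (par p) * fps_X)"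

definition expand :: "ratfun \<Rightarrow> ratfun fls" where
  "expand = rat_subst (\<lambda>c. fls_const (cst c)) (\<lambda>p. fps_to_fls (gpar p))"

definition xterm :: "ratfun fps \<Rightarrow> expo \<Rightarrow> laurent fps" where
  "xterm c \<nu> = Abs_fps (\<lambda>k. Poly_Mapping.single \<nu> (fps_nth c k))"

text \<open>\<open>qpoch c \<nu>\<close> is \<open>(c x\<^sup>\<nu>; q)\<^sub>\<infinity>\<close>.\<close>

definition qpoch :: "ratfun fps \<Rightarrow> expo \<Rightarrow> laurent fps" where
  "qpoch c \<nu> = prodinf (\<lambda>r. 1 - xterm (c * (gpar Qh ^ 2) ^ r) \<nu>)"

text \<open>
  Inverse of a power series with constant coefficient 1 over the ring of Laurent polynomials
  (\<open>inverse\<close> on power series is only available over coefficients with an inverse operation).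
\<close>

definition unit_inverse :: "laurent fps \<Rightarrow> laurent fps" where
  "unit_inverse F = fps_right_inverse F 1"

text \<open>
  The reciprocal of the kernel \<open>\<Delta>\<^sup>+\<^bsub>CC\<^esub>\<close> for the parameter tuple
  \<open>(t, t\<^sub>0\<^sup>1\<^sup>/\<^sup>2, u\<^sub>0\<^sup>1\<^sup>/\<^sup>2, t\<^sub>n\<^sup>1\<^sup>/\<^sup>2, u\<^sub>n\<^sup>1\<^sup>/\<^sup>2)\<close>. Unlike the kernel itself (whose denominator
  contains the factors \<open>1 - x\<^sub>i x\<^sub>j\<^sup>\<plusminus>\<^sup>1\<close> and \<open>1 - x\<^sub>i\<^sup>2\<close>), it is an element of the power
  series ring: what is inverted here is the numerator of the kernel.
\<close>

definition inv_kernel ::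
    "nat \<Rightarrow> ratfun fps \<Rightarrow> ratfun fps \<Rightarrow> ratfun fps \<Rightarrow> ratfun fps \<Rightarrow> ratfun fps \<Rightarrow> laurent fps" where
  "inv_kernel n t t0h u0h tnh unh =
     (let qh = gpar Qh; q = qh ^ 2;
          a = qh * t0h * u0h; b = - (qh * t0h * inverse u0h);
          c = tnh * unh; d = - (tnh * inverse unh)
      in
       (\<Prod>i=1..n. \<Prod>j=i+1..n.
          qpoch 1 (eps i - eps j) * qpoch 1 (eps i + eps j) *
          qpoch q (- eps i + eps j) * qpoch q (- eps i - eps j) *
          unit_inverse
           (qpoch t (eps i - eps j) * qpoch t (eps i + eps j) *
            qpoch (t * q) (- eps i + eps j) * qpoch (t * q) (- eps i - eps j))) *
       (\<Prod>i=1..n.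
          qpoch 1 (eps i + eps i) * qpoch q (- eps i - eps i) *
          unit_inverse
           (qpoch c (eps i) * qpoch (q * c) (- eps i) *
            qpoch d (eps i) * qpoch (q * d) (- eps i) *
            qpoch a (eps i) * qpoch a (- eps i) *
            qpoch b (eps i) * qpoch b (- eps i))))"

text \<open>
  Constant term of \<open>h G\<close> for a Laurent polynomial \<open>h\<close>: the sum over \<open>\<nu>\<close> of the coefficient
  of \<open>x\<^sup>\<nu>\<close> in \<open>h\<close> times that of \<open>x\<^sup>-\<^sup>\<nu>\<close> in \<open>G\<close>.
\<close>

definition ct :: "laurent \<Rightarrow> laurent fps \<Rightarrow> ratfun fls" where
  "ct h G = (\<Sum>\<nu>\<in>Poly_Mapping.keys h.
     expand (Poly_Mapping.lookup h \<nu>) *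
     fps_to_fls (Abs_fps (\<lambda>k. Poly_Mapping.lookup (fps_nth G k) (- \<nu>))))"

text \<open>
  In the products below \<open>t\<^sub>n\<^sup>1\<^sup>/\<^sup>2\<close> is shifted to \<open>q t\<^sub>n\<^sup>1\<^sup>/\<^sup>2\<close>, hence \<open>t\<^sub>n\<close> to
  \<open>(q t\<^sub>n\<^sup>1\<^sup>/\<^sup>2)\<^sup>2 = q\<^sup>2 t\<^sub>n\<close>, whereas \<open>t\<close> is shifted to \<open>q t\<close>. A Poincare polynomial \<open>W0\<close>
  belonging to the shifted parameters is therefore evaluated at \<open>q\<^sup>2 t\<^sub>n\<close>; with \<open>q t\<^sub>n\<close> in
  its place the norm comparisons already fail for \<open>n = 1\<close>.
\<close>

definition ip_plus :: "nat \<Rightarrow> laurent \<Rightarrow> laurent \<Rightarrow> ratfun fls" where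
  "ip_plus n f1 f2 = ct (f1 * bar f2)
     (inv_kernel n (gpar Th ^ 2) (gpar T0h) (gpar U0h) (gpar Tnh) (gpar Unh))"

definition ip_pm :: "nat \<Rightarrow> laurent \<Rightarrow> laurent \<Rightarrow> ratfun fls" where
  "ip_pm n f1 f2 = ct (f1 * bar f2)
     (inv_kernel n (gpar Th ^ 2) (gpar T0h) (gpar U0h) (gpar Qh ^ 2 * gpar Tnh) (gpar Unh))"

definition ip_mp :: "nat \<Rightarrow> laurent \<Rightarrow> laurent \<Rightarrow> ratfun fls" where
  "ip_mp n f1 f2 = ct (f1 * bar f2)
     (inv_kernel n (gpar Qh ^ 2 * gpar Th ^ 2) (gpar T0h) (gpar U0h) (gpar Tnh) (gpar Unh))"

definition ip_minus :: "nat \<Rightarrow> laurent \<Rightarrow> laurent \<Rightarrow> ratfun fls" where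
  "ip_minus n f1 f2 = ct (f1 * bar f2)
     (inv_kernel n (gpar Qh ^ 2 * gpar Th ^ 2) (gpar T0h) (gpar U0h) (gpar Qh ^ 2 * gpar Tnh) (gpar Unh))"

end

theory Submission
  imports Defs
begin

text \<open>
  Split the reciprocal kernel as \<open>S \<cdot> D(t, c, d)\<close>, where \<open>S\<close> is invariant under signed permutations
  and \<open>D(t, c, d) = \<plusminus> \<delta> M(t, c, d)\<close> with the type C Weyl denominator \<open>\<delta>\<close> and
  \<open>M(t, c, d) = x\<^sup>\<rho> \<Prod>(1 - t x\<^sup>-\<^sup>\<alpha>) \<Prod>(1 - c/x\<^sub>i)(1 - d/x\<^sub>i)\<close>. Macdonald's identity
  \<open>\<Sum>\<^sub>w sgn(w) w(M(t, c, d)) = W\<^sub>0(t, -cd) \<delta>\<close> shows that symmetrising the constant term of an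
  invariant \<open>F\<close> against \<open>S D(t, c, d)\<close> yields \<open>W\<^sub>0(t, -cd) / |W|\<close> times the constant term of
  \<open>\<plusminus> F S \<delta>\<^sup>2\<close>. Shifting \<open>t\<close> or \<open>t\<^sub>n\<close> multiplies \<open>S\<close> by an invariant polynomial \<open>P\<close>, and for
  the corresponding denominator \<open>A\<close> one has \<open>A \<cdot> bar(A) \<cdot> D(t, c, d) = P \<cdot> D(t', c', d')\<close> with
  \<open>t\<close>, respectively \<open>c, d\<close>, replaced by their inverses; comparing the two symmetrisations gives the
  ratio of Poincare polynomials. Macdonald's identity itself holds because an antisymmetric Laurent
  polynomial all of whose exponents lie in \<open>[-n, n]\<close> is determined by its coefficient of \<open>x\<^sup>\<rho>\<close>, and
  for the left-hand side this coefficient is read off from the leading terms of the factors of \<open>w(M)\<close>.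
\<close>

text \<open>The obstacle is that the kernels are power series in the small parameters, whereas
  \<open>bar\<close> inverts parameters, and the inverse of a small parameter is no power series.
  Everything in which inverse parameters occur (bar(A), and D with inverted t or c, d) is therefore
  kept as a Laurent polynomial in the x_i over the parameter field, while the infinite products stay
  on the series side. Polynomial factors without inverse parameters, such as P and D(t, c, d), exist
  in both worlds, and \<open>has_expansion\<close> carries them across the constant term. The
  arguments of the Poincare polynomials come from -cd: it equals t_n for the kernel itself, 1/t_n
  after inverting c and d, and q^2 t_n after the shift of t_n^(1/2) by q, which multiplies both c
  and d by q. Dividing by the Poincare polynomials at inverted arguments is legitimate because they
  take the value |W| when all parameters are set to 1.\<close>

section \<open>Sums over supports and evaluation homomorphisms\<close>

lemma poly_mapping_add_induct [case_names zero add]: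
  fixes f :: "'a \<Rightarrow>\<^sub>0 'b::comm_monoid_add"
  assumes "P 0" and "\<And>k v f. P f \<Longrightarrow> P (f + Poly_Mapping.single k v)"
  shows "P f"
proof (induction f rule: update_induct)
  case const
  show ?case by (rule assms(1))
next
  case (update f a b)
  have "Poly_Mapping.update a b f = f + Poly_Mapping.single a b"
    using update(1) by (intro poly_mapping_eqI)
      (auto simp: lookup_update lookup_add lookup_single in_keys_iff when_def)
  with assms(2)[OF update(3)] show ?case by simp
qed

lemma poly_mapping_eq_sum_single:
  "(f :: 'a \<Rightarrow>\<^sub>0 'b::comm_monoid_add) =
     (\<Sum>k\<in>Poly_Mapping.keys f. Poly_Mapping.single k (Poly_Mapping.lookup f k))"
  by (intro poly_mapping_eqI)
     (auto simp: lookup_sum lookup_single when_def sum.delta in_keys_iff)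

lemma sum_keys_eq_superset:
  assumes "finite A" "Poly_Mapping.keys f \<subseteq> A" "\<And>k. F k 0 = 0"
  shows "(\<Sum>k\<in>Poly_Mapping.keys f. F k (Poly_Mapping.lookup f k)) = (\<Sum>k\<in>A. F k (Poly_Mapping.lookup f k))"
  using assms by (intro sum.mono_neutral_left) (auto simp: in_keys_iff)

lemma sum_keys_add:
  fixes F :: "'a \<Rightarrow> 'b::comm_monoid_add \<Rightarrow> 'c::comm_monoid_add"
  assumes 0: "\<And>k. F k 0 = 0" and add: "\<And>k a b. F k (a + b) = F k a + F k b"
  shows "(\<Sum>k\<in>Poly_Mapping.keys (f + g). F k (Poly_Mapping.lookup (f + g) k)) =
    (\<Sum>k\<in>Poly_Mapping.keys f. F k (Poly_Mapping.lookup f k)) +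
    (\<Sum>k\<in>Poly_Mapping.keys g. F k (Poly_Mapping.lookup g k))"
proof -
  define A where "A = Poly_Mapping.keys f \<union> Poly_Mapping.keys g"
  have A: "finite A" by (simp add: A_def)
  show ?thesis
    using sum_keys_eq_superset[OF A, of f F] sum_keys_eq_superset[OF A, of g F]
      sum_keys_eq_superset[OF A, of "f + g" F] 0 keys_add[of f g]
    by (simp add: A_def lookup_add add sum.distrib)
qed

text \<open>The common form of \<open>poly_subst\<close>, \<open>bar\<close> and
  \<open>signed_act\<close>: a map on coefficients combined with a multiplicative map on exponents.
  Multiplicativity of all three follows from \<open>pm_eval_hom\<close>.\<close>

definition pm_eval :: "('b::zero \<Rightarrow> 'c) \<Rightarrow> ('a \<Rightarrow> 'c) \<Rightarrow> ('a \<Rightarrow>\<^sub>0 'b) \<Rightarrow> 'c::comm_ring_1" where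
  "pm_eval \<eta> m f = (\<Sum>k\<in>Poly_Mapping.keys f. \<eta> (Poly_Mapping.lookup f k) * m k)"

locale ring_hom_1 =
  fixes \<eta> :: "'b::comm_ring_1 \<Rightarrow> 'c::comm_ring_1"
  assumes hom_add: "\<eta> (a + b) = \<eta> a + \<eta> b"
    and hom_mult: "\<eta> (a * b) = \<eta> a * \<eta> b"
    and hom_one: "\<eta> 1 = 1"
begin

lemma hom_zero: "\<eta> 0 = 0"
  using hom_add[of 0 0] by simp

lemma hom_uminus: "\<eta> (- a) = - \<eta> a"
  using hom_add[of a "- a"] by (simp add: hom_zero eq_neg_iff_add_eq_0 add.commute)

lemma hom_diff: "\<eta> (a - b) = \<eta> a - \<eta> b"
  using hom_add[of a "- b"] by (simp add: hom_uminus)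

lemma hom_power: "\<eta> (a ^ n) = \<eta> a ^ n"
  by (induction n) (simp_all add: hom_one hom_mult)

lemma hom_sum: "\<eta> (sum F A) = (\<Sum>i\<in>A. \<eta> (F i))"
  by (induction A rule: infinite_finite_induct) (simp_all add: hom_zero hom_add)

lemma hom_prod: "\<eta> (prod F A) = (\<Prod>i\<in>A. \<eta> (F i))"
  by (induction A rule: infinite_finite_induct) (simp_all add: hom_one hom_mult)

lemmas hom_simps = hom_add hom_mult hom_one hom_zero hom_uminus hom_diff hom_power hom_sum hom_prod

lemma pm_eval_add: "pm_eval \<eta> m (f + g) = pm_eval \<eta> m f + pm_eval \<eta> m g"
  unfolding pm_eval_def
  by (rule sum_keys_add[of "\<lambda>k c. \<eta> c * m k"]) (simp_all add: hom_zero hom_add distrib_right)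

lemma pm_eval_single: "pm_eval \<eta> m (Poly_Mapping.single k c) = \<eta> c * m k"
  by (simp add: pm_eval_def hom_zero)

lemma pm_eval_hom:
  assumes "m 0 = 1" and "\<And>a b. m (a + b) = m a * m b"
  shows "ring_hom_1 (pm_eval \<eta> m)"
proof
  show "pm_eval \<eta> m 1 = 1"
    using pm_eval_single[of m 0 1] by (simp add: assms(1) hom_one)
  show "pm_eval \<eta> m (f * g) = pm_eval \<eta> m f * pm_eval \<eta> m g" for f g
  proof (induction f rule: poly_mapping_add_induct)
    case zero
    show ?case by (simp add: pm_eval_def)
  next
    case (add k v f)
    have "pm_eval \<eta> m (Poly_Mapping.single k v * g) = \<eta> v * m k * pm_eval \<eta> m g"
    proof (induction g rule: poly_mapping_add_induct)
      case zero
      show ?case by (simp add: pm_eval_def)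
    next
      case (add l w g)
      then show ?case
        by (simp add: distrib_left pm_eval_add mult_single pm_eval_single hom_mult assms(2))
    qed
    with add show ?case
      by (simp add: distrib_right pm_eval_add pm_eval_single)
  qed
qed (rule pm_eval_add)

end

lemma ring_hom_1_id: "ring_hom_1 (\<lambda>x. x)"
  by standard auto

lemma ring_hom_1_comp: "ring_hom_1 \<eta> \<Longrightarrow> ring_hom_1 \<psi> \<Longrightarrow> ring_hom_1 (\<lambda>x. \<psi> (\<eta> x))"
  by (simp add: ring_hom_1_def)

lemma ring_hom_1_single: "ring_hom_1 (Poly_Mapping.single 0 :: 'b::comm_ring_1 \<Rightarrow> 'a::comm_monoid_add \<Rightarrow>\<^sub>0 'b)"
  by standard (simp_all add: single_add mult_single)

section \<open>Substitution for the parameters: the bar involution and the expansion\<close>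

lemma poly_subst_eq_pm_eval:
  "poly_subst \<phi> v p = pm_eval \<phi> (\<lambda>e. \<Prod>k\<in>UNIV. v k ^ Poly_Mapping.lookup e k) p"
  by (simp add: poly_subst_def pm_eval_def)

lemma poly_subst_hom:
  assumes "ring_hom_1 \<phi>"
  shows "ring_hom_1 (poly_subst \<phi> v)"
  unfolding poly_subst_eq_pm_eval[abs_def]
  by (rule ring_hom_1.pm_eval_hom[OF assms])
     (simp_all add: lookup_add power_add prod.distrib)

lemma poly_subst_single:
  assumes "ring_hom_1 \<phi>"
  shows "poly_subst \<phi> v (Poly_Mapping.single e c) = \<phi> c * (\<Prod>k\<in>UNIV. v k ^ Poly_Mapping.lookup e k)"
  by (simp add: poly_subst_eq_pm_eval ring_hom_1.pm_eval_single[OF assms])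

lemma Fract_one_hom: "ring_hom_1 (\<lambda>a :: 'a::idom. Fract a 1)"
  by standard (simp_all add: One_fract_def)

lemma cst_hom: "ring_hom_1 cst"
  unfolding cst_def[abs_def]
  using ring_hom_1_comp[OF ring_hom_1_single Fract_one_hom] .

lemma Fract_one_eq_0_iff: "Fract a 1 = 0 \<longleftrightarrow> (a :: 'a::idom) = 0"
  by (simp add: Zero_fract_def eq_fract)

lemma param_monomial_eq:
  "(\<Prod>k\<in>UNIV. par k ^ Poly_Mapping.lookup e k) = Fract (Poly_Mapping.single e 1) 1"
proof -
  have pow: "Poly_Mapping.single (Poly_Mapping.single p (1::nat)) (1::complex) ^ m =
      Poly_Mapping.single (Poly_Mapping.single p m) 1" for p :: param and m
    by (induction m) (simp_all add: mult_single single_add[symmetric])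
  have prod: "(\<Prod>k\<in>A. Poly_Mapping.single (F k) (1::complex)) = Poly_Mapping.single (sum F A) 1"
    if "finite A" for A :: "param set" and F :: "param \<Rightarrow> param \<Rightarrow>\<^sub>0 nat"
    using that by (induction A) (simp_all add: mult_single)
  have sum: "(\<Sum>k\<in>UNIV. Poly_Mapping.single k (Poly_Mapping.lookup e k)) = e"
    using sum_keys_eq_superset[of UNIV e "\<lambda>k. Poly_Mapping.single k"]
      poly_mapping_eq_sum_single[of e] by simp
  interpret F: ring_hom_1 "\<lambda>a :: parampoly. Fract a 1" by (rule Fract_one_hom)
  show ?thesis
    by (simp add: par_def F.hom_power[symmetric] F.hom_prod[symmetric] pow[unfolded One_nat_def] prod sum)
qed

lemma cst_mult_param_monomial:
  "cst c * (\<Prod>k\<in>UNIV. par k ^ Poly_Mapping.lookup e k) = Fract (Poly_Mapping.single e c) 1"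
  by (simp add: param_monomial_eq cst_def mult_single)

context
  fixes \<phi> :: "complex \<Rightarrow> 'b::field" and v :: "param \<Rightarrow> 'b"
  assumes \<phi>: "ring_hom_1 \<phi>" and inj: "\<And>p. p \<noteq> 0 \<Longrightarrow> poly_subst \<phi> v p \<noteq> 0"
begin

interpretation S: ring_hom_1 "poly_subst \<phi> v"
  by (rule poly_subst_hom[OF \<phi>])

text \<open>Two fractions for the same element satisfy a cross multiplication identity, which the
  substitution preserves; \<open>inj\<close> keeps both denominators nonzero, so every choice made
  by \<open>SOME\<close> has the same value.\<close>

lemma rat_subst_Fract:
  assumes "b \<noteq> 0"
  shows "rat_subst \<phi> v (Fract a b) = poly_subst \<phi> v a / poly_subst \<phi> v b"
  unfolding rat_subst_def
proof (rule some_equality)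
  show "\<exists>a' b'. b' \<noteq> 0 \<and> Fract a b = Fract a' b' \<and>
      poly_subst \<phi> v a / poly_subst \<phi> v b = poly_subst \<phi> v a' / poly_subst \<phi> v b'"
    using assms by blast
next
  fix w
  assume "\<exists>a' b'. b' \<noteq> 0 \<and> Fract a b = Fract a' b' \<and> w = poly_subst \<phi> v a' / poly_subst \<phi> v b'"
  then obtain a' b' where *: "b' \<noteq> 0" "Fract a b = Fract a' b'"
    "w = poly_subst \<phi> v a' / poly_subst \<phi> v b'" by blast
  hence "a * b' = a' * b"
    using assms by (simp add: eq_fract)
  hence "poly_subst \<phi> v a * poly_subst \<phi> v b' = poly_subst \<phi> v a' * poly_subst \<phi> v b"
    by (metis S.hom_mult)
  then show "w = poly_subst \<phi> v a / poly_subst \<phi> v b"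
    using * inj[OF assms] inj[OF *(1)] by (simp add: frac_eq_eq)
qed

lemma rat_subst_hom: "ring_hom_1 (rat_subst \<phi> v)"
proof
  fix x y :: ratfun
  obtain a b where x: "x = Fract a b" "b \<noteq> 0" by (cases x) 
  obtain c d where y: "y = Fract c d" "d \<noteq> 0" by (cases y)
  show "rat_subst \<phi> v (x + y) = rat_subst \<phi> v x + rat_subst \<phi> v y"
    using x y inj by (simp add: rat_subst_Fract S.hom_simps add_frac_eq)
  show "rat_subst \<phi> v (x * y) = rat_subst \<phi> v x * rat_subst \<phi> v y"
    using x y by (simp add: rat_subst_Fract S.hom_simps)
next
  show "rat_subst \<phi> v 1 = 1"
    by (simp add: One_fract_def rat_subst_Fract S.hom_simps)
qed

lemma rat_subst_par: "rat_subst \<phi> v (par p) = v p"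
proof -
  have "(\<Prod>k\<in>UNIV. v k ^ Poly_Mapping.lookup (Poly_Mapping.single p (1::nat)) k) =
      (\<Prod>k\<in>UNIV. if k = p then v k else 1)"
    by (intro prod.cong) (auto simp: lookup_single when_def)
  then show ?thesis
    by (simp add: par_def rat_subst_Fract poly_subst_single[OF \<phi>] S.hom_simps ring_hom_1.hom_one[OF \<phi>])
qed

end

lemma ring_hom_1_inverse:
  fixes \<eta> :: "'a::field \<Rightarrow> 'b::field"
  assumes "ring_hom_1 \<eta>"
  shows "\<eta> (inverse x) = inverse (\<eta> x)"
proof (cases "x = 0")
  case False
  interpret ring_hom_1 \<eta> by fact
  from False have "\<eta> x * \<eta> (inverse x) = 1"
    by (simp add: hom_mult[symmetric] hom_one)
  then show ?thesis
    by (metis inverse_unique)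
qed (simp add: ring_hom_1.hom_zero[OF assms])

lemma par_nonzero [simp]: "par p \<noteq> 0"
  by (simp add: par_def Fract_one_eq_0_iff) (metis lookup_single_eq lookup_zero one_neq_zero)

text \<open>
  Injectivity: after multiplication by a large monomial, the substitution permutes the monomials.
\<close>

lemma poly_subst_inverse_nonzero:
  assumes "p \<noteq> 0"
  shows "poly_subst cst (\<lambda>p. inverse (par p)) p \<noteq> 0"
proof
  assume eq0: "poly_subst cst (\<lambda>p. inverse (par p)) p = 0"
  define N where "N = Max ((\<lambda>(e, k). Poly_Mapping.lookup e k) ` (Poly_Mapping.keys p \<times> (UNIV :: param set)))"
  have N: "Poly_Mapping.lookup e k \<le> N" if "e \<in> Poly_Mapping.keys p" for e k
    unfolding N_def using that by (intro Max_ge) (auto intro!: image_eqI[of _ _ "(e, k)"])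
  define c where "c e = Abs_poly_mapping (\<lambda>k. N - Poly_Mapping.lookup e k)" for e :: "param \<Rightarrow>\<^sub>0 nat"
  have c: "Poly_Mapping.lookup (c e) k = N - Poly_Mapping.lookup e k" for e k
    by (simp add: c_def)
  have c_eq: "c e = c e' \<longleftrightarrow> e = e'" if "e \<in> Poly_Mapping.keys p" "e' \<in> Poly_Mapping.keys p" for e e'
  proof
    assume "c e = c e'"
    hence "N - Poly_Mapping.lookup e k = N - Poly_Mapping.lookup e' k" for k
      by (metis c)
    with N[OF that(1)] N[OF that(2)] show "e = e'"
      by (intro poly_mapping_eqI) (metis diff_diff_cancel)
  qed simp
  define F :: "parampoly" where "F = (\<Sum>e\<in>Poly_Mapping.keys p. Poly_Mapping.single (c e) (Poly_Mapping.lookup p e))"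
  have "Fract F 1 = (\<Sum>e\<in>Poly_Mapping.keys p. cst (Poly_Mapping.lookup p e) * (\<Prod>k\<in>UNIV. par k ^ Poly_Mapping.lookup (c e) k))"
    by (simp add: F_def ring_hom_1.hom_sum[OF Fract_one_hom] cst_mult_param_monomial)
  also have "\<dots> = (\<Sum>e\<in>Poly_Mapping.keys p. cst (Poly_Mapping.lookup p e) *
      (\<Prod>k\<in>UNIV. inverse (par k) ^ Poly_Mapping.lookup e k) * (\<Prod>k\<in>UNIV. par k ^ N))"
  proof (rule sum.cong)
    fix e assume "e \<in> Poly_Mapping.keys p"
    hence "par k ^ (N - Poly_Mapping.lookup e k) = inverse (par k) ^ Poly_Mapping.lookup e k * par k ^ N" for k
      using N by (simp add: power_diff field_simps)
    then show "cst (Poly_Mapping.lookup p e) * (\<Prod>k\<in>UNIV. par k ^ Poly_Mapping.lookup (c e) k) =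
        cst (Poly_Mapping.lookup p e) * (\<Prod>k\<in>UNIV. inverse (par k) ^ Poly_Mapping.lookup e k) * (\<Prod>k\<in>UNIV. par k ^ N)"
      by (simp add: c prod.distrib[symmetric] mult.assoc)
  qed simp
  also have "\<dots> = poly_subst cst (\<lambda>p. inverse (par p)) p * (\<Prod>k\<in>UNIV. par k ^ N)"
    by (simp add: poly_subst_def sum_distrib_right)
  finally have "F = 0"
    by (simp add: eq0 Fract_one_eq_0_iff)
  from assms obtain e where e: "e \<in> Poly_Mapping.keys p" by (metis all_not_in_conv keys_eq_empty)
  have "Poly_Mapping.lookup F (c e) = (\<Sum>e'\<in>Poly_Mapping.keys p. if e' = e then Poly_Mapping.lookup p e' else 0)"
    unfolding F_def lookup_sum using c_eq e
    by (intro sum.cong) (auto simp: lookup_single when_def)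
  with e \<open>F = 0\<close> show False by (auto simp: in_keys_iff)
qed

lemma bar_par_hom: "ring_hom_1 bar_par"
  unfolding bar_par_def
  by (rule rat_subst_hom[OF cst_hom poly_subst_inverse_nonzero])

lemma bar_par_par: "bar_par (par p) = inverse (par p)"
  unfolding bar_par_def
  by (rule rat_subst_par[OF cst_hom poly_subst_inverse_nonzero])

lemma fls_const_hom: "ring_hom_1 (\<lambda>c. fls_const (cst c))"
proof -
  have "ring_hom_1 (fls_const :: ratfun \<Rightarrow> _)"
    by standard (simp_all add: fls_plus_const fls_const_mult_const)
  from ring_hom_1_comp[OF cst_hom this] show ?thesis .
qed

text \<open>
  Injectivity: the coefficient of the \<open>d\<close>-th power of the degree marker is the part of degree
  \<open>d\<close> in the small parameters.
\<close>

lemma poly_subst_gpar_nonzero: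
  assumes "p \<noteq> 0"
  shows "poly_subst (\<lambda>c. fls_const (cst c)) (\<lambda>p. fps_to_fls (gpar p)) p \<noteq> 0"
proof
  assume eq0: "poly_subst (\<lambda>c. fls_const (cst c)) (\<lambda>p. fps_to_fls (gpar p)) p = 0"
  define w where "w k = (if k = U0h \<or> k = Unh then 0 else 1 :: nat)" for k
  define d where "d e = (\<Sum>k\<in>UNIV. w k * Poly_Mapping.lookup e k)" for e :: "param \<Rightarrow>\<^sub>0 nat"
  have gpar_eq: "gpar k = fps_const (par k) * fps_X ^ w k" for k
    by (simp add: gpar_def w_def)
  have prod: "(\<Prod>k\<in>UNIV. gpar k ^ Poly_Mapping.lookup e k) =
      fps_const (Fract (Poly_Mapping.single e 1) 1) * fps_X ^ d e" for e
  proof -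
    have "(\<Prod>k\<in>UNIV. gpar k ^ Poly_Mapping.lookup e k) =
      (\<Prod>k\<in>UNIV. fps_const (par k ^ Poly_Mapping.lookup e k)) * (\<Prod>k\<in>UNIV. fps_X ^ (w k * Poly_Mapping.lookup e k))"
      by (simp add: gpar_eq power_mult_distrib prod.distrib power_mult fps_const_power)
    also have "(\<Prod>k\<in>UNIV. fps_const (par k ^ Poly_Mapping.lookup e k)) = fps_const (\<Prod>k\<in>UNIV. par k ^ Poly_Mapping.lookup e k)"
      by (rule ring_hom_1.hom_prod[symmetric]) (standard, simp_all)
    also have "(\<Prod>k\<in>UNIV. fps_X ^ (w k * Poly_Mapping.lookup e k)) = (fps_X ^ d e :: ratfun fps)"
      by (simp add: d_def power_sum)
    finally show ?thesis by (simp add: param_monomial_eq)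
  qed
  interpret T: ring_hom_1 "fps_to_fls :: ratfun fps \<Rightarrow> _"
    by standard (simp_all add: fls_times_fps_to_fls fps_to_fls_plus)
  have "poly_subst (\<lambda>c. fls_const (cst c)) (\<lambda>p. fps_to_fls (gpar p)) p =
     fps_to_fls (\<Sum>e\<in>Poly_Mapping.keys p. fps_const (cst (Poly_Mapping.lookup p e)) * (\<Prod>k\<in>UNIV. gpar k ^ Poly_Mapping.lookup e k))"
    by (simp add: poly_subst_def T.hom_simps)
  also have "(\<Sum>e\<in>Poly_Mapping.keys p. fps_const (cst (Poly_Mapping.lookup p e)) * (\<Prod>k\<in>UNIV. gpar k ^ Poly_Mapping.lookup e k))
    = (\<Sum>e\<in>Poly_Mapping.keys p. fps_const (Fract (Poly_Mapping.single e (Poly_Mapping.lookup p e)) 1) * fps_X ^ d e)"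
    by (simp add: prod mult.assoc[symmetric] cst_def mult_single)
  finally have sum0: "(\<Sum>e\<in>Poly_Mapping.keys p. fps_const (Fract (Poly_Mapping.single e (Poly_Mapping.lookup p e)) 1) * fps_X ^ d e) = (0 :: ratfun fps)"
    by (simp add: eq0)
  from assms obtain e where e: "e \<in> Poly_Mapping.keys p" by (metis all_not_in_conv keys_eq_empty)
  define F :: parampoly where "F = (\<Sum>e'\<in>Poly_Mapping.keys p. if d e' = d e then Poly_Mapping.single e' (Poly_Mapping.lookup p e') else 0)"
  have "Fract F 1 = fps_nth (\<Sum>e\<in>Poly_Mapping.keys p. fps_const (Fract (Poly_Mapping.single e (Poly_Mapping.lookup p e)) 1) * fps_X ^ d e) (d e)"
    unfolding F_def ring_hom_1.hom_sum[OF Fract_one_hom] fps_sum_nth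
    by (intro sum.cong) (auto simp: fps_X_power_nth Zero_fract_def)
  hence "F = 0"
    by (simp add: sum0 Fract_one_eq_0_iff)
  have "Poly_Mapping.lookup F e = (\<Sum>e'\<in>Poly_Mapping.keys p. if e' = e then Poly_Mapping.lookup p e' else 0)"
    unfolding F_def lookup_sum
    by (intro sum.cong) (auto simp: lookup_single when_def)
  with e \<open>F = 0\<close> show False by (auto simp: in_keys_iff)
qed

lemma expand_hom: "ring_hom_1 expand"
  unfolding expand_def
  by (rule rat_subst_hom[OF fls_const_hom poly_subst_gpar_nonzero])

lemma expand_par: "expand (par p) = fps_to_fls (gpar p)"
  unfolding expand_def
  by (rule rat_subst_par[OF fls_const_hom poly_subst_gpar_nonzero])

interpretation expand: ring_hom_1 expand by (rule expand_hom)
interpretation bar_par: ring_hom_1 bar_par by (rule bar_par_hom)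

lemma expand_divide: "expand (a / b) = expand a / expand b"
  by (simp add: divide_inverse expand.hom_mult ring_hom_1_inverse[OF expand_hom])

lemma expand_nonzero: "a \<noteq> 0 \<Longrightarrow> expand a \<noteq> 0"
  using expand.hom_mult[of a "inverse a"] by (auto simp: expand.hom_one)

section \<open>Signed permutations acting on exponents and Laurent polynomials\<close>

text \<open>The convention x_(-k) = 1/x_k at the level of exponents: a signed permutation acts just
  by applying it to the signed index, which removes the case distinctions on signs from all later
  formulas.\<close>

definition signed_eps :: "int \<Rightarrow> expo" where
  "signed_eps a = Poly_Mapping.single (nat \<bar>a\<bar>) (sgn a)"

text \<open>
  Unlike \<open>act_expo\<close>, the next action leaves the unused index \<open>0\<close> alone, so that signed
  permutations act by automorphisms on the whole group algebra.
\<close>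

definition signed_act_expo :: "(int \<Rightarrow> int) \<Rightarrow> expo \<Rightarrow> expo" where
  "signed_act_expo w \<nu> = (\<Sum>i\<in>Poly_Mapping.keys \<nu>. Poly_Mapping.single (nat \<bar>w (int i)\<bar>)
     ((if i = 0 then 1 else sgn (w (int i))) * Poly_Mapping.lookup \<nu> i))"

definition signed_act :: "(int \<Rightarrow> int) \<Rightarrow> laurent \<Rightarrow> laurent" where
  "signed_act w = pm_eval (Poly_Mapping.single 0) (\<lambda>\<nu>. Poly_Mapping.single (signed_act_expo w \<nu>) 1)"

lemma signed_act_expo_add: "signed_act_expo w (\<mu> + \<nu>) = signed_act_expo w \<mu> + signed_act_expo w \<nu>"
  unfolding signed_act_expo_def
  by (rule sum_keys_add[of "\<lambda>i c. Poly_Mapping.single (nat \<bar>w (int i)\<bar>) ((if i = 0 then 1 else sgn (w (int i))) * c)"])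
     (simp_all add: single_add[symmetric] distrib_left)

lemma signed_act_expo_0 [simp]: "signed_act_expo w 0 = 0"
  by (simp add: signed_act_expo_def)

lemma signed_act_expo_uminus: "signed_act_expo w (- \<nu>) = - signed_act_expo w \<nu>"
  using signed_act_expo_add[of w \<nu> "- \<nu>"] by (simp add: eq_neg_iff_add_eq_0 add.commute)

lemma signed_act_expo_single:
  "signed_act_expo w (Poly_Mapping.single i c) =
     Poly_Mapping.single (nat \<bar>w (int i)\<bar>) ((if i = 0 then 1 else sgn (w (int i))) * c)"
  by (simp add: signed_act_expo_def)

lemma signed_act_hom: "ring_hom_1 (signed_act w)"
  unfolding signed_act_def
  by (rule ring_hom_1.pm_eval_hom[OF ring_hom_1_single]) (simp_all add: signed_act_expo_add mult_single)

lemma signed_act_single: "signed_act w (Poly_Mapping.single \<nu> c) = Poly_Mapping.single (signed_act_expo w \<nu>) c"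
  by (simp add: signed_act_def ring_hom_1.pm_eval_single[OF ring_hom_1_single] mult_single)

lemma bar_eq_pm_eval:
  "bar = pm_eval (\<lambda>c. Poly_Mapping.single 0 (bar_par c)) (\<lambda>\<nu>. Poly_Mapping.single (- \<nu>) 1)"
  by (simp add: bar_def[abs_def] pm_eval_def[abs_def] mult_single)

lemma bar_hom: "ring_hom_1 bar"
  unfolding bar_eq_pm_eval
  by (rule ring_hom_1.pm_eval_hom[OF ring_hom_1_comp[OF bar_par_hom ring_hom_1_single]])
     (simp_all add: mult_single)

lemma bar_single: "bar (Poly_Mapping.single \<nu> c) = Poly_Mapping.single (- \<nu>) (bar_par c)"
  by (simp add: bar_eq_pm_eval mult_single
      ring_hom_1.pm_eval_single[OF ring_hom_1_comp[OF bar_par_hom ring_hom_1_single]])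

interpretation bar: ring_hom_1 bar by (rule bar_hom)
interpretation signed_act: ring_hom_1 "signed_act w" for w by (rule signed_act_hom)

lemma signed_act_bar: "signed_act w (bar f) = bar (signed_act w f)"
  by (induction f rule: poly_mapping_add_induct)
     (simp_all add: bar.hom_simps signed_act.hom_simps bar_single signed_act_single signed_act_expo_uminus)

text \<open>The two actions on exponents treat only index 0 differently, and that index does not
  occur in elements of \<open>laurent_ring n\<close>.\<close>

lemma act_eq_signed_act:
  assumes "f \<in> laurent_ring n"
  shows "act w f = signed_act w f"
proof -
  have "act_expo w \<nu> = signed_act_expo w \<nu>" if "\<nu> \<in> Poly_Mapping.keys f" for \<nu>
    unfolding act_expo_def signed_act_expo_def using assms that
    by (intro sum.cong) (auto simp: laurent_ring_def subset_iff)
  then show ?thesis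
    by (simp add: act_def signed_act_def pm_eval_def mult_single)
qed

section \<open>The group of signed permutations\<close>

context
  fixes n :: nat and w :: "int \<Rightarrow> int"
  assumes w: "w \<in> W_fin n"
begin

lemma W_minus: "w (- k) = - w k"
  using w by (simp add: W_fin_def)

lemma W_zero: "w 0 = 0"
  using W_minus[of 0] by simp

lemma W_inj: "w a = w b \<longleftrightarrow> a = b"
  using w by (auto simp: W_fin_def dest: permutes_inj injD)

lemma W_eq_0_iff: "w a = 0 \<longleftrightarrow> a = 0"
  using W_inj[of a 0] by (simp add: W_zero)

lemma W_abs_eq_iff: "\<bar>w a\<bar> = \<bar>w b\<bar> \<longleftrightarrow> \<bar>a\<bar> = \<bar>b\<bar>"
  using W_inj[of a b] W_inj[of a "- b"] by (auto simp: W_minus abs_eq_iff)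

lemma W_bounds: "1 \<le> i \<Longrightarrow> i \<le> n \<Longrightarrow> w (int i) \<noteq> 0 \<and> \<bar>w (int i)\<bar> \<le> int n"
proof -
  assume i: "1 \<le> i" "i \<le> n"
  hence "w (int i) \<in> {- int n..int n}"
    using w permutes_in_image[of w "{- int n..int n}" "int i"] by (auto simp: W_fin_def)
  with i show ?thesis by (auto simp: W_eq_0_iff)
qed

lemma W_outside: "i > n \<Longrightarrow> w (int i) = int i"
  using w permutes_not_in[of w "{- int n..int n}" "int i"] by (auto simp: W_fin_def)

lemma W_perm_inj: "inj_on (\<lambda>i. nat \<bar>w (int i)\<bar>) A"
  by (intro inj_onI) (use W_abs_eq_iff in \<open>force simp: nat_eq_iff2\<close>)

lemma W_perm_bij: "bij_betw (\<lambda>i. nat \<bar>w (int i)\<bar>) {1..n} {1..n}"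
proof -
  have "(\<lambda>i. nat \<bar>w (int i)\<bar>) ` {1..n} \<subseteq> {1..n}"
  proof (rule image_subsetI)
    fix i assume "i \<in> {1..n}"
    then show "nat \<bar>w (int i)\<bar> \<in> {1..n}" using W_bounds[of i] by auto
  qed
  with W_perm_inj show ?thesis
    by (metis bij_betw_def endo_inj_surj finite_atLeastAtMost)
qed

lemma signed_act_expo_signed_eps: "a \<noteq> 0 \<Longrightarrow> signed_act_expo w (signed_eps a) = signed_eps (w a)"
  using W_eq_0_iff[of a] W_minus[of "- a"]
  by (cases "a > 0") (auto simp: signed_eps_def signed_act_expo_single sgn_if)

end

lemma W_comp: "v \<in> W_fin n \<Longrightarrow> w \<in> W_fin n \<Longrightarrow> v \<circ> w \<in> W_fin n"
  by (auto simp: W_fin_def permutes_compose)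

lemma W_id: "id \<in> W_fin n"
  by (simp add: W_fin_def permutes_id)

lemma W_inv:
  assumes "w \<in> W_fin n"
  shows "inv w \<in> W_fin n" "w \<circ> inv w = id" "inv w \<circ> w = id"
proof -
  have p: "w permutes {- int n..int n}" using assms by (simp add: W_fin_def)
  show *: "w \<circ> inv w = id" "inv w \<circ> w = id"
    using permutes_inv_o[OF p] by auto
  have "inv w (- k) = - inv w k" for k
    by (metis W_inj[OF assms] W_minus[OF assms] p permutes_inverses(1))
  then show "inv w \<in> W_fin n"
    using permutes_inv[OF p] by (simp add: W_fin_def)
qed

lemma W_finite: "finite (W_fin n)"
  using finite_permutations[of "{- int n..int n}"] by (simp add: W_fin_def)

lemma signed_act_expo_comp:
  assumes "v \<in> W_fin n" "w \<in> W_fin n"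
  shows "signed_act_expo v (signed_act_expo w \<nu>) = signed_act_expo (v \<circ> w) \<nu>"
proof (induction \<nu> rule: poly_mapping_add_induct)
  case (add k c \<nu>)
  have "signed_act_expo v (signed_act_expo w (Poly_Mapping.single k c)) = signed_act_expo (v \<circ> w) (Poly_Mapping.single k c)"
    using W_minus[OF assms(1), of "w (int k)"] W_minus[OF assms(1), of "- w (int k)"] W_eq_0_iff[OF assms(2), of "int k"]
      W_zero[OF assms(1)] W_zero[OF assms(2)]
    by (cases "w (int k) > 0"; cases "w (int k) = 0")
       (simp_all add: signed_act_expo_single sgn_if mult.assoc)
  with add show ?case by (simp only: signed_act_expo_add)
qed simp

lemma signed_act_expo_id: "signed_act_expo id \<nu> = \<nu>"
  by (induction \<nu> rule: poly_mapping_add_induct) (simp_all add: signed_act_expo_add signed_act_expo_single sgn_if)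

lemma signed_act_expo_eq_iff:
  assumes "w \<in> W_fin n"
  shows "signed_act_expo w \<mu> = signed_act_expo w \<nu> \<longleftrightarrow> \<mu> = \<nu>"
  by (metis W_inv[OF assms] assms signed_act_expo_comp signed_act_expo_id)

lemma signed_act_expo_surj:
  assumes "w \<in> W_fin n"
  obtains \<mu> where "\<nu> = signed_act_expo w \<mu>"
  by (metis W_inv[OF assms] assms signed_act_expo_comp signed_act_expo_id)

lemma signed_act_comp:
  assumes "v \<in> W_fin n" "w \<in> W_fin n"
  shows "signed_act v (signed_act w f) = signed_act (v \<circ> w) f"
  by (induction f rule: poly_mapping_add_induct)
     (simp_all add: signed_act.hom_simps signed_act_single signed_act_expo_comp[OF assms, unfolded o_def] o_def)

lemma lookup_signed_act:
  assumes "w \<in> W_fin n"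
  shows "Poly_Mapping.lookup (signed_act w f) (signed_act_expo w \<nu>) = Poly_Mapping.lookup f \<nu>"
  by (induction f rule: poly_mapping_add_induct)
     (simp_all add: signed_act.hom_simps signed_act_single lookup_add lookup_single signed_act_expo_eq_iff[OF assms])

lemma lookup_signed_act_expo:
  assumes "w \<in> W_fin n"
  shows "Poly_Mapping.lookup (signed_act_expo w \<nu>) (nat \<bar>w (int i)\<bar>) =
    (if i = 0 then 1 else sgn (w (int i))) * Poly_Mapping.lookup \<nu> i"
proof (induction \<nu> rule: poly_mapping_add_induct)
  case (add k c \<nu>)
  have "nat \<bar>w (int k)\<bar> = nat \<bar>w (int i)\<bar> \<longleftrightarrow> k = i"
    using W_perm_inj[OF assms, of UNIV] by (auto dest: injD)
  with add show ?case
    by (auto simp: signed_act_expo_add signed_act_expo_single lookup_add lookup_single when_def distrib_left)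
qed simp

lemma sum_W_translate:
  assumes "v \<in> W_fin n"
  shows "(\<Sum>w\<in>W_fin n. F (v \<circ> w)) = (\<Sum>w\<in>W_fin n. F w)"
proof (rule sum.reindex_bij_witness[of _ "\<lambda>w. inv v \<circ> w" "\<lambda>w. v \<circ> w"])
  fix w assume w: "w \<in> W_fin n"
  show "inv v \<circ> (v \<circ> w) = w" "v \<circ> (inv v \<circ> w) = w"
    using W_inv[OF assms] by (simp_all add: o_assoc)
  show "v \<circ> w \<in> W_fin n" "inv v \<circ> w \<in> W_fin n"
    using w W_inv(1)[OF assms] assms by (auto intro: W_comp)
qed simp

section \<open>Pairs of indices\<close>

definition index_pairs :: "nat \<Rightarrow> (nat \<times> nat) set" where
  "index_pairs n = (SIGMA i:{1..n}. {i+1..n})"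

lemma finite_index_pairs [simp]: "finite (index_pairs n)"
  by (simp add: index_pairs_def)

lemma index_pairs_iff: "(i, j) \<in> index_pairs n \<longleftrightarrow> 1 \<le> i \<and> i < j \<and> j \<le> n"
  by (auto simp: index_pairs_def)

lemma prod_index_pairs: "(\<Prod>i=1..n. \<Prod>j=i+1..n. F i j) = (\<Prod>(i,j)\<in>index_pairs n. F i j)"
  by (simp add: index_pairs_def prod.Sigma)

lemma sum_index_pairs: "(\<Sum>i=1..n. \<Sum>j=i+1..n. F i j) = (\<Sum>(i,j)\<in>index_pairs n. F i j)"
  by (simp add: index_pairs_def sum.Sigma)

text \<open>A permutation of the indices permutes the two-element subsets; these are encoded as
  increasing pairs, so the image has to be sorted again.\<close>

lemma bij_betw_sorted_pairs:
  assumes "bij_betw \<sigma> {1..n} {1..n}"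
  shows "bij_betw (\<lambda>(i, j). (min (\<sigma> i) (\<sigma> j), max (\<sigma> i) (\<sigma> j))) (index_pairs n) (index_pairs n)"
    (is "bij_betw ?f _ _")
proof -
  have inj: "\<sigma> i = \<sigma> j \<longleftrightarrow> i = j" if "i \<in> {1..n}" "j \<in> {1..n}" for i j
    using inj_on_eq_iff[OF bij_betw_imp_inj_on[OF assms]] that by simp
  have mem: "\<sigma> i \<in> {1..n}" if "i \<in> {1..n}" for i
    using bij_betwE[OF assms] that by blast
  have sub: "?f ` index_pairs n \<subseteq> index_pairs n"
  proof (rule image_subsetI, clarify)
    fix i j assume ij: "(i, j) \<in> index_pairs n"
    then show "(min (\<sigma> i) (\<sigma> j), max (\<sigma> i) (\<sigma> j)) \<in> index_pairs n"
      using inj[of i j] mem[of i] mem[of j] by (auto simp: index_pairs_iff min_def max_def)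
  qed
  have "inj_on ?f (index_pairs n)"
  proof (rule inj_onI, clarify)
    fix i j k l assume *: "(i, j) \<in> index_pairs n" "(k, l) \<in> index_pairs n"
      "min (\<sigma> i) (\<sigma> j) = min (\<sigma> k) (\<sigma> l)" "max (\<sigma> i) (\<sigma> j) = max (\<sigma> k) (\<sigma> l)"
    hence "\<sigma> i = \<sigma> k \<and> \<sigma> j = \<sigma> l \<or> \<sigma> i = \<sigma> l \<and> \<sigma> j = \<sigma> k"
      by (auto simp: min_def max_def split: if_splits)
    with *(1,2) inj[of i k] inj[of j l] inj[of i l] inj[of j k] show "i = k \<and> j = l"
      by (auto simp: index_pairs_iff)
  qed
  with sub show ?thesis
    unfolding bij_betw_def using endo_inj_surj[OF finite_index_pairs] by blast
qed

lemma prod_index_pairs_reindex: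
  assumes "bij_betw \<sigma> {1..n} {1..n}"
  shows "(\<Prod>(i,j)\<in>index_pairs n. F (min (\<sigma> i) (\<sigma> j)) (max (\<sigma> i) (\<sigma> j))) = (\<Prod>(i,j)\<in>index_pairs n. F i j)"
  using prod.reindex_bij_betw[OF bij_betw_sorted_pairs[OF assms], of "\<lambda>(i, j). F i j"]
  by (simp add: case_prod_beta)

section \<open>The length statistics\<close>

definition pair_length :: "int \<Rightarrow> int \<Rightarrow> nat" where
  "pair_length a b = (if \<bar>a\<bar> < \<bar>b\<bar> then (if a > 0 then 0 else 2) else 1)"

text \<open>
  These count the roots \<open>e\<^sub>i \<plusminus> e\<^sub>j\<close> with \<open>i < j\<close> and the \<open>e\<^sub>i\<close> that \<open>w\<close> makes negative: if
  \<open>\<bar>w(i)\<bar> < \<bar>w(j)\<bar>\<close>, the signs of \<open>w(e\<^sub>i \<plusminus> e\<^sub>j)\<close> are both that of \<open>w(i)\<close>, and otherwise they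
  are opposite.
\<close>

definition ell_s :: "nat \<Rightarrow> (int \<Rightarrow> int) \<Rightarrow> nat" where
  "ell_s n w = (\<Sum>(i,j)\<in>index_pairs n. pair_length (w (int i)) (w (int j)))"

definition ell_d :: "nat \<Rightarrow> (int \<Rightarrow> int) \<Rightarrow> nat" where
  "ell_d n w = (\<Sum>i=1..n. if w (int i) < 0 then 1 else 0)"

lemma simple_refl_int:
  assumes "1 \<le> i" "i < n"
  shows "simple_refl n i (int k) = int (Transposition.transpose i (i + 1) k)"
  using assms by (auto simp: simple_refl_def Transposition.transpose_def)

lemma simple_refl_last:
  "simple_refl n n k = (if k = int n then - int n else if k = - int n then int n else k)"
  by (auto simp: simple_refl_def Transposition.transpose_def)

lemma simple_refl_in_W:
  assumes "1 \<le> i" "i \<le> n"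
  shows "simple_refl n i \<in> W_fin n"
proof (cases "i < n")
  case True
  have "simple_refl n i permutes {- int n..int n}"
    unfolding simple_refl_def if_P[OF True]
    by (intro permutes_compose permutes_swap_id) (use assms True in auto)
  moreover have "simple_refl n i (- k) = - simple_refl n i k" for k
    using assms True by (auto simp: simple_refl_def Transposition.transpose_def)
  ultimately show ?thesis by (simp add: W_fin_def)
next
  case False
  have "simple_refl n i permutes {- int n..int n}"
    unfolding simple_refl_def if_not_P[OF False]
    by (intro permutes_swap_id) auto
  moreover have "simple_refl n i (- k) = - simple_refl n i k" for k
    using False by (auto simp: simple_refl_def Transposition.transpose_def)
  ultimately show ?thesis by (simp add: W_fin_def)
qed

lemma simple_refl_involution: "1 \<le> i \<Longrightarrow> i \<le> n \<Longrightarrow> simple_refl n i \<circ> simple_refl n i = id"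
  by (auto simp: simple_refl_def Transposition.transpose_def fun_eq_iff)

text \<open>Exchanging the neighbours i and i + 1 preserves the order of every pair except (i, i +
  1), so the remaining summands are merely permuted. The additive form avoids subtraction of natural
  numbers.\<close>

lemma ell_s_simple:
  assumes "1 \<le> i" "i < n"
  shows "ell_s n (w \<circ> simple_refl n i) + pair_length (w (int i)) (w (int (i + 1))) =
    ell_s n w + pair_length (w (int (i + 1))) (w (int i))"
proof -
  let ?s = "Transposition.transpose i (i + 1)"
  let ?R = "index_pairs n - {(i, i + 1)}"
  have *: "sum F (index_pairs n) = F (i, i + 1) + sum F ?R" for F :: "nat \<times> nat \<Rightarrow> nat"
    using assms by (intro sum.remove) (auto simp: index_pairs_iff)
  have "(\<Sum>(j,k)\<in>?R. pair_length (w (int (?s j))) (w (int (?s k)))) = (\<Sum>(j,k)\<in>?R. pair_length (w (int j)) (w (int k)))"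
    by (rule sum.reindex_bij_witness[of _ "map_prod ?s ?s" "map_prod ?s ?s"])
       (use assms in \<open>auto simp: index_pairs_iff Transposition.transpose_def split: if_splits\<close>)
  then show ?thesis
    by (simp add: ell_s_def * simple_refl_int[OF assms])
qed

lemma ell_d_simple:
  assumes "1 \<le> i" "i < n"
  shows "ell_d n (w \<circ> simple_refl n i) = ell_d n w"
  unfolding ell_d_def o_apply simple_refl_int[OF assms]
  by (rule sum.reindex_bij_witness[of _ "Transposition.transpose i (i + 1)" "Transposition.transpose i (i + 1)"])
     (use assms in \<open>auto simp: Transposition.transpose_def split: if_splits\<close>)

text \<open>Index n occurs only as the second member of a pair, and \<open>pair_length\<close> sees
  its second argument only through the absolute value.\<close>

lemma ell_s_last:
  assumes "w \<in> W_fin n"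
  shows "ell_s n (w \<circ> simple_refl n n) = ell_s n w"
  unfolding ell_s_def
  by (intro sum.cong) (auto simp: index_pairs_iff simple_refl_last pair_length_def W_minus[OF assms])

lemma ell_d_last:
  assumes "w \<in> W_fin n" "1 \<le> n"
  shows "ell_d n (w \<circ> simple_refl n n) + (if w (int n) < 0 then 1 else 0) =
    ell_d n w + (if w (int n) < 0 then 0 else 1)"
proof -
  have *: "sum F {1..n} = sum F {1..<n} + F n" for F :: "nat \<Rightarrow> nat"
    using assms(2) by (metis sum.last_plus add.commute)
  have "(\<Sum>i=1..<n. if w (simple_refl n n (int i)) < 0 then 1 else 0 :: nat) = (\<Sum>i=1..<n. if w (int i) < 0 then 1 else 0)"
    by (intro sum.cong) (auto simp: simple_refl_last)
  moreover have "w (int n) \<noteq> 0" using W_bounds[OF assms(1), of n] assms(2) by simp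
  ultimately show ?thesis
    unfolding ell_d_def * by (simp add: simple_refl_last W_minus[OF assms(1)])
qed

lemma pair_length_swap:
  assumes "\<bar>a\<bar> \<noteq> \<bar>b\<bar>"
  shows "pair_length a b = pair_length b a + 1 \<or> pair_length b a = pair_length a b + 1"
  using assms by (auto simp: pair_length_def)

text \<open>Every letter of a word affects only its own statistic. This gives separate lower bounds
  for the two letter counts, and so makes \<open>len_s\<close> and \<open>len_d\<close> independent
  of the reduced word that \<open>arg_min\<close> selects.\<close>

lemma ell_change:
  assumes w: "w \<in> W_fin n" and i: "1 \<le> i" "i \<le> n"
  defines "w' \<equiv> w \<circ> simple_refl n i"
  shows "if i < n then ell_d n w' = ell_d n w \<and> (ell_s n w' = ell_s n w + 1 \<or> ell_s n w = ell_s n w' + 1)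
    else ell_s n w' = ell_s n w \<and> (ell_d n w' = ell_d n w + 1 \<or> ell_d n w = ell_d n w' + 1)"
proof (cases "i < n")
  case True
  have "\<bar>w (int i)\<bar> \<noteq> \<bar>w (int (i + 1))\<bar>"
    using W_abs_eq_iff[OF w] by simp
  from pair_length_swap[OF this] ell_s_simple[OF i(1) True, of w] ell_d_simple[OF i(1) True, of w]
  show ?thesis unfolding w'_def using True by auto
next
  case False
  hence "i = n" using i by simp
  with ell_s_last[OF w] ell_d_last[OF w] i show ?thesis
    unfolding w'_def by (auto split: if_splits)
qed

text \<open>Starting from w(n) > 0, the absence of descents propagates positivity and strict growth
  down to index 1. An increasing sequence of n integers between 1 and n can only be 1, ...,
  n.\<close>

lemma no_descent_imp_id:
  assumes w: "w \<in> W_fin n"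
    and nd: "\<And>i. 1 \<le> i \<Longrightarrow> i < n \<Longrightarrow> pair_length (w (int i)) (w (int (i + 1))) \<le> pair_length (w (int (i + 1))) (w (int i))"
    and nl: "1 \<le> n \<Longrightarrow> w (int n) > 0"
  shows "w = id"
proof -
  have step: "w (int i) > 0 \<and> w (int i) < w (int (i + 1))"
    if "1 \<le> i" "i < n" "w (int (i + 1)) > 0" for i
  proof -
    have "\<bar>w (int i)\<bar> \<noteq> \<bar>w (int (i + 1))\<bar>"
      using W_abs_eq_iff[OF w] by simp
    with nd[OF that(1,2)] that(3) show ?thesis
      by (auto simp: pair_length_def split: if_splits)
  qed
  have pos: "w (int i) > 0" if "1 \<le> i" "i \<le> n" for i
    using that(2,1)
  proof (induction rule: inc_induct)
    case base
    then show ?case using nl by simp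
  next
    case (step m)
    then show ?case using \<open>\<And>i. 1 \<le> i \<Longrightarrow> i < n \<Longrightarrow> w (int (i + 1)) > 0 \<Longrightarrow> _\<close>[of m] by simp
  qed
  have mono: "w (int i) < w (int (i + 1))" if "1 \<le> i" "i < n" for i
    using step[OF that] pos[of "i + 1"] that by simp
  have ge: "1 \<le> i \<Longrightarrow> i \<le> n \<Longrightarrow> int i \<le> w (int i)" for i
  proof (induction i rule: nat_induct_at_least[of 1, consumes 1])
    case base
    then show ?case using pos[of 1] by simp
  next
    case (Suc i)
    then show ?case using mono[of i] by simp
  qed
  have le: "w (int i) \<le> int i" if "1 \<le> i" "i \<le> n" for i
    using that(2,1)
  proof (induction rule: inc_induct)
    case base
    then show ?case using W_bounds[OF w, of n] by auto
  next
    case (step m)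
    then show ?case using mono[of m] by simp
  qed
  have nat: "w (int i) = int i" for i
    using ge[of i] le[of i] W_outside[OF w, of i] W_zero[OF w]
    by (cases "i = 0"; cases "i \<le> n") auto
  show "w = id"
  proof
    fix k :: int
    show "w k = id k"
      using nat[of "nat k"] nat[of "nat (- k)"] W_minus[OF w, of k] by (cases "k \<ge> 0") auto
  qed
qed

lemma foldr_comp_append: "foldr (\<circ>) (xs @ [g]) id = foldr (\<circ>) xs id \<circ> g"
  by (induction xs) (auto simp: o_assoc)

lemma is_word_snoc:
  assumes "is_word n w u" "1 \<le> i" "i \<le> n"
  shows "is_word n (w \<circ> simple_refl n i) (u @ [i])"
proof -
  have "foldr (\<circ>) (map (simple_refl n) u @ [simple_refl n i]) id = w \<circ> simple_refl n i"
    unfolding foldr_comp_append using assms(1) by (simp add: is_word_def)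
  with assms show ?thesis by (simp add: is_word_def)
qed

lemma is_word_bounds:
  assumes "is_word n w u"
  shows "w \<in> W_fin n \<and> ell_s n w \<le> length (filter (\<lambda>i. i < n) u) \<and> ell_d n w \<le> length (filter (\<lambda>i. i = n) u)"
  using assms
proof (induction u arbitrary: w rule: rev_induct)
  case Nil
  hence "w = id" by (simp add: is_word_def)
  then show ?case
    by (auto simp: W_id[unfolded id_def] id_def ell_s_def ell_d_def index_pairs_iff pair_length_def intro!: sum.neutral)
next
  case (snoc i u)
  define v where "v = foldr (\<circ>) (map (simple_refl n) u) id"
  have sub: "set (u @ [i]) \<subseteq> {1..n}" and eq: "foldr (\<circ>) (map (simple_refl n) (u @ [i])) id = w"
    using snoc.prems unfolding is_word_def by blast+
  from sub have u: "set u \<subseteq> {1..n}" and i: "1 \<le> i" "i \<le> n" by auto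
  from u have v: "is_word n v u"
    by (simp add: is_word_def v_def)
  have w_eq: "w = v \<circ> simple_refl n i"
    using eq unfolding map_append list.map foldr_comp_append v_def by (rule sym)
  have "w \<in> W_fin n"
    unfolding w_eq using snoc.IH[OF v] simple_refl_in_W[OF i] by (blast intro: W_comp)
  with snoc.IH[OF v] ell_change[of v n i, folded w_eq] i show ?case
    by (cases "i < n") auto
qed

text \<open>Unless \<open>w\<close> is the identity, some generator is a descent and lowers the
  total by exactly one; a word for the shorter element is extended by that letter.\<close>

lemma exists_word:
  assumes "w \<in> W_fin n"
  shows "\<exists>u. is_word n w u \<and> length u = ell_s n w + ell_d n w"
  using assms
proof (induction "ell_s n w + ell_d n w" arbitrary: w rule: less_induct)
  case less
  have descent: ?case if i: "1 \<le> i" "i \<le> n"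
    and lt: "ell_s n (w \<circ> simple_refl n i) + ell_d n (w \<circ> simple_refl n i) < ell_s n w + ell_d n w" for i
  proof -
    let ?v = "w \<circ> simple_refl n i"
    have "?v \<in> W_fin n" using less.prems simple_refl_in_W[OF i] by (rule W_comp)
    from less.hyps[OF lt this] obtain u where u: "is_word n ?v u" "length u = ell_s n ?v + ell_d n ?v"
      by blast
    have "?v \<circ> simple_refl n i = w"
      by (simp add: o_assoc[symmetric] simple_refl_involution[OF i])
    with is_word_snoc[OF u(1) i] have "is_word n w (u @ [i])" by simp
    moreover have "length (u @ [i]) = ell_s n w + ell_d n w"
      using u(2) ell_change[OF less.prems i] lt by (auto split: if_splits)
    ultimately show ?case by blast
  qed
  show ?case
  proof (cases "(\<forall>i. 1 \<le> i \<and> i < n \<longrightarrow> pair_length (w (int i)) (w (int (i + 1))) \<le> pair_length (w (int (i + 1))) (w (int i))) \<and>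
      (1 \<le> n \<longrightarrow> w (int n) > 0)")
    case True
    hence id: "w = id" using no_descent_imp_id[OF less.prems] by blast
    have "is_word n w []" by (simp add: is_word_def id)
    moreover have "ell_s n w + ell_d n w = 0"
      by (auto simp: id ell_s_def ell_d_def index_pairs_iff pair_length_def intro!: sum.neutral)
    ultimately show ?thesis by force
  next
    case False
    then consider i where "1 \<le> i" "i < n" "pair_length (w (int i)) (w (int (i + 1))) > pair_length (w (int (i + 1))) (w (int i))"
      | "1 \<le> n" "w (int n) \<le> 0" by force
    then show ?thesis
    proof cases
      case 1
      with ell_s_simple[OF 1(1,2), of w] ell_d_simple[OF 1(1,2), of w] show ?thesis
        by (intro descent[of i]) auto
    next
      case 2
      moreover have "w (int n) \<noteq> 0" using W_bounds[OF less.prems, of n] 2 by simp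
      ultimately show ?thesis
        using ell_s_last[OF less.prems] ell_d_last[OF less.prems]
        by (intro descent[of n]) auto
    qed
  qed
qed

lemma length_filter_word:
  assumes "is_word n w u"
  shows "length (filter (\<lambda>i. i < n) u) + length (filter (\<lambda>i. i = n) u) = length u"
proof -
  have "filter (\<lambda>i. i = n) u = filter (\<lambda>i. \<not> i < n) u"
    using assms by (intro filter_cong) (auto simp: is_word_def)
  then show ?thesis by (simp add: sum_length_filter_compl)
qed

text \<open>The reduced word is at most as long as the sum of the two lower bounds of
  \<open>is_word_bounds\<close>, so both bounds are attained.\<close>

lemma len_eq_ell:
  assumes "w \<in> W_fin n"
  shows "len_s n w = ell_s n w" "len_d n w = ell_d n w"
proof -
  from exists_word[OF assms] obtain u where u: "is_word n w u" "length u = ell_s n w + ell_d n w"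
    by blast
  let ?r = "reduced_word n w"
  have r: "is_word n w ?r"
    unfolding reduced_word_def using u(1) by (rule arg_min_natI)
  have "length ?r \<le> length u"
    unfolding reduced_word_def using u(1) by (rule arg_min_nat_le)
  with is_word_bounds[OF r] length_filter_word[OF r] u(2)
  show "len_s n w = ell_s n w" "len_d n w = ell_d n w"
    by (auto simp: len_s_def len_d_def)
qed

lemma W0_eq: "W0 n z1 z2 = (\<Sum>w\<in>W_fin n. z1 ^ ell_s n w * z2 ^ ell_d n w)"
  unfolding W0_def by (intro sum.cong) (simp_all add: len_eq_ell)

section \<open>Macdonald's identity\<close>

lemma lookup_mult_single:
  "Poly_Mapping.lookup (Poly_Mapping.single \<nu> c * f) \<mu> = c * Poly_Mapping.lookup f (\<mu> - \<nu>)" for f :: laurent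
  by (induction f rule: poly_mapping_add_induct)
     (auto simp: distrib_left lookup_add mult_single lookup_single when_def algebra_simps)

lemma lookup_single_0_mult: "Poly_Mapping.lookup (Poly_Mapping.single 0 c * f) \<nu> = c * Poly_Mapping.lookup f \<nu>"
  for f :: laurent
  by (simp add: lookup_mult_single)

lemma single_0_mult_left_cancel:
  fixes f :: laurent
  assumes "Poly_Mapping.single 0 c * f = Poly_Mapping.single 0 d * f" "f \<noteq> 0"
  shows "c = d"
proof -
  from assms(2) obtain \<nu> where "Poly_Mapping.lookup f \<nu> \<noteq> 0"
    by (metis poly_mapping_eqI lookup_zero)
  moreover have "c * Poly_Mapping.lookup f \<nu> = d * Poly_Mapping.lookup f \<nu>"
    using assms(1) by (metis lookup_single_0_mult)
  ultimately show ?thesis by simp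
qed

lemma of_nat_ratfun_eq_0_iff: "of_nat m = (0 :: ratfun) \<longleftrightarrow> m = 0"
proof -
  have "of_nat m = cst (of_nat m)"
    by (induction m) (simp_all add: ring_hom_1.hom_simps[OF cst_hom])
  then show ?thesis by (simp add: cst_def Fract_one_eq_0_iff)
qed

lemma signed_act_single_0: "signed_act w (Poly_Mapping.single 0 c) = Poly_Mapping.single 0 c"
  by (simp add: signed_act_single)

definition mac_single :: "ratfun \<Rightarrow> ratfun \<Rightarrow> int \<Rightarrow> laurent" where
  "mac_single c d a = Poly_Mapping.single (signed_eps a) 1 - Poly_Mapping.single 0 (c + d) + Poly_Mapping.single (signed_eps (- a)) (c * d)"

text \<open>This is x_a (1 - t x_b / x_a) (1 - t / (x_a x_b)) multiplied out, with x_(-k) = 1/x_k.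
  In this form the action of \<open>w\<close> only replaces a and b, and the leading term is one of
  four visible monomials.\<close>

definition mac_pair :: "ratfun \<Rightarrow> int \<Rightarrow> int \<Rightarrow> laurent" where
  "mac_pair t a b = Poly_Mapping.single (signed_eps a) 1 - Poly_Mapping.single (signed_eps b) t - Poly_Mapping.single (signed_eps (- b)) t +
     Poly_Mapping.single (signed_eps (- a)) (t ^ 2)"

text \<open>
  This is \<open>x\<^sup>\<rho> \<Prod>(1 - t\<^sub>\<alpha> x\<^sup>-\<^sup>\<alpha>)\<close> with the factors for \<open>e\<^sub>i - e\<^sub>j\<close>, \<open>e\<^sub>i + e\<^sub>j\<close> and the two factors
  \<open>(1 - c/x\<^sub>i)(1 - d/x\<^sub>i)\<close> combined. For \<open>t = 1\<close>, \<open>c = 1\<close>, \<open>d = -1\<close> it is the Weyl denominator of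
  type C.
\<close>

definition mac_prod :: "nat \<Rightarrow> ratfun \<Rightarrow> ratfun \<Rightarrow> ratfun \<Rightarrow> laurent" where
  "mac_prod n t c d = (\<Prod>i=1..n. mac_single c d (int i)) * (\<Prod>(i,j)\<in>index_pairs n. mac_pair t (int i) (int j))"

abbreviation weyl_denom :: "nat \<Rightarrow> laurent" where
  "weyl_denom n \<equiv> mac_prod n 1 1 (- 1)"

definition sign_char :: "nat \<Rightarrow> (int \<Rightarrow> int) \<Rightarrow> ratfun" where
  "sign_char n w = (- 1) ^ (ell_s n w + ell_d n w)"

text \<open>The sum of the leading exponents of the factors of \<open>mac_prod\<close>, one summand
  for each factor; \<open>lookup_rho\<close> identifies it with (n, ..., 2, 1).\<close>

definition rho :: "nat \<Rightarrow> expo" where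
  "rho n = (\<Sum>i=1..n. signed_eps (int i)) + (\<Sum>(i,j)\<in>index_pairs n. signed_eps (int i))"

lemma signed_eps_uminus: "signed_eps (- a) = - signed_eps a"
  by (simp add: signed_eps_def single_uminus)

lemma signed_act_mac_single: "w \<in> W_fin n \<Longrightarrow> a \<noteq> 0 \<Longrightarrow> signed_act w (mac_single c d a) = mac_single c d (w a)"
  by (simp add: mac_single_def signed_act.hom_simps signed_act_single signed_act_expo_signed_eps[of w n] W_minus[of w n])

lemma signed_act_mac_pair: "w \<in> W_fin n \<Longrightarrow> a \<noteq> 0 \<Longrightarrow> b \<noteq> 0 \<Longrightarrow> signed_act w (mac_pair t a b) = mac_pair t (w a) (w b)"
  by (simp add: mac_pair_def signed_act.hom_simps signed_act_single signed_act_expo_signed_eps[of w n] W_minus[of w n])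

lemma signed_act_mac_prod:
  assumes "w \<in> W_fin n"
  shows "signed_act w (mac_prod n t c d) =
    (\<Prod>i=1..n. mac_single c d (w (int i))) * (\<Prod>(i,j)\<in>index_pairs n. mac_pair t (w (int i)) (w (int j)))"
proof -
  have "(\<Prod>i=1..n. signed_act w (mac_single c d (int i))) = (\<Prod>i=1..n. mac_single c d (w (int i)))"
    by (intro prod.cong) (auto simp: signed_act_mac_single[OF assms])
  moreover have "(\<Prod>(i,j)\<in>index_pairs n. signed_act w (mac_pair t (int i) (int j))) = (\<Prod>(i,j)\<in>index_pairs n. mac_pair t (w (int i)) (w (int j)))"
    by (intro prod.cong) (auto simp: signed_act_mac_pair[OF assms] index_pairs_iff)
  ultimately show ?thesis
    by (simp add: mac_prod_def signed_act.hom_mult signed_act.hom_prod case_prod_beta)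
qed

subsection \<open>Leading terms\<close>

text \<open>The pairing with (n, ..., 2, 1). It is positive on every e_i and strictly decreasing in
  i, which is what singles out one heaviest monomial in each factor.\<close>

definition weight :: "nat \<Rightarrow> expo \<Rightarrow> int" where
  "weight n \<nu> = (\<Sum>i=1..n. (int n + 1 - int i) * Poly_Mapping.lookup \<nu> i)"

definition below_weight :: "nat \<Rightarrow> int \<Rightarrow> laurent \<Rightarrow> bool" where
  "below_weight n L r \<longleftrightarrow> (\<forall>\<mu>\<in>Poly_Mapping.keys r. weight n \<mu> < L)"

text \<open>Formulated through the difference, not through a maximal exponent in the support,
  because the coefficient \<open>c\<close> may be zero for special arguments.\<close>

definition has_leading_term :: "nat \<Rightarrow> laurent \<Rightarrow> expo \<Rightarrow> ratfun \<Rightarrow> bool" where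
  "has_leading_term n f \<nu> c \<longleftrightarrow> below_weight n (weight n \<nu>) (f - Poly_Mapping.single \<nu> c)"

lemma weight_add: "weight n (\<mu> + \<nu>) = weight n \<mu> + weight n \<nu>"
  by (simp add: weight_def lookup_add distrib_left sum.distrib)

lemma weight_0: "weight n 0 = 0"
  by (simp add: weight_def)

lemma weight_signed_eps: "a \<noteq> 0 \<Longrightarrow> \<bar>a\<bar> \<le> int n \<Longrightarrow> weight n (signed_eps a) = sgn a * (int n + 1 - \<bar>a\<bar>)"
proof -
  assume a: "a \<noteq> 0" "\<bar>a\<bar> \<le> int n"
  have "weight n (signed_eps a) = (\<Sum>i=1..n. if i = nat \<bar>a\<bar> then (int n + 1 - int i) * sgn a else 0)"
    unfolding weight_def signed_eps_def by (intro sum.cong) (auto simp: lookup_single when_def)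
  also have "\<dots> = sgn a * (int n + 1 - \<bar>a\<bar>)"
    using a by (simp add: sum.delta Suc_le_eq nat_le_iff)
  finally show ?thesis .
qed

lemma below_weight_add: "below_weight n L f \<Longrightarrow> below_weight n L g \<Longrightarrow> below_weight n L (f + g)"
  unfolding below_weight_def using keys_add[of f g] by blast

lemma below_weight_uminus: "below_weight n L f \<Longrightarrow> below_weight n L (- f)"
  by (simp add: below_weight_def in_keys_iff)

lemma below_weight_single: "weight n \<nu> < L \<Longrightarrow> below_weight n L (Poly_Mapping.single \<nu> c)"
  by (simp add: below_weight_def)

lemma below_weight_mult:
  assumes "\<And>\<mu>. \<mu> \<in> Poly_Mapping.keys f \<Longrightarrow> weight n \<mu> \<le> K" "below_weight n L g"
  shows "below_weight n (K + L) (f * g)"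
  unfolding below_weight_def
proof
  fix \<mu> assume "\<mu> \<in> Poly_Mapping.keys (f * g)"
  then obtain a b where "\<mu> = a + b" "a \<in> Poly_Mapping.keys f" "b \<in> Poly_Mapping.keys g"
    using keys_mult[of f g] by blast
  with assms show "weight n \<mu> < K + L"
    by (fastforce simp: below_weight_def weight_add)
qed

lemma has_leading_term_lookup: "has_leading_term n f \<nu> c \<Longrightarrow> Poly_Mapping.lookup f \<nu> = c"
  by (force simp: has_leading_term_def below_weight_def in_keys_iff lookup_minus)

lemma has_leading_term_add_below_weight: "has_leading_term n f \<nu> c \<Longrightarrow> below_weight n (weight n \<nu>) r \<Longrightarrow> has_leading_term n (f + r) \<nu> c"
  using below_weight_add[of n "weight n \<nu>" "f - Poly_Mapping.single \<nu> c" r]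
  by (simp add: has_leading_term_def algebra_simps)

lemma has_leading_term_single: "has_leading_term n (Poly_Mapping.single \<nu> c) \<nu> c"
  by (simp add: has_leading_term_def below_weight_def)

lemma has_leading_term_keys: "has_leading_term n f \<nu> c \<Longrightarrow> \<mu> \<in> Poly_Mapping.keys f \<Longrightarrow> weight n \<mu> \<le> weight n \<nu>"
  using keys_add[of "f - Poly_Mapping.single \<nu> c" "Poly_Mapping.single \<nu> c"]
  by (force simp: has_leading_term_def below_weight_def split: if_splits)

lemma has_leading_term_mult:
  assumes "has_leading_term n f \<mu> c" "has_leading_term n g \<nu> d"
  shows "has_leading_term n (f * g) (\<mu> + \<nu>) (c * d)"
proof -
  have "f * g - Poly_Mapping.single (\<mu> + \<nu>) (c * d) =
    f * (g - Poly_Mapping.single \<nu> d) + Poly_Mapping.single \<nu> d * (f - Poly_Mapping.single \<mu> c)"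
    by (simp add: mult_single algebra_simps)
  moreover have "below_weight n (weight n (\<mu> + \<nu>)) (f * (g - Poly_Mapping.single \<nu> d))"
    unfolding weight_add using assms by (intro below_weight_mult has_leading_term_keys[of n f \<mu> c]) (auto simp: has_leading_term_def)
  moreover have "below_weight n (weight n \<nu> + weight n \<mu>) (Poly_Mapping.single \<nu> d * (f - Poly_Mapping.single \<mu> c))"
    using assms by (intro below_weight_mult) (auto simp: has_leading_term_def split: if_splits)
  ultimately show ?thesis
    by (simp add: has_leading_term_def below_weight_add weight_add add.commute)
qed

lemma has_leading_term_prod:
  assumes "\<And>i. i \<in> A \<Longrightarrow> has_leading_term n (f i) (\<nu> i) (c i)"
  shows "has_leading_term n (\<Prod>i\<in>A. f i) (\<Sum>i\<in>A. \<nu> i) (\<Prod>i\<in>A. c i)"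
  using assms
proof (induction A rule: infinite_finite_induct)
  case (insert i A)
  then show ?case using has_leading_term_mult[of n "f i" "\<nu> i" "c i"] by simp
qed (use has_leading_term_single[of n 0 1] in simp_all)

lemma has_leading_term_mac_single:
  assumes "a \<noteq> 0" "\<bar>a\<bar> \<le> int n"
  shows "has_leading_term n (mac_single c d a) (signed_eps \<bar>a\<bar>) ((c * d) ^ (if a < 0 then 1 else 0))"
proof (cases "a > 0")
  case True
  have "mac_single c d a = Poly_Mapping.single (signed_eps \<bar>a\<bar>) 1 + (- Poly_Mapping.single 0 (c + d) + Poly_Mapping.single (signed_eps (- a)) (c * d))"
    using True by (simp add: mac_single_def)
  also have "has_leading_term n \<dots> (signed_eps \<bar>a\<bar>) 1"
    using assms True by (intro has_leading_term_add_below_weight has_leading_term_single below_weight_add below_weight_uminus below_weight_single) (auto simp: weight_signed_eps weight_0)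
  finally show ?thesis using True by simp
next
  case False
  have "mac_single c d a = Poly_Mapping.single (signed_eps \<bar>a\<bar>) (c * d) + (- Poly_Mapping.single 0 (c + d) + Poly_Mapping.single (signed_eps a) 1)"
    using False by (simp add: mac_single_def)
  also have "has_leading_term n \<dots> (signed_eps \<bar>a\<bar>) (c * d)"
    using assms False by (intro has_leading_term_add_below_weight has_leading_term_single below_weight_add below_weight_uminus below_weight_single) (auto simp: weight_signed_eps weight_0)
  finally show ?thesis using False assms by simp
qed

text \<open>The heaviest of the four exponents is the positive one with the smaller index. Its
  coefficient is 1, - t or t^2 according to how many of the two roots \<open>signed_eps a\<close>
  plus or minus \<open>signed_eps b\<close> are negative.\<close>

lemma has_leading_term_mac_pair:
  assumes "a \<noteq> 0" "\<bar>a\<bar> \<le> int n" "b \<noteq> 0" "\<bar>b\<bar> \<le> int n" "\<bar>a\<bar> \<noteq> \<bar>b\<bar>"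
  shows "has_leading_term n (mac_pair t a b) (signed_eps (min \<bar>a\<bar> \<bar>b\<bar>)) ((- t) ^ pair_length a b)"
proof -
  define s where "s \<nu> c = (Poly_Mapping.single \<nu> c :: laurent)" for \<nu> c
  have weight: "weight n (signed_eps x) = sgn x * (int n + 1 - \<bar>x\<bar>)" if "x \<in> {a, b, - a, - b}" for x
    using that assms by (intro weight_signed_eps) auto
  consider "\<bar>a\<bar> < \<bar>b\<bar>" "a > 0" | "\<bar>a\<bar> < \<bar>b\<bar>" "a < 0" | "\<bar>b\<bar> < \<bar>a\<bar>" "b > 0" | "\<bar>b\<bar> < \<bar>a\<bar>" "b < 0"
    using assms by linarith
  then show ?thesis
  proof cases
    case 1
    have "mac_pair t a b = s (signed_eps a) 1 + (- s (signed_eps b) t + (- s (signed_eps (- b)) t + s (signed_eps (- a)) (t ^ 2)))"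
      by (simp add: mac_pair_def s_def)
    also have "has_leading_term n \<dots> (signed_eps a) 1"
      unfolding s_def using 1 assms
      by (intro has_leading_term_add_below_weight has_leading_term_single below_weight_add below_weight_uminus below_weight_single) (auto simp: weight sgn_if)
    finally show ?thesis using 1 by (simp add: pair_length_def)
  next
    case 2
    have "mac_pair t a b = s (signed_eps (- a)) (t ^ 2) + (- s (signed_eps b) t + (- s (signed_eps (- b)) t + s (signed_eps a) 1))"
      by (simp add: mac_pair_def s_def)
    also have "has_leading_term n \<dots> (signed_eps (- a)) (t ^ 2)"
      unfolding s_def using 2 assms
      by (intro has_leading_term_add_below_weight has_leading_term_single below_weight_add below_weight_uminus below_weight_single) (auto simp: weight sgn_if)
    finally show ?thesis using 2 by (simp add: pair_length_def)
  next
    case 3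
    have "mac_pair t a b = s (signed_eps b) (- t) + (- s (signed_eps (- b)) t + (s (signed_eps a) 1 + s (signed_eps (- a)) (t ^ 2)))"
      by (simp add: mac_pair_def s_def single_uminus)
    also have "has_leading_term n \<dots> (signed_eps b) (- t)"
      unfolding s_def using 3 assms
      by (intro has_leading_term_add_below_weight has_leading_term_single below_weight_add below_weight_uminus below_weight_single) (auto simp: weight sgn_if)
    finally show ?thesis using 3 by (simp add: pair_length_def)
  next
    case 4
    have "mac_pair t a b = s (signed_eps (- b)) (- t) + (- s (signed_eps b) t + (s (signed_eps a) 1 + s (signed_eps (- a)) (t ^ 2)))"
      by (simp add: mac_pair_def s_def single_uminus)
    also have "has_leading_term n \<dots> (signed_eps (- b)) (- t)"
      unfolding s_def using 4 assms
      by (intro has_leading_term_add_below_weight has_leading_term_single below_weight_add below_weight_uminus below_weight_single) (auto simp: weight sgn_if)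
    finally show ?thesis using 4 by (simp add: pair_length_def)
  qed
qed

lemma sum_index_pairs_reindex:
  assumes "bij_betw \<sigma> {1..n} {1..n}"
  shows "(\<Sum>(i,j)\<in>index_pairs n. F (min (\<sigma> i) (\<sigma> j)) (max (\<sigma> i) (\<sigma> j))) = (\<Sum>(i,j)\<in>index_pairs n. F i j)"
  using sum.reindex_bij_betw[OF bij_betw_sorted_pairs[OF assms], of "\<lambda>(i, j). F i j"]
  by (simp add: case_prod_beta)

text \<open>Applying \<open>w\<close> only rearranges the leading exponents of the factors, so their
  sum is \<open>rho n\<close> for every \<open>w\<close>; the coefficients multiply to powers that
  count the roots made negative.\<close>

lemma has_leading_term_signed_act_mac_prod:
  assumes w: "w \<in> W_fin n"
  shows "has_leading_term n (signed_act w (mac_prod n t c d)) (rho n) ((c * d) ^ ell_d n w * (- t) ^ ell_s n w)"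
proof -
  have 1: "has_leading_term n (\<Prod>i=1..n. mac_single c d (w (int i))) (\<Sum>i=1..n. signed_eps \<bar>w (int i)\<bar>)
     (\<Prod>i=1..n. (c * d) ^ (if w (int i) < 0 then 1 else 0))"
    by (intro has_leading_term_prod has_leading_term_mac_single) (use W_bounds[OF w] in auto)
  have "has_leading_term n (\<Prod>p\<in>index_pairs n. mac_pair t (w (int (fst p))) (w (int (snd p))))
      (\<Sum>p\<in>index_pairs n. signed_eps (min \<bar>w (int (fst p))\<bar> \<bar>w (int (snd p))\<bar>))
     (\<Prod>p\<in>index_pairs n. (- t) ^ pair_length (w (int (fst p))) (w (int (snd p))))"
  proof (intro has_leading_term_prod, goal_cases)
    case (1 p)
    hence "1 \<le> fst p" "fst p \<le> n" "1 \<le> snd p" "snd p \<le> n" "fst p \<noteq> snd p"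
      by (auto simp: index_pairs_def)
    then show ?case
      using W_bounds[OF w] W_abs_eq_iff[OF w, of "int (fst p)" "int (snd p)"] by (intro has_leading_term_mac_pair) auto
  qed
  hence 2: "has_leading_term n (\<Prod>(i,j)\<in>index_pairs n. mac_pair t (w (int i)) (w (int j)))
      (\<Sum>(i,j)\<in>index_pairs n. signed_eps (min \<bar>w (int i)\<bar> \<bar>w (int j)\<bar>)) (\<Prod>(i,j)\<in>index_pairs n. (- t) ^ pair_length (w (int i)) (w (int j)))"
    by (simp add: case_prod_beta)
  have 3: "(\<Sum>i=1..n. signed_eps \<bar>w (int i)\<bar>) = (\<Sum>i=1..n. signed_eps (int i))"
    using sum.reindex_bij_betw[OF W_perm_bij[OF w], of "\<lambda>i. signed_eps (int i)"] by simp
  have "(\<Sum>(i,j)\<in>index_pairs n. signed_eps (int (min (nat \<bar>w (int i)\<bar>) (nat \<bar>w (int j)\<bar>)))) = (\<Sum>(i,j)\<in>index_pairs n. signed_eps (int i))"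
    by (rule sum_index_pairs_reindex[OF W_perm_bij[OF w], of "\<lambda>i j. signed_eps (int i)"])
  hence 4: "(\<Sum>(i,j)\<in>index_pairs n. signed_eps (min \<bar>w (int i)\<bar> \<bar>w (int j)\<bar>)) = (\<Sum>(i,j)\<in>index_pairs n. signed_eps (int i))"
    by (simp add: of_nat_min)
  have 5: "(\<Prod>i=1..n. (c * d) ^ (if w (int i) < 0 then 1 else 0)) = (c * d) ^ ell_d n w"
    by (simp add: ell_d_def power_sum)
  have 6: "(\<Prod>(i,j)\<in>index_pairs n. (- t) ^ pair_length (w (int i)) (w (int j))) = (- t) ^ ell_s n w"
    by (simp add: ell_s_def power_sum case_prod_beta)
  show ?thesis
    using has_leading_term_mult[OF 1 2] unfolding 3 4 5 6 signed_act_mac_prod[OF w] rho_def .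
qed

lemma ell_id: "ell_s n id = 0" "ell_d n id = 0"
  by (auto simp: ell_s_def ell_d_def index_pairs_iff pair_length_def intro!: sum.neutral)

lemma signed_act_id: "signed_act id f = f"
  by (induction f rule: poly_mapping_add_induct) (simp_all add: signed_act.hom_simps signed_act_single signed_act_expo_id[unfolded id_def] id_def)

lemma lookup_weyl_denom_rho: "Poly_Mapping.lookup (weyl_denom n) (rho n) = 1"
  using has_leading_term_lookup[OF has_leading_term_signed_act_mac_prod[OF W_id, of n 1 1 "- 1"]] by (simp add: signed_act_id ell_id)

lemma weyl_denom_nonzero: "weyl_denom n \<noteq> 0"
  using lookup_weyl_denom_rho[of n] by auto

subsection \<open>Antisymmetry\<close>

lemma mac_single_sign: "a \<noteq> 0 \<Longrightarrow> mac_single 1 (- 1) a = (- 1) ^ (if a < 0 then 1 else 0) * mac_single 1 (- 1) \<bar>a\<bar>"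
  by (simp add: mac_single_def single_uminus)

text \<open>For t = 1 the factor is (x_a + 1/x_a) - (x_b + 1/x_b): unchanged by inverting a variable
  and negated by exchanging the two. Accordingly \<open>pair_length\<close> is odd exactly when the
  absolute values are out of order.\<close>

lemma mac_pair_sign:
  assumes "\<bar>a\<bar> \<noteq> \<bar>b\<bar>"
  shows "mac_pair 1 a b = (- 1) ^ pair_length a b * mac_pair 1 (min \<bar>a\<bar> \<bar>b\<bar>) (max \<bar>a\<bar> \<bar>b\<bar>)"
  using assms by (auto simp: mac_pair_def pair_length_def min_def max_def abs_if)

lemma signed_act_weyl_denom:
  assumes w: "w \<in> W_fin n"
  shows "signed_act w (weyl_denom n) = Poly_Mapping.single 0 (sign_char n w) * weyl_denom n"
proof -
  have "(\<Prod>i=1..n. mac_single 1 (- 1) (w (int i))) =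
      (\<Prod>i=1..n. (- 1) ^ (if w (int i) < 0 then 1 else 0) * mac_single 1 (- 1) \<bar>w (int i)\<bar>)"
    by (intro prod.cong mac_single_sign) (use W_bounds[OF w] in auto)
  also have "\<dots> = (- 1) ^ ell_d n w * (\<Prod>i=1..n. mac_single 1 (- 1) (int (nat \<bar>w (int i)\<bar>)))"
    by (simp add: prod.distrib ell_d_def power_sum)
  also have "(\<Prod>i=1..n. mac_single 1 (- 1) (int (nat \<bar>w (int i)\<bar>))) = (\<Prod>i=1..n. mac_single 1 (- 1) (int i))"
    by (rule prod.reindex_bij_betw[OF W_perm_bij[OF w]])
  finally have 1: "(\<Prod>i=1..n. mac_single 1 (- 1) (w (int i))) = (- 1) ^ ell_d n w * (\<Prod>i=1..n. mac_single 1 (- 1) (int i))" .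
  let ?\<sigma> = "\<lambda>i. nat \<bar>w (int i)\<bar>"
  have "(\<Prod>(i,j)\<in>index_pairs n. mac_pair 1 (w (int i)) (w (int j))) =
      (\<Prod>(i,j)\<in>index_pairs n. (- 1) ^ pair_length (w (int i)) (w (int j)) *
        mac_pair 1 (min \<bar>w (int i)\<bar> \<bar>w (int j)\<bar>) (max \<bar>w (int i)\<bar> \<bar>w (int j)\<bar>))"
  proof (intro prod.cong refl, clarify)
    fix i j assume "(i, j) \<in> index_pairs n"
    hence "\<bar>w (int i)\<bar> \<noteq> \<bar>w (int j)\<bar>"
      using W_abs_eq_iff[OF w] by (auto simp: index_pairs_iff)
    then show "mac_pair 1 (w (int i)) (w (int j)) = (- 1) ^ pair_length (w (int i)) (w (int j)) *
        mac_pair 1 (min \<bar>w (int i)\<bar> \<bar>w (int j)\<bar>) (max \<bar>w (int i)\<bar> \<bar>w (int j)\<bar>)"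
      by (rule mac_pair_sign)
  qed
  also have "\<dots> = (- 1) ^ ell_s n w *
      (\<Prod>(i,j)\<in>index_pairs n. mac_pair 1 (int (min (?\<sigma> i) (?\<sigma> j))) (int (max (?\<sigma> i) (?\<sigma> j))))"
    by (simp add: prod.distrib ell_s_def power_sum case_prod_beta of_nat_min of_nat_max)
  also have "(\<Prod>(i,j)\<in>index_pairs n. mac_pair 1 (int (min (?\<sigma> i) (?\<sigma> j))) (int (max (?\<sigma> i) (?\<sigma> j)))) =
      (\<Prod>(i,j)\<in>index_pairs n. mac_pair 1 (int i) (int j))"
    by (rule prod_index_pairs_reindex[OF W_perm_bij[OF w], of "\<lambda>i j. mac_pair 1 (int i) (int j)"])
  finally have 2: "(\<Prod>(i,j)\<in>index_pairs n. mac_pair 1 (w (int i)) (w (int j))) =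
      (- 1) ^ ell_s n w * (\<Prod>(i,j)\<in>index_pairs n. mac_pair 1 (int i) (int j))" .
  have "Poly_Mapping.single 0 (sign_char n w) = ((- 1) ^ (ell_s n w + ell_d n w) :: laurent)"
    unfolding sign_char_def by (simp add: ring_hom_1.hom_simps[OF ring_hom_1_single])
  then show ?thesis
    unfolding signed_act_mac_prod[OF w] 1 2 unfolding mac_prod_def by (simp add: power_add mult_ac)
qed

text \<open>Multiplicativity is read off from the action on the nonzero \<open>weyl_denom\<close>,
  where \<open>sign_char\<close> appears as the eigenvalue; no computation with lengths is
  involved.\<close>

lemma sign_char_comp:
  assumes "v \<in> W_fin n" "w \<in> W_fin n"
  shows "sign_char n (v \<circ> w) = sign_char n v * sign_char n w"
proof (rule single_0_mult_left_cancel[OF _ weyl_denom_nonzero])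
  have "Poly_Mapping.single 0 (sign_char n (v \<circ> w)) * weyl_denom n = signed_act v (signed_act w (weyl_denom n))"
    by (simp only: signed_act_comp[OF assms] signed_act_weyl_denom[OF W_comp[OF assms]])
  also have "\<dots> = Poly_Mapping.single 0 (sign_char n v * sign_char n w) * weyl_denom n"
    using assms mult_single[of 0 "sign_char n w" "0 :: expo" "sign_char n v"]
    by (simp add: signed_act_weyl_denom signed_act.hom_mult signed_act_single_0 mult.assoc[symmetric] mult.commute)
  finally show "Poly_Mapping.single 0 (sign_char n (v \<circ> w)) * weyl_denom n = Poly_Mapping.single 0 (sign_char n v * sign_char n w) * weyl_denom n" .
qed

lemma sign_char_square: "sign_char n w * sign_char n w = 1"
  by (simp add: sign_char_def power_add[symmetric] mult_2[symmetric] power_mult)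

definition antisym_laurent :: "nat \<Rightarrow> laurent \<Rightarrow> bool" where
  "antisym_laurent n f \<longleftrightarrow> (\<forall>v\<in>W_fin n. signed_act v f = Poly_Mapping.single 0 (sign_char n v) * f)"

definition in_box :: "nat \<Rightarrow> laurent \<Rightarrow> bool" where
  "in_box n f \<longleftrightarrow> (\<forall>\<nu>\<in>Poly_Mapping.keys f. \<forall>k. \<bar>Poly_Mapping.lookup \<nu> k\<bar> \<le> (if k \<in> {1..n} then int n else 0))"

lemma antisym_sum:
  "antisym_laurent n (\<Sum>w\<in>W_fin n. Poly_Mapping.single 0 (sign_char n w) * signed_act w f)"
  unfolding antisym_laurent_def
proof
  fix v assume v: "v \<in> W_fin n"
  let ?F = "\<lambda>w. Poly_Mapping.single 0 (sign_char n w) * signed_act w f"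
  have "signed_act v (\<Sum>w\<in>W_fin n. ?F w) = (\<Sum>w\<in>W_fin n. Poly_Mapping.single 0 (sign_char n v) * ?F (v \<circ> w))"
    unfolding signed_act.hom_sum
  proof (intro sum.cong refl)
    fix w assume w: "w \<in> W_fin n"
    have "sign_char n w = sign_char n v * sign_char n (v \<circ> w)"
      using sign_char_square[of n v] by (simp add: sign_char_comp[OF v w] mult.assoc[symmetric])
    hence "Poly_Mapping.single 0 (sign_char n w) = Poly_Mapping.single 0 (sign_char n v) * Poly_Mapping.single (0 :: expo) (sign_char n (v \<circ> w))"
      by (simp add: mult_single)
    then show "signed_act v (?F w) = Poly_Mapping.single 0 (sign_char n v) * ?F (v \<circ> w)"
      by (simp add: signed_act.hom_mult signed_act_single_0 signed_act_comp[OF v w] mult.assoc)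
  qed
  also have "\<dots> = Poly_Mapping.single 0 (sign_char n v) * (\<Sum>w\<in>W_fin n. ?F w)"
    unfolding sum_distrib_left[symmetric] sum_W_translate[OF v, of ?F] ..
  finally show "signed_act v (\<Sum>w\<in>W_fin n. ?F w) = Poly_Mapping.single 0 (sign_char n v) * (\<Sum>w\<in>W_fin n. ?F w)" .
qed

text \<open>The element \<open>v\<close> fixes the exponent and changes the sign of
  \<open>f\<close>, so the coefficient equals its own negative; the parameter field has
  characteristic 0.\<close>

lemma antisym_lookup_eq_0:
  assumes "antisym_laurent n f" "v \<in> W_fin n" "sign_char n v = - 1" "signed_act_expo v \<nu> = \<nu>"
  shows "Poly_Mapping.lookup f \<nu> = 0"
proof -
  have "Poly_Mapping.lookup f \<nu> = Poly_Mapping.lookup (signed_act v f) \<nu>"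
    using lookup_signed_act[OF assms(2), of f \<nu>] assms(4) by simp
  also have "\<dots> = - Poly_Mapping.lookup f \<nu>"
    using assms by (simp add: antisym_laurent_def lookup_single_0_mult)
  finally have "of_nat 2 * Poly_Mapping.lookup f \<nu> = 0" by simp
  then show ?thesis
    unfolding mult_eq_0_iff of_nat_ratfun_eq_0_iff by simp
qed

lemma sign_char_simple_refl:
  assumes "1 \<le> i" "i \<le> n"
  shows "sign_char n (simple_refl n i) = - 1"
  using ell_change[OF W_id assms] by (auto simp: sign_char_def ell_id split: if_splits)

section \<open>Reflections and regular exponents\<close>

definition flip_coord :: "nat \<Rightarrow> int \<Rightarrow> int" where
  "flip_coord k = Transposition.transpose (int k) (- int k)"

definition swap_coords :: "nat \<Rightarrow> nat \<Rightarrow> int \<Rightarrow> int" where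
  "swap_coords i j = Transposition.transpose (int i) (int j) \<circ> Transposition.transpose (- int i) (- int j)"

lemma flip_coord_in_W: "1 \<le> k \<Longrightarrow> k \<le> n \<Longrightarrow> flip_coord k \<in> W_fin n"
  unfolding W_fin_def flip_coord_def
  by (intro CollectI conjI permutes_swap_id) (auto simp: Transposition.transpose_def)

lemma swap_coords_in_W: "1 \<le> i \<Longrightarrow> i \<le> n \<Longrightarrow> 1 \<le> j \<Longrightarrow> j \<le> n \<Longrightarrow> swap_coords i j \<in> W_fin n"
  unfolding W_fin_def swap_coords_def
  by (intro CollectI conjI permutes_compose permutes_swap_id) (auto simp: Transposition.transpose_def)

lemma flip_coord_int: "flip_coord k (int i) = (if i = k then - int k else int i)"
  by (auto simp: flip_coord_def Transposition.transpose_def)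

lemma swap_coords_int: "1 \<le> i \<Longrightarrow> 1 \<le> j \<Longrightarrow> swap_coords i j (int k) = int (Transposition.transpose i j k)"
  by (auto simp: swap_coords_def Transposition.transpose_def)

text \<open>Each pair (k, j) contributes 2 to \<open>ell_s\<close> and every other pair contributes
  0, so the parity comes from \<open>ell_d\<close> alone, which is 1.\<close>

lemma sign_char_flip_coord:
  assumes "1 \<le> k" "k \<le> n"
  shows "sign_char n (flip_coord k) = - 1"
proof -
  have "pair_length (flip_coord k (int i)) (flip_coord k (int j)) = 2 * (if i = k then 1 else 0)" if "(i, j) \<in> index_pairs n" for i j
    using that by (auto simp: index_pairs_iff pair_length_def flip_coord_int)
  hence "ell_s n (flip_coord k) = (\<Sum>(i,j)\<in>index_pairs n. 2 * (if i = k then 1 else 0))"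
    unfolding ell_s_def by (intro sum.cong) auto
  hence "even (ell_s n (flip_coord k))"
    by (simp add: case_prod_beta dvd_sum)
  moreover have "ell_d n (flip_coord k) = (\<Sum>i=1..n. if i = k then 1 else 0)"
    unfolding ell_d_def using assms by (intro sum.cong) (auto simp: flip_coord_int)
  hence "ell_d n (flip_coord k) = 1"
    using assms by simp
  ultimately show ?thesis by (simp add: sign_char_def)
qed

lemma W_eqI:
  assumes "v \<in> W_fin n" "w \<in> W_fin n" "\<And>k. v (int k) = w (int k)"
  shows "v = w"
proof
  fix a :: int
  show "v a = w a"
    using assms(3)[of "nat a"] assms(3)[of "nat (- a)"] W_minus[OF assms(1), of a] W_minus[OF assms(2), of a]
    by (cases "a \<ge> 0") auto
qed

text \<open>Induction on the distance of the indices: the next swap is the conjugate of the previous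
  one by a simple reflection, and conjugation does not change the sign.\<close>

lemma sign_char_swap_coords:
  assumes "1 \<le> i" "i < j" "j \<le> n"
  shows "sign_char n (swap_coords i j) = - 1"
proof -
  from assms(2) have "Suc i \<le> j" by simp
  then show ?thesis using assms(3)
  proof (induction j rule: dec_induct)
    case base
    hence "swap_coords i (Suc i) = simple_refl n i"
      by (simp add: swap_coords_def simple_refl_def add.commute)
    then show ?case using sign_char_simple_refl[of i n] assms(1) base by simp
  next
    case (step j)
    have s: "simple_refl n j \<in> W_fin n" and p: "swap_coords i j \<in> W_fin n"
      using step assms(1) by (auto intro!: simple_refl_in_W swap_coords_in_W)
    have "swap_coords i (Suc j) = simple_refl n j \<circ> (swap_coords i j \<circ> simple_refl n j)"
      using step assms(1)
      by (intro W_eqI[of _ n] W_comp s p swap_coords_in_W)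
         (auto simp: swap_coords_int simple_refl_int Transposition.transpose_def)
    then show ?case
      unfolding \<open>swap_coords i (Suc j) = _\<close> sign_char_comp[OF s W_comp[OF p s]] sign_char_comp[OF p s]
      using step assms(1) by (simp add: sign_char_simple_refl)
  qed
qed

text \<open>\<open>lookup_signed_act_expo\<close> describes coordinates by their source index; this
  supplies the source of a given target index \<open>k\<close>.\<close>

lemma W_hits:
  assumes "w \<in> W_fin n"
  obtains i where "k = nat \<bar>w (int i)\<bar>" "k \<in> {1..n} \<longleftrightarrow> i \<in> {1..n}" "k \<notin> {1..n} \<longrightarrow> i = k"
proof (cases "k \<in> {1..n}")
  case True
  hence "k \<in> (\<lambda>i. nat \<bar>w (int i)\<bar>) ` {1..n}"
    using W_perm_bij[OF assms] by (simp add: bij_betw_def)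
  then obtain i where "i \<in> {1..n}" "k = nat \<bar>w (int i)\<bar>" by blast
  with True that show ?thesis by blast
next
  case False
  hence "k = 0 \<or> k > n" by auto
  with False that[of k] show ?thesis
    using W_zero[OF assms] W_outside[OF assms, of k] by auto
qed

lemma signed_act_expo_flip_coord:
  assumes "1 \<le> k" "k \<le> n" "Poly_Mapping.lookup \<nu> k = 0"
  shows "signed_act_expo (flip_coord k) \<nu> = \<nu>"
proof (rule poly_mapping_eqI)
  fix i
  show "Poly_Mapping.lookup (signed_act_expo (flip_coord k) \<nu>) i = Poly_Mapping.lookup \<nu> i"
    using lookup_signed_act_expo[OF flip_coord_in_W[OF assms(1,2)], of \<nu> i] assms by (auto simp: flip_coord_int split: if_splits)
qed

lemma signed_act_expo_swap_coords:
  assumes "1 \<le> i" "i \<le> n" "1 \<le> j" "j \<le> n" "Poly_Mapping.lookup \<nu> i = Poly_Mapping.lookup \<nu> j"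
  shows "signed_act_expo (swap_coords i j) \<nu> = \<nu>"
proof (rule poly_mapping_eqI)
  fix k
  show "Poly_Mapping.lookup (signed_act_expo (swap_coords i j) \<nu>) k = Poly_Mapping.lookup \<nu> k"
  proof -
    define m where "m = Transposition.transpose i j k"
    have "swap_coords i j (int m) = int k"
      using assms by (simp add: swap_coords_int m_def)
    hence "Poly_Mapping.lookup (signed_act_expo (swap_coords i j) \<nu>) k = (if m = 0 then 1 else sgn (int k)) * Poly_Mapping.lookup \<nu> m"
      using lookup_signed_act_expo[OF swap_coords_in_W[OF assms(1-4)], of \<nu> m] by simp
    moreover have "m = 0 \<longleftrightarrow> k = 0" "Poly_Mapping.lookup \<nu> m = Poly_Mapping.lookup \<nu> k"
      using assms by (auto simp: m_def Transposition.transpose_def)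
    ultimately show ?thesis by (auto simp: sgn_if)
  qed
qed

text \<open>A zero coordinate, or two coordinates with equal absolute values, would give a
  reflection fixing the exponent, and then the coefficient would vanish by
  \<open>antisym_lookup_eq_0\<close>.\<close>

lemma antisym_regular:
  assumes f: "antisym_laurent n f" "Poly_Mapping.lookup f \<nu> \<noteq> 0"
  shows "1 \<le> k \<Longrightarrow> k \<le> n \<Longrightarrow> Poly_Mapping.lookup \<nu> k \<noteq> 0"
    and "1 \<le> i \<Longrightarrow> i < j \<Longrightarrow> j \<le> n \<Longrightarrow> \<bar>Poly_Mapping.lookup \<nu> i\<bar> \<noteq> \<bar>Poly_Mapping.lookup \<nu> j\<bar>"
proof -
  show "Poly_Mapping.lookup \<nu> k \<noteq> 0" if "1 \<le> k" "k \<le> n"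
    using antisym_lookup_eq_0[OF f(1) flip_coord_in_W sign_char_flip_coord signed_act_expo_flip_coord] that f(2) by blast
  assume ij: "1 \<le> i" "i < j" "j \<le> n"
  have W: "swap_coords i j \<in> W_fin n" "flip_coord j \<in> W_fin n"
    using ij by (auto intro!: swap_coords_in_W flip_coord_in_W)
  show "\<bar>Poly_Mapping.lookup \<nu> i\<bar> \<noteq> \<bar>Poly_Mapping.lookup \<nu> j\<bar>"
  proof
    assume "\<bar>Poly_Mapping.lookup \<nu> i\<bar> = \<bar>Poly_Mapping.lookup \<nu> j\<bar>"
    then consider "Poly_Mapping.lookup \<nu> i = Poly_Mapping.lookup \<nu> j" | "Poly_Mapping.lookup \<nu> i = - Poly_Mapping.lookup \<nu> j"
      by (auto simp: abs_eq_iff)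
    then show False
    proof cases
      case 1
      with antisym_lookup_eq_0[OF f(1) W(1) sign_char_swap_coords[OF ij] signed_act_expo_swap_coords] ij f(2) show False by simp
    next
      case 2
      \<comment> \<open>The reflection in the root e_i + e_j, obtained by conjugating the swap with
        a sign change; it fixes exponents with opposite entries at i and j.\<close>
      let ?v = "flip_coord j \<circ> (swap_coords i j \<circ> flip_coord j)"
      have v: "?v \<in> W_fin n" by (intro W_comp W)
      have sgv: "sign_char n ?v = - 1"
        using sign_char_square[of n "flip_coord j"] by (simp add: sign_char_comp W W_comp sign_char_swap_coords[OF ij])
      have flip2: "flip_coord j \<circ> flip_coord j = id"
        by (simp add: flip_coord_def)
      have "Poly_Mapping.lookup (signed_act_expo (flip_coord j) \<nu>) i = Poly_Mapping.lookup (signed_act_expo (flip_coord j) \<nu>) j"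
        using lookup_signed_act_expo[OF W(2), of \<nu> i] lookup_signed_act_expo[OF W(2), of \<nu> j] ij 2 by (simp add: flip_coord_int)
      hence "signed_act_expo (swap_coords i j) (signed_act_expo (flip_coord j) \<nu>) = signed_act_expo (flip_coord j) \<nu>"
        using ij by (intro signed_act_expo_swap_coords) auto
      hence "signed_act_expo ?v \<nu> = signed_act_expo (flip_coord j) (signed_act_expo (flip_coord j) \<nu>)"
        by (simp add: signed_act_expo_comp[OF W(2) W_comp[OF W], symmetric] signed_act_expo_comp[OF W, symmetric])
      also have "\<dots> = \<nu>"
        by (simp add: signed_act_expo_comp[OF W(2) W(2)] flip2 signed_act_expo_id)
      finally show False
        using antisym_lookup_eq_0[OF f(1) v sgv] f(2) by blast
    qed
  qed
qed

lemma lookup_rho: "Poly_Mapping.lookup (rho n) k = (if k \<in> {1..n} then int n + 1 - int k else 0)"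
proof -
  have "(\<Sum>i=1..n. Poly_Mapping.lookup (signed_eps (int i)) k) = (if k \<in> {1..n} then 1 else 0)"
    by (simp add: signed_eps_def lookup_single when_def sgn_if)
  moreover have "(\<Sum>i=1..n. \<Sum>j=i+1..n. Poly_Mapping.lookup (signed_eps (int i)) k) =
      (\<Sum>i=1..n. if i = k then int n - int k else 0)"
    by (intro sum.cong) (auto simp: signed_eps_def lookup_single when_def sgn_if of_nat_diff)
  ultimately show ?thesis
    unfolding rho_def lookup_add lookup_sum sum_index_pairs[symmetric] by simp
qed

text \<open>Absolute values that are pairwise distinct, nonzero and at most n exhaust 1, ..., n, so
  the exponent is a signed rearrangement of \<open>rho n\<close>.\<close>

lemma regular_in_orbit:
  assumes bound: "\<And>k. \<bar>Poly_Mapping.lookup \<nu> k\<bar> \<le> (if k \<in> {1..n} then int n else 0)"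
    and nz: "\<And>k. 1 \<le> k \<Longrightarrow> k \<le> n \<Longrightarrow> Poly_Mapping.lookup \<nu> k \<noteq> 0"
    and dist: "\<And>i j. 1 \<le> i \<Longrightarrow> i < j \<Longrightarrow> j \<le> n \<Longrightarrow> \<bar>Poly_Mapping.lookup \<nu> i\<bar> \<noteq> \<bar>Poly_Mapping.lookup \<nu> j\<bar>"
  obtains w where "w \<in> W_fin n" "signed_act_expo w \<nu> = rho n"
proof -
  define m where "m k = Poly_Mapping.lookup \<nu> (nat \<bar>k\<bar>)" for k
  \<comment> \<open>Coordinate i must move to the position n + 1 - |m i|, where \<open>rho n\<close>
    has the entry |m i|, with the sign that makes it positive. As \<open>m\<close> is even in
    \<open>k\<close>, the factor \<open>sgn k\<close> makes \<open>w\<close> odd.\<close>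
  define w where "w k = (if k = 0 \<or> \<bar>k\<bar> > int n then k else sgn k * (sgn (m k) * (int n + 1 - \<bar>m k\<bar>)))" for k :: int
  have m_nz: "m k \<noteq> 0" and m_le: "\<bar>m k\<bar> \<le> int n" if "k \<noteq> 0" "\<bar>k\<bar> \<le> int n" for k
    using nz[of "nat \<bar>k\<bar>"] bound[of "nat \<bar>k\<bar>"] that by (auto simp: m_def nat_le_iff split: if_splits)
  have abs_w: "\<bar>w k\<bar> = int n + 1 - \<bar>m k\<bar>" if "k \<noteq> 0" "\<bar>k\<bar> \<le> int n" for k
    using m_nz[OF that] m_le[OF that] that by (simp add: w_def abs_mult)
  have minus: "w (- k) = - w k" for k
    by (simp add: w_def m_def)
  have m_inj: "\<bar>k\<bar> = \<bar>l\<bar>" if "\<bar>m k\<bar> = \<bar>m l\<bar>" "k \<noteq> 0" "\<bar>k\<bar> \<le> int n" "l \<noteq> 0" "\<bar>l\<bar> \<le> int n" for k l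
  proof (rule ccontr)
    assume ne: "\<bar>k\<bar> \<noteq> \<bar>l\<bar>"
    have "nat \<bar>k\<bar> \<ge> 1" "nat \<bar>k\<bar> \<le> n" "nat \<bar>l\<bar> \<ge> 1" "nat \<bar>l\<bar> \<le> n"
      using that by auto
    moreover have "nat \<bar>k\<bar> < nat \<bar>l\<bar> \<or> nat \<bar>l\<bar> < nat \<bar>k\<bar>"
      using ne by auto
    ultimately show False
      using dist[of "nat \<bar>k\<bar>" "nat \<bar>l\<bar>"] dist[of "nat \<bar>l\<bar>" "nat \<bar>k\<bar>"] that(1) unfolding m_def by auto
  qed
  have maps: "w ` {- int n..int n} \<subseteq> {- int n..int n}"
  proof (rule image_subsetI)
    fix k assume k: "k \<in> {- int n..int n}"
    show "w k \<in> {- int n..int n}"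
    proof (cases "k = 0")
      case True
      then show ?thesis by (simp add: w_def)
    next
      case False
      moreover have "\<bar>k\<bar> \<le> int n" using k by auto
      ultimately have "\<bar>w k\<bar> \<le> int n"
        using abs_w[of k] m_nz[of k] by linarith
      then show ?thesis by auto
    qed
  qed
  have inj: "inj_on w {- int n..int n}"
  proof (rule inj_onI)
    fix k l assume kl: "k \<in> {- int n..int n}" "l \<in> {- int n..int n}" "w k = w l"
    have kl': "\<bar>k\<bar> \<le> int n" "\<bar>l\<bar> \<le> int n" using kl by auto
    have w0: "w x = 0 \<longleftrightarrow> x = 0" if "\<bar>x\<bar> \<le> int n" for x
      using abs_w[of x] m_le[of x] that by (cases "x = 0") (auto simp: w_def)
    show "k = l"
    proof (cases "k = 0 \<or> l = 0")
      case True
      with w0[OF kl'(1)] w0[OF kl'(2)] kl(3) show ?thesis by auto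
    next
      case False
      hence "\<bar>m k\<bar> = \<bar>m l\<bar>"
        using abs_w[of k] abs_w[of l] kl' kl(3) by simp
      hence "\<bar>k\<bar> = \<bar>l\<bar>" using m_inj False kl' by blast
      moreover have "k \<noteq> - l"
        using minus[of l] kl(3) w0[OF kl'(2)] False by auto
      ultimately show ?thesis by (auto simp: abs_eq_iff)
    qed
  qed
  have "w permutes {- int n..int n}"
  proof (rule bij_imp_permutes)
    show "bij_betw w {- int n..int n} {- int n..int n}"
      unfolding bij_betw_def using inj endo_inj_surj[OF _ maps inj] by simp
  qed (auto simp: w_def)
  with minus have W: "w \<in> W_fin n" by (simp add: W_fin_def)
  have "signed_act_expo w \<nu> = rho n"
  proof (rule poly_mapping_eqI)
    fix k
    obtain i where i: "k = nat \<bar>w (int i)\<bar>" "k \<in> {1..n} \<longleftrightarrow> i \<in> {1..n}" "k \<notin> {1..n} \<longrightarrow> i = k"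
      using W_hits[OF W] .
    show "Poly_Mapping.lookup (signed_act_expo w \<nu>) k = Poly_Mapping.lookup (rho n) k"
    proof (cases "k \<in> {1..n}")
      case True
      with i have i': "i \<in> {1..n}" by blast
      have "sgn (w (int i)) = sgn (m (int i))"
        using i' m_le[of "int i"] by (simp add: w_def sgn_mult)
      hence "Poly_Mapping.lookup (signed_act_expo w \<nu>) k = \<bar>m (int i)\<bar>"
        using i' unfolding i(1) lookup_signed_act_expo[OF W] by (simp add: m_def sgn_mult_self_eq abs_sgn mult.commute)
      moreover have "int k = int n + 1 - \<bar>m (int i)\<bar>"
        using abs_w[of "int i"] m_le[of "int i"] i' i(1) by simp
      ultimately show ?thesis using True by (simp add: lookup_rho)
    next
      case False
      with i(3) bound[of k, unfolded if_not_P[OF False]] have "Poly_Mapping.lookup \<nu> i = 0" by simp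
      with lookup_signed_act_expo[OF W, of \<nu> i] have "Poly_Mapping.lookup (signed_act_expo w \<nu>) k = 0"
        unfolding i(1) by simp
      with False show ?thesis by (simp add: lookup_rho)
    qed
  qed
  with W that show ?thesis by blast
qed

text \<open>Any nonzero coefficient sits at a regular exponent of the box, hence in the orbit of
  \<open>rho n\<close>, and antisymmetry would carry it to a nonzero coefficient at
  \<open>rho n\<close>.\<close>

lemma antisym_in_box_eq_0:
  assumes f: "antisym_laurent n f" "in_box n f" "Poly_Mapping.lookup f (rho n) = 0"
  shows "f = 0"
proof (rule ccontr)
  assume "f \<noteq> 0"
  then obtain \<nu> where \<nu>: "Poly_Mapping.lookup f \<nu> \<noteq> 0"
    by (metis poly_mapping_eqI lookup_zero)
  obtain w where w: "w \<in> W_fin n" "signed_act_expo w \<nu> = rho n"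
  proof (rule regular_in_orbit[of \<nu> n])
    show "\<bar>Poly_Mapping.lookup \<nu> k\<bar> \<le> (if k \<in> {1..n} then int n else 0)" for k
      using f(2) \<nu>[folded in_keys_iff] unfolding in_box_def by blast
  qed (use antisym_regular[OF f(1) \<nu>] in auto)
  have "Poly_Mapping.lookup f \<nu> = Poly_Mapping.lookup (signed_act w f) (rho n)"
    using lookup_signed_act[OF w(1), of f \<nu>] w(2) by simp
  also have "\<dots> = 0"
    using f w(1) by (simp add: antisym_laurent_def lookup_single_0_mult)
  finally show False using \<nu> by simp
qed

subsection \<open>Bounds on exponents\<close>

definition exps_bounded :: "nat \<Rightarrow> laurent \<Rightarrow> int \<Rightarrow> bool" where
  "exps_bounded k f b \<longleftrightarrow> (\<forall>\<nu>\<in>Poly_Mapping.keys f. \<bar>Poly_Mapping.lookup \<nu> k\<bar> \<le> b)"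

lemma exps_bounded_single: "\<bar>Poly_Mapping.lookup \<nu> k\<bar> \<le> b \<Longrightarrow> exps_bounded k (Poly_Mapping.single \<nu> c) b"
  by (simp add: exps_bounded_def)

lemma exps_bounded_add: "exps_bounded k f b \<Longrightarrow> exps_bounded k g b \<Longrightarrow> exps_bounded k (f + g) b"
  unfolding exps_bounded_def using keys_add[of f g] by blast

lemma exps_bounded_diff: "exps_bounded k f b \<Longrightarrow> exps_bounded k g b \<Longrightarrow> exps_bounded k (f - g) b"
  using exps_bounded_add[of k f b "- g"] by (simp add: exps_bounded_def in_keys_iff)

lemma exps_bounded_mult:
  assumes "exps_bounded k f b" "exps_bounded k g c"
  shows "exps_bounded k (f * g) (b + c)"
  unfolding exps_bounded_def
proof
  fix \<nu> assume "\<nu> \<in> Poly_Mapping.keys (f * g)"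
  then obtain \<mu> \<kappa> where "\<nu> = \<mu> + \<kappa>" "\<mu> \<in> Poly_Mapping.keys f" "\<kappa> \<in> Poly_Mapping.keys g"
    using keys_mult[of f g] by blast
  with assms show "\<bar>Poly_Mapping.lookup \<nu> k\<bar> \<le> b + c"
    unfolding exps_bounded_def lookup_add by (fastforce simp: lookup_add intro: order_trans[OF abs_triangle_ineq] add_mono)
qed

lemma exps_bounded_prod:
  assumes "\<And>i. i \<in> A \<Longrightarrow> exps_bounded k (f i) (b i)"
  shows "exps_bounded k (\<Prod>i\<in>A. f i) (\<Sum>i\<in>A. b i)"
  using assms
proof (induction A rule: infinite_finite_induct)
  case (insert i A)
  then show ?case using exps_bounded_mult[of k "f i" "b i"] by simp
qed (use exps_bounded_single[of 0 k 0 1] in simp_all)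

lemma exps_bounded_mac_single: "exps_bounded k (mac_single c d (int i)) (if k = i then 1 else 0)"
  unfolding mac_single_def
  by (intro exps_bounded_add exps_bounded_diff exps_bounded_single) (auto simp: signed_eps_def lookup_single when_def sgn_if)

lemma exps_bounded_mac_pair: "exps_bounded k (mac_pair t (int i) (int j)) (if k = i \<or> k = j then 1 else 0)"
  unfolding mac_pair_def
  by (intro exps_bounded_add exps_bounded_diff exps_bounded_single) (auto simp: signed_eps_def lookup_single when_def sgn_if)

text \<open>An index occurs in one single factor and in n - 1 pair factors, and each of them changes
  its exponent by at most 1; this is where the side length n of the box comes from.\<close>

lemma in_box_mac_prod: "in_box n (mac_prod n t c d)"
proof -
  have "exps_bounded k (mac_prod n t c d) (if k \<in> {1..n} then int n else 0)" for k
  proof -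
    have "exps_bounded k (\<Prod>p\<in>index_pairs n. mac_pair t (int (fst p)) (int (snd p))) (\<Sum>p\<in>index_pairs n. if k = fst p \<or> k = snd p then 1 else 0)"
      by (intro exps_bounded_prod exps_bounded_mac_pair)
    moreover have "(\<Sum>p\<in>index_pairs n. if k = fst p \<or> k = snd p then 1 else 0 :: int) =
        int (card {p \<in> index_pairs n. k = fst p \<or> k = snd p})"
      by (simp add: sum.If_cases Int_def)
    moreover have "card {p \<in> index_pairs n. k = fst p \<or> k = snd p} = (if k \<in> {1..n} then n - 1 else 0)"
    proof (cases "k \<in> {1..n}")
      case True
      hence eq: "{p \<in> index_pairs n. k = fst p \<or> k = snd p} = (\<lambda>j. (k, j)) ` {k+1..n} \<union> (\<lambda>i. (i, k)) ` {1..<k}"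
        by (auto simp: index_pairs_def)
      have "card {p \<in> index_pairs n. k = fst p \<or> k = snd p} = card {k+1..n} + card {1..<k}"
        unfolding eq by (subst card_Un_disjoint) (auto simp: card_image inj_on_def)
      with True show ?thesis by auto
    next
      case False
      hence eq: "{p \<in> index_pairs n. k = fst p \<or> k = snd p} = {}" by (auto simp: index_pairs_def)
      show ?thesis unfolding eq if_not_P[OF False] by simp
    qed
    ultimately have "exps_bounded k (\<Prod>(i,j)\<in>index_pairs n. mac_pair t (int i) (int j)) (if k \<in> {1..n} then int n - 1 else 0)"
      by (cases "k \<in> {1..n}") (auto simp: case_prod_beta of_nat_diff)
    moreover have "exps_bounded k (\<Prod>i=1..n. mac_single c d (int i)) (\<Sum>i=1..n. if k = i then 1 else 0)"
      by (intro exps_bounded_prod exps_bounded_mac_single)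
    hence "exps_bounded k (\<Prod>i=1..n. mac_single c d (int i)) (if k \<in> {1..n} then 1 else 0)"
      by simp
    ultimately show ?thesis
      unfolding mac_prod_def using exps_bounded_mult by (fastforce split: if_splits)
  qed
  then show ?thesis by (simp add: in_box_def exps_bounded_def)
qed

lemma in_box_signed_act:
  assumes "in_box n f" and w: "w \<in> W_fin n"
  shows "in_box n (signed_act w f)"
  unfolding in_box_def
proof (intro ballI allI)
  fix \<nu> k assume \<nu>: "\<nu> \<in> Poly_Mapping.keys (signed_act w f)"
  obtain \<mu> where \<mu>: "\<nu> = signed_act_expo w \<mu>" using signed_act_expo_surj[OF w] .
  hence "\<mu> \<in> Poly_Mapping.keys f"
    using \<nu> by (simp add: in_keys_iff lookup_signed_act[OF w])
  obtain i where i: "k = nat \<bar>w (int i)\<bar>" "k \<in> {1..n} \<longleftrightarrow> i \<in> {1..n}"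
    using W_hits[OF w] .
  have "\<bar>Poly_Mapping.lookup \<nu> k\<bar> \<le> \<bar>Poly_Mapping.lookup \<mu> i\<bar>"
    unfolding \<mu> i(1) lookup_signed_act_expo[OF w] by (simp add: abs_mult sgn_if)
  also have "\<dots> \<le> (if i \<in> {1..n} then int n else 0)"
    using assms(1) \<open>\<mu> \<in> _\<close> unfolding in_box_def by blast
  finally show "\<bar>Poly_Mapping.lookup \<nu> k\<bar> \<le> (if k \<in> {1..n} then int n else 0)"
    using i(2) by simp
qed

lemma in_box_add: "in_box n f \<Longrightarrow> in_box n g \<Longrightarrow> in_box n (f + g)"
  unfolding in_box_def using keys_add[of f g] by blast

lemma in_box_scale: "in_box n f \<Longrightarrow> in_box n (Poly_Mapping.single 0 c * f)"
  by (auto simp: in_box_def in_keys_iff lookup_single_0_mult)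

lemma in_box_sum: "(\<And>i. i \<in> A \<Longrightarrow> in_box n (f i)) \<Longrightarrow> in_box n (\<Sum>i\<in>A. f i)"
proof (induction A rule: infinite_finite_induct)
  case (insert i A)
  then show ?case by (simp add: in_box_add)
qed (simp_all add: in_box_def)

theorem macdonald_identity:
  "(\<Sum>w\<in>W_fin n. Poly_Mapping.single 0 (sign_char n w) * signed_act w (mac_prod n t c d)) =
     Poly_Mapping.single 0 (W0 n t (- (c * d))) * weyl_denom n" (is "?J = ?R")
proof -
  let ?m = "Poly_Mapping.single 0 (- 1) :: laurent"
  have anti: "antisym_laurent n ?J" by (rule antisym_sum)
  have "antisym_laurent n (?J - ?R)"
    using anti unfolding antisym_laurent_def
    by (simp add: signed_act.hom_diff signed_act.hom_mult signed_act_single_0 signed_act_weyl_denom algebra_simps)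
  moreover have "in_box n (?J + Poly_Mapping.single 0 (- W0 n t (- (c * d))) * weyl_denom n)"
    by (intro in_box_add in_box_sum in_box_scale in_box_signed_act in_box_mac_prod)
  hence "in_box n (?J - ?R)"
    by (simp add: single_uminus)
  moreover have "Poly_Mapping.lookup (?J - ?R) (rho n) = 0"
  proof -
    have "Poly_Mapping.lookup ?J (rho n) = (\<Sum>w\<in>W_fin n. t ^ ell_s n w * (- (c * d)) ^ ell_d n w)"
      unfolding lookup_sum lookup_single_0_mult
    proof (intro sum.cong refl)
      fix w assume w: "w \<in> W_fin n"
      show "sign_char n w * Poly_Mapping.lookup (signed_act w (mac_prod n t c d)) (rho n) = t ^ ell_s n w * (- (c * d)) ^ ell_d n w"
      proof -
        \<comment> \<open>Splitting the sign between the two statistics turns - t into t and c d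
          into - (c d).\<close>
        have "sign_char n w * Poly_Mapping.lookup (signed_act w (mac_prod n t c d)) (rho n) =
            ((- 1) ^ ell_s n w * (- t) ^ ell_s n w) * ((- 1) ^ ell_d n w * (c * d) ^ ell_d n w)"
          unfolding has_leading_term_lookup[OF has_leading_term_signed_act_mac_prod[OF w]] sign_char_def power_add by (simp add: mult_ac)
        then show ?thesis unfolding power_mult_distrib[symmetric] by simp
      qed
    qed
    then show ?thesis
      by (simp add: lookup_minus lookup_single_0_mult lookup_weyl_denom_rho W0_eq)
  qed
  ultimately have "?J - ?R = 0" by (rule antisym_in_box_eq_0)
  then show ?thesis by simp
qed

section \<open>Power series over Laurent polynomials\<close>

lemma fps_map_hom:
  assumes "ring_hom_1 \<phi>"
  shows "ring_hom_1 (\<lambda>F. Abs_fps (\<lambda>k. \<phi> (fps_nth F k)))"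
proof -
  interpret ring_hom_1 \<phi> by fact
  show ?thesis
    by standard (auto simp: fps_eq_iff fps_mult_nth hom_simps)
qed

definition fps_act :: "(int \<Rightarrow> int) \<Rightarrow> laurent fps \<Rightarrow> laurent fps" where
  "fps_act w F = Abs_fps (\<lambda>k. signed_act w (fps_nth F k))"

lemma fps_act_hom: "ring_hom_1 (fps_act w)"
  unfolding fps_act_def[abs_def] by (rule fps_map_hom[OF signed_act_hom])

interpretation fps_act: ring_hom_1 "fps_act w" for w by (rule fps_act_hom)

lemma nth_fps_act [simp]: "fps_nth (fps_act w F) k = signed_act w (fps_nth F k)"
  by (simp add: fps_act_def)

lemma nth_xterm [simp]: "fps_nth (xterm c \<nu>) k = Poly_Mapping.single \<nu> (fps_nth c k)"
  by (simp add: xterm_def)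

lemma fps_act_xterm: "fps_act w (xterm c \<nu>) = xterm c (signed_act_expo w \<nu>)"
  by (simp add: fps_eq_iff signed_act_single)

lemma nth_mult_cong:
  assumes "\<And>j. j \<le> k \<Longrightarrow> fps_nth F j = fps_nth G j"
  shows "fps_nth (H * F) k = fps_nth (H * G) k"
  unfolding fps_mult_nth using assms by (intro sum.cong) auto

text \<open>Factor r agrees with 1 below degree r, so factors with index above k cannot affect the
  coefficient of degree k.\<close>

lemma nth_prod_stable:
  fixes f :: "nat \<Rightarrow> 'a::comm_ring_1 fps"
  assumes "\<And>r j. j < r \<Longrightarrow> fps_nth (f r) j = fps_nth 1 j"
  shows "k \<le> N \<Longrightarrow> fps_nth (\<Prod>i\<le>N. f i) k = fps_nth (\<Prod>i\<le>k. f i) k"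
proof (induction N rule: dec_induct)
  case (step N)
  have "fps_nth ((\<Prod>i\<le>N. f i) * f (Suc N)) k = fps_nth ((\<Prod>i\<le>N. f i) * 1) k"
    using assms step by (intro nth_mult_cong) auto
  with step show ?case by simp
qed simp

abbreviation series_q :: "ratfun fps" where "series_q \<equiv> gpar Qh ^ 2"

abbreviation qpoch_factor :: "ratfun fps \<Rightarrow> expo \<Rightarrow> nat \<Rightarrow> laurent fps" where
  "qpoch_factor c \<nu> r \<equiv> 1 - xterm (c * series_q ^ r) \<nu>"

lemma series_q_power: "series_q ^ r = fps_const (par Qh ^ (2 * r)) * fps_X ^ (2 * r)"
  by (simp add: gpar_def power_mult_distrib power_mult[symmetric] fps_const_power mult.commute)

lemma nth_series_q_power_mult: "j < r \<Longrightarrow> fps_nth (c * series_q ^ r) j = 0"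
proof -
  assume "j < r"
  have "c * series_q ^ r = fps_X ^ (2 * r) * (c * fps_const (par Qh ^ (2 * r)))"
    unfolding series_q_power by (simp only: mult_ac)
  then show ?thesis unfolding \<open>c * series_q ^ r = _\<close> fps_X_power_mult_nth using \<open>j < r\<close> by simp
qed

lemma series_q_mult_0 [simp]: "fps_nth (series_q * c) 0 = 0" "fps_nth series_q 0 = 0"
  using nth_series_q_power_mult[of 0 1 c] nth_series_q_power_mult[of 0 1 1] by (simp_all add: mult.commute)

lemma nth_qpoch:
  assumes "fps_nth c 0 = 0 \<or> \<nu> \<noteq> 0" "k \<le> N"
  shows "fps_nth (qpoch c \<nu>) k = fps_nth (\<Prod>i\<le>N. qpoch_factor c \<nu> i) k"
proof -
  define P where "P = Abs_fps (\<lambda>k. fps_nth (\<Prod>i\<le>k. qpoch_factor c \<nu> i) k)"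
  have stable: "fps_nth (\<Prod>i\<le>N. qpoch_factor c \<nu> i) k = fps_nth P k" if "k \<le> N" for k N
    unfolding P_def fps_nth_Abs_fps using that
    by (intro nth_prod_stable) (simp_all add: nth_series_q_power_mult)
  have "(\<lambda>N. \<Prod>i\<le>N. qpoch_factor c \<nu> i) \<longlonglongrightarrow> P"
  proof (rule tendsto_fpsI)
    fix k
    show "\<forall>\<^sub>F N in sequentially. fps_nth (\<Prod>i\<le>N. qpoch_factor c \<nu> i) k = fps_nth P k"
      using eventually_ge_at_top[of k] by eventually_elim (rule stable)
  qed
  \<comment> \<open>\<open>has_prod\<close> requires a nonzero limit. The assumption guarantees it:
    the constant coefficient 1 - c_0 x^\<nu> vanishes only for c_0 = 1 and \<nu> = 0.\<close>
  moreover have "fps_nth P 0 \<noteq> 0"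
  proof
    assume "fps_nth P 0 = 0"
    hence "Poly_Mapping.lookup (1 - Poly_Mapping.single \<nu> (fps_nth c 0)) 0 = 0"
      by (simp add: P_def)
    with assms(1) show False by (auto simp: lookup_minus lookup_single lookup_one)
  qed
  hence "P \<noteq> 0" by auto
  ultimately have "qpoch_factor c \<nu> has_prod P"
    by (simp add: has_prod_def raw_has_prod_def)
  hence "qpoch c \<nu> = P"
    unfolding qpoch_def by (simp add: has_prod_unique[symmetric])
  with stable[OF assms(2)] show ?thesis by simp
qed

lemma qpoch_step:
  assumes "fps_nth c 0 = 0 \<or> \<nu> \<noteq> 0"
  shows "qpoch c \<nu> = (1 - xterm c \<nu>) * qpoch (series_q * c) \<nu>"
proof (rule fps_ext)
  fix k
  have "fps_nth (qpoch c \<nu>) k = fps_nth (\<Prod>i\<le>Suc k. qpoch_factor c \<nu> i) k"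
    by (rule nth_qpoch[OF assms]) simp
  also have "(\<Prod>i\<le>Suc k. qpoch_factor c \<nu> i) = (1 - xterm c \<nu>) * (\<Prod>i\<le>k. qpoch_factor (series_q * c) \<nu> i)"
    by (subst prod.atMost_Suc_shift) (simp add: mult_ac)
  also have "fps_nth \<dots> k = fps_nth ((1 - xterm c \<nu>) * qpoch (series_q * c) \<nu>) k"
  proof (rule nth_mult_cong)
    fix j assume "j \<le> k"
    then show "fps_nth (\<Prod>i\<le>k. qpoch_factor (series_q * c) \<nu> i) j = fps_nth (qpoch (series_q * c) \<nu>) j"
      by (intro nth_qpoch[symmetric]) simp_all
  qed
  finally show "fps_nth (qpoch c \<nu>) k = fps_nth ((1 - xterm c \<nu>) * qpoch (series_q * c) \<nu>) k" .
qed

lemma nth_qpoch_0: "fps_nth c 0 = 0 \<Longrightarrow> fps_nth (qpoch c \<nu>) 0 = 1"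
  using nth_qpoch[of c \<nu> 0 0] by simp

lemma fps_act_qpoch:
  assumes "w \<in> W_fin n" "fps_nth c 0 = 0 \<or> \<nu> \<noteq> 0"
  shows "fps_act w (qpoch c \<nu>) = qpoch c (signed_act_expo w \<nu>)"
proof (rule fps_ext)
  fix k
  have "fps_nth c 0 = 0 \<or> signed_act_expo w \<nu> \<noteq> 0"
    using assms(2) signed_act_expo_eq_iff[OF assms(1), of \<nu> 0] by auto
  hence "fps_nth (qpoch c (signed_act_expo w \<nu>)) k = fps_nth (fps_act w (\<Prod>i\<le>k. qpoch_factor c \<nu> i)) k"
    by (simp add: nth_qpoch[of c _ k k] fps_act.hom_simps fps_act_xterm)
  then show "fps_nth (fps_act w (qpoch c \<nu>)) k = fps_nth (qpoch c (signed_act_expo w \<nu>)) k"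
    by (simp add: nth_qpoch[OF assms(2), of k k])
qed

lemma unit_inverse_right: "fps_nth F 0 = 1 \<Longrightarrow> F * unit_inverse F = 1"
  unfolding unit_inverse_def by (rule fps_right_inverse) simp

lemma unit_inverse_eqI:
  assumes "F * G = 1" "fps_nth F 0 = 1"
  shows "unit_inverse F = G"
proof -
  have "unit_inverse F = (F * G) * unit_inverse F" by (simp add: assms)
  also have "\<dots> = G * (F * unit_inverse F)" by (simp only: mult_ac)
  finally show ?thesis by (simp add: unit_inverse_right[OF assms(2)])
qed

lemma unit_inverse_mult:
  assumes "fps_nth F 0 = 1" "fps_nth G 0 = 1"
  shows "unit_inverse (F * G) = unit_inverse F * unit_inverse G"
proof (rule unit_inverse_eqI)
  have "F * G * (unit_inverse F * unit_inverse G) = (F * unit_inverse F) * (G * unit_inverse G)"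
    by (simp only: mult_ac)
  then show "F * G * (unit_inverse F * unit_inverse G) = 1"
    by (simp add: unit_inverse_right assms)
qed (simp add: assms)

definition qinv :: "ratfun fps \<Rightarrow> expo \<Rightarrow> laurent fps" where
  "qinv c \<nu> = unit_inverse (qpoch c \<nu>)"

lemma qpoch_qinv: "fps_nth c 0 = 0 \<Longrightarrow> qpoch c \<nu> * qinv c \<nu> = 1"
  unfolding qinv_def by (intro unit_inverse_right nth_qpoch_0)

text \<open>Shifting c to q c drops the leading factor of the infinite product, so its inverse gains
  that factor. Hence a parameter shift multiplies the kernel by a polynomial.\<close>

lemma qinv_step:
  assumes "fps_nth c 0 = 0"
  shows "qinv (series_q * c) \<nu> = qinv c \<nu> * (1 - xterm c \<nu>)"
  unfolding qinv_def[of "series_q * c"]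
proof (rule unit_inverse_eqI)
  have "qpoch (series_q * c) \<nu> * (qinv c \<nu> * (1 - xterm c \<nu>)) = ((1 - xterm c \<nu>) * qpoch (series_q * c) \<nu>) * qinv c \<nu>"
    by (simp only: mult_ac)
  also have "\<dots> = 1"
    using qpoch_qinv[OF assms] assms by (simp add: qpoch_step[symmetric])
  finally show "qpoch (series_q * c) \<nu> * (qinv c \<nu> * (1 - xterm c \<nu>)) = 1" .
qed (simp add: nth_qpoch_0)

lemma fps_act_qinv:
  assumes "w \<in> W_fin n" "fps_nth c 0 = 0"
  shows "fps_act w (qinv c \<nu>) = qinv c (signed_act_expo w \<nu>)"
  unfolding qinv_def[of c "signed_act_expo w \<nu>"]
proof (rule unit_inverse_eqI[symmetric])
  have "qpoch c (signed_act_expo w \<nu>) * fps_act w (qinv c \<nu>) = fps_act w (qpoch c \<nu> * qinv c \<nu>)"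
    using assms by (simp add: fps_act.hom_mult fps_act_qpoch)
  then show "qpoch c (signed_act_expo w \<nu>) * fps_act w (qinv c \<nu>) = 1"
    using assms by (simp add: qpoch_qinv fps_act.hom_one)
qed (simp add: nth_qpoch_0 assms)

section \<open>The symmetric part of the kernel\<close>

text \<open>The share of one root in S. For a positive root \<alpha> the reciprocal kernel has
  (x^\<alpha>; q) (q x^-\<alpha>; q) over (t x^\<alpha>; q) (t q x^-\<alpha>; q); treating \<alpha>
  and -\<alpha> alike leaves over (1 - x^\<alpha>) (1 - t x^-\<alpha>), which goes into
  \<open>asym_pair\<close>.\<close>

definition root_factor :: "ratfun fps \<Rightarrow> expo \<Rightarrow> laurent fps" where
  "root_factor t \<nu> = qpoch series_q \<nu> * qinv t \<nu>"

definition sym_pair :: "ratfun fps \<Rightarrow> int \<Rightarrow> int \<Rightarrow> laurent fps" where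
  "sym_pair t i j = root_factor t (signed_eps i - signed_eps j) * root_factor t (signed_eps i + signed_eps j) *
     root_factor t (- signed_eps i + signed_eps j) * root_factor t (- signed_eps i - signed_eps j)"

definition qinv_pair :: "ratfun fps \<Rightarrow> expo \<Rightarrow> laurent fps" where
  "qinv_pair c \<nu> = qinv c \<nu> * qinv c (- \<nu>)"

definition sym_single :: "ratfun fps \<Rightarrow> ratfun fps \<Rightarrow> ratfun fps \<Rightarrow> ratfun fps \<Rightarrow> int \<Rightarrow> laurent fps" where
  "sym_single a b c d i = qpoch series_q (signed_eps i + signed_eps i) * qpoch series_q (- signed_eps i - signed_eps i) *
     (qinv_pair a (signed_eps i) * qinv_pair b (signed_eps i) * qinv_pair c (signed_eps i) * qinv_pair d (signed_eps i))"

definition sym_kernel :: "nat \<Rightarrow> ratfun fps \<Rightarrow> ratfun fps \<Rightarrow> ratfun fps \<Rightarrow> ratfun fps \<Rightarrow> ratfun fps \<Rightarrow> laurent fps" where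
  "sym_kernel n t a b c d =
     (\<Prod>i=1..n. sym_single a b c d (int i)) * (\<Prod>(i,j)\<in>index_pairs n. sym_pair t (int i) (int j))"

lemma sym_pair_abs: "sym_pair t i j = sym_pair t \<bar>i\<bar> \<bar>j\<bar>"
proof -
  have "sym_pair t (- i) j = sym_pair t i j" "sym_pair t i (- j) = sym_pair t i j" for i j
    by (simp_all add: sym_pair_def signed_eps_uminus mult_ac)
  then show ?thesis by (simp add: abs_if)
qed

lemma sym_pair_commute: "sym_pair t i j = sym_pair t j i"
proof -
  have eqs: "signed_eps j - signed_eps i = - signed_eps i + signed_eps j" "- signed_eps j + signed_eps i = signed_eps i - signed_eps j"
    "signed_eps j + signed_eps i = signed_eps i + signed_eps j" "- signed_eps j - signed_eps i = - signed_eps i - signed_eps j"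
    by simp_all
  show ?thesis
    unfolding sym_pair_def[of t j i] eqs unfolding sym_pair_def by (simp only: mult_ac)
qed

lemma sym_single_abs: "sym_single a b c d i = sym_single a b c d \<bar>i\<bar>"
proof -
  have "sym_single a b c d (- i) = sym_single a b c d i" for i
    by (simp add: sym_single_def qinv_pair_def signed_eps_uminus mult_ac)
  then show ?thesis by (simp add: abs_if)
qed

text \<open>\<open>sym_single\<close> and \<open>sym_pair\<close> depend only on absolute values,
  and the latter only on the unordered pair, so \<open>w\<close> merely permutes the
  factors.\<close>

lemma fps_act_sym_kernel:
  assumes w: "w \<in> W_fin n" and 0: "fps_nth t 0 = 0" "fps_nth a 0 = 0" "fps_nth b 0 = 0" "fps_nth c 0 = 0" "fps_nth d 0 = 0"
  shows "fps_act w (sym_kernel n t a b c d) = sym_kernel n t a b c d"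
proof -
  have diff: "signed_act_expo w (\<mu> - \<nu>) = signed_act_expo w \<mu> - signed_act_expo w \<nu>" for \<mu> \<nu>
    using signed_act_expo_add[of w \<mu> "- \<nu>"] by (simp add: signed_act_expo_uminus)
  have double: "signed_act_expo w (2 * \<nu>) = 2 * signed_act_expo w \<nu>" for \<nu>
    by (simp only: mult_2 signed_act_expo_add)
  have single: "fps_act w (sym_single a b c d i) = sym_single a b c d (w i)" if "i \<noteq> 0" for i
    using that unfolding sym_single_def qinv_pair_def
    by (simp add: fps_act.hom_mult fps_act_qpoch[OF w] fps_act_qinv[OF w] 0 signed_act_expo_add diff double signed_act_expo_uminus signed_act_expo_signed_eps[OF w])
  have pair: "fps_act w (sym_pair t i j) = sym_pair t (w i) (w j)" if "i \<noteq> 0" "j \<noteq> 0" for i j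
    using that unfolding sym_pair_def root_factor_def
    by (simp add: fps_act.hom_mult fps_act_qpoch[OF w] fps_act_qinv[OF w] 0 signed_act_expo_add diff double signed_act_expo_uminus signed_act_expo_signed_eps[OF w])
  have "(\<Prod>i=1..n. fps_act w (sym_single a b c d (int i))) = (\<Prod>i=1..n. sym_single a b c d (int (nat \<bar>w (int i)\<bar>)))"
    using sym_single_abs by (intro prod.cong) (auto simp: single)
  also have "\<dots> = (\<Prod>i=1..n. sym_single a b c d (int i))"
    by (rule prod.reindex_bij_betw[OF W_perm_bij[OF w]])
  finally have 1: "(\<Prod>i=1..n. fps_act w (sym_single a b c d (int i))) = (\<Prod>i=1..n. sym_single a b c d (int i))" .
  let ?\<sigma> = "\<lambda>i. nat \<bar>w (int i)\<bar>"
  have "(\<Prod>(i,j)\<in>index_pairs n. fps_act w (sym_pair t (int i) (int j))) =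
      (\<Prod>(i,j)\<in>index_pairs n. sym_pair t (int (min (?\<sigma> i) (?\<sigma> j))) (int (max (?\<sigma> i) (?\<sigma> j))))"
  proof (intro prod.cong refl, clarify)
    fix i j assume "(i, j) \<in> index_pairs n"
    hence "fps_act w (sym_pair t (int i) (int j)) = sym_pair t (int (?\<sigma> i)) (int (?\<sigma> j))"
      using sym_pair_abs by (auto simp: pair index_pairs_iff)
    also have "\<dots> = sym_pair t (int (min (?\<sigma> i) (?\<sigma> j))) (int (max (?\<sigma> i) (?\<sigma> j)))"
      unfolding min_def max_def using sym_pair_commute by (cases "?\<sigma> i \<le> ?\<sigma> j") (simp_all only: if_True if_False)
    finally show "fps_act w (sym_pair t (int i) (int j)) =
        sym_pair t (int (min (?\<sigma> i) (?\<sigma> j))) (int (max (?\<sigma> i) (?\<sigma> j)))" .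
  qed
  also have "\<dots> = (\<Prod>(i,j)\<in>index_pairs n. sym_pair t (int i) (int j))"
    by (rule prod_index_pairs_reindex[OF W_perm_bij[OF w], of "\<lambda>i j. sym_pair t (int i) (int j)"])
  finally have 2: "(\<Prod>(i,j)\<in>index_pairs n. fps_act w (sym_pair t (int i) (int j))) = (\<Prod>(i,j)\<in>index_pairs n. sym_pair t (int i) (int j))" .
  show ?thesis
    using 1 2 by (simp add: sym_kernel_def fps_act.hom_mult fps_act.hom_prod case_prod_beta)
qed

definition shift_single :: "ratfun fps \<Rightarrow> nat \<Rightarrow> laurent fps" where
  "shift_single c i = (1 - xterm c (signed_eps (int i))) * (1 - xterm c (- signed_eps (int i)))"

definition shift_pair :: "ratfun fps \<Rightarrow> nat \<Rightarrow> nat \<Rightarrow> laurent fps" where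
  "shift_pair t i j = (1 - xterm t (signed_eps (int i) - signed_eps (int j))) * (1 - xterm t (signed_eps (int i) + signed_eps (int j))) *
     (1 - xterm t (- signed_eps (int i) + signed_eps (int j))) * (1 - xterm t (- signed_eps (int i) - signed_eps (int j)))"

lemma sym_kernel_shift_single:
  assumes "fps_nth c 0 = 0" "fps_nth d 0 = 0"
  shows "sym_kernel n t a b (series_q * c) (series_q * d) =
    (\<Prod>i=1..n. shift_single c i * shift_single d i) * sym_kernel n t a b c d"
proof -
  have "sym_single a b (series_q * c) (series_q * d) (int i) = (shift_single c i * shift_single d i) * sym_single a b c d (int i)" for i
    unfolding sym_single_def shift_single_def qinv_pair_def qinv_step[OF assms(1)] qinv_step[OF assms(2)]
    by (simp only: mult_ac)
  then show ?thesis
    by (simp add: sym_kernel_def prod.distrib mult.assoc)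
qed

lemma sym_kernel_shift_pair:
  assumes "fps_nth t 0 = 0"
  shows "sym_kernel n (series_q * t) a b c d = (\<Prod>(i,j)\<in>index_pairs n. shift_pair t i j) * sym_kernel n t a b c d"
proof -
  have "sym_pair (series_q * t) (int i) (int j) = shift_pair t i j * sym_pair t (int i) (int j)" for i j
    unfolding sym_pair_def shift_pair_def root_factor_def qinv_step[OF assms]
    by (simp only: mult_ac)
  then show ?thesis
    by (simp add: sym_kernel_def prod.distrib case_prod_beta mult_ac)
qed

definition asym_single :: "ratfun fps \<Rightarrow> ratfun fps \<Rightarrow> nat \<Rightarrow> laurent fps" where
  "asym_single c d i = (1 - xterm 1 (signed_eps (int i) + signed_eps (int i))) * (1 - xterm c (- signed_eps (int i))) * (1 - xterm d (- signed_eps (int i)))"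

definition asym_pair :: "ratfun fps \<Rightarrow> nat \<Rightarrow> nat \<Rightarrow> laurent fps" where
  "asym_pair t i j = (1 - xterm 1 (signed_eps (int i) - signed_eps (int j))) * (1 - xterm 1 (signed_eps (int i) + signed_eps (int j))) *
     (1 - xterm t (- signed_eps (int i) + signed_eps (int j))) * (1 - xterm t (- signed_eps (int i) - signed_eps (int j)))"

definition asym_kernel :: "nat \<Rightarrow> ratfun fps \<Rightarrow> ratfun fps \<Rightarrow> ratfun fps \<Rightarrow> laurent fps" where
  "asym_kernel n t c d = (\<Prod>i=1..n. asym_single c d i) * (\<Prod>(i,j)\<in>index_pairs n. asym_pair t i j)"

lemma eps_eq_signed_eps: "1 \<le> i \<Longrightarrow> eps i = signed_eps (int i)"
  by (simp add: eps_def signed_eps_def)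

text \<open>Leading factors are split off from the products \<open>qpoch 1\<close>, and each inverse
  with parameter q t, q c or q d is completed to one with t, c or d by \<open>qinv_step\<close>. The
  factors with a and b are symmetric as they stand.\<close>

lemma inv_kernel_eq:
  fixes t t0h u0h tnh unh :: "ratfun fps"
  defines "a \<equiv> gpar Qh * t0h * u0h" and "b \<equiv> - (gpar Qh * t0h * inverse u0h)"
    and "c \<equiv> tnh * unh" and "d \<equiv> - (tnh * inverse unh)"
  assumes 0: "fps_nth t 0 = 0" "fps_nth t0h 0 = 0" "fps_nth tnh 0 = 0"
  shows "inv_kernel n t t0h u0h tnh unh = asym_kernel n t c d * sym_kernel n t a b c d"
proof -
  have z: "fps_nth t 0 = 0" "fps_nth a 0 = 0" "fps_nth b 0 = 0" "fps_nth c 0 = 0" "fps_nth d 0 = 0"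
    using 0 by (simp_all add: a_def b_def c_def d_def)
  \<comment> \<open>The products \<open>qpoch 1\<close> have constant term 1 in their parameter, so
    \<open>qpoch_step\<close> applies to them only at nonzero exponents.\<close>
  have nz: "signed_eps (int i) + signed_eps (int i) \<noteq> 0" if "1 \<le> i" for i
  proof
    assume "signed_eps (int i) + signed_eps (int i) = 0"
    hence "Poly_Mapping.lookup (signed_eps (int i)) i + Poly_Mapping.lookup (signed_eps (int i)) i = 0"
      by (simp only: lookup_add[symmetric] lookup_zero)
    with that show False by (simp add: signed_eps_def)
  qed
  have nz2: "signed_eps (int i) + signed_eps (int j) \<noteq> 0" "signed_eps (int i) - signed_eps (int j) \<noteq> 0" if "(i, j) \<in> index_pairs n" for i j
  proof -
    have "Poly_Mapping.lookup (signed_eps (int i) + signed_eps (int j)) i \<noteq> 0" "Poly_Mapping.lookup (signed_eps (int i) - signed_eps (int j)) i \<noteq> 0"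
      using that by (auto simp: index_pairs_iff signed_eps_def lookup_add lookup_minus lookup_single)
    then show "signed_eps (int i) + signed_eps (int j) \<noteq> 0" "signed_eps (int i) - signed_eps (int j) \<noteq> 0" by (metis lookup_zero)+
  qed
  have step1: "qpoch 1 \<nu> = (1 - xterm 1 \<nu>) * qpoch series_q \<nu>" if "\<nu> \<noteq> 0" for \<nu>
    using qpoch_step[of 1 \<nu>] that by simp
  have single: "qpoch 1 (eps i + eps i) * qpoch series_q (- eps i - eps i) *
      unit_inverse (qpoch c (eps i) * qpoch (series_q * c) (- eps i) * qpoch d (eps i) * qpoch (series_q * d) (- eps i) *
        qpoch a (eps i) * qpoch a (- eps i) * qpoch b (eps i) * qpoch b (- eps i)) =
      asym_single c d i * sym_single a b c d (int i)" if "1 \<le> i" for i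
  proof -
    have ui: "unit_inverse (qpoch c \<mu> * qpoch (series_q * c) \<nu> * qpoch d \<mu> * qpoch (series_q * d) \<nu> *
        qpoch a \<mu> * qpoch a \<nu> * qpoch b \<mu> * qpoch b \<nu>) =
        qinv c \<mu> * qinv (series_q * c) \<nu> * qinv d \<mu> * qinv (series_q * d) \<nu> * qinv a \<mu> * qinv a \<nu> * qinv b \<mu> * qinv b \<nu>" for \<mu> \<nu>
      by (simp add: unit_inverse_mult nth_qpoch_0 z qinv_def)
    show ?thesis
      unfolding eps_eq_signed_eps[OF that] step1[OF nz[OF that]] ui qinv_step[OF z(4)] qinv_step[OF z(5)]
        asym_single_def sym_single_def qinv_pair_def
      by (simp only: mult_ac)
  qed
  have pair: "qpoch 1 (eps i - eps j) * qpoch 1 (eps i + eps j) * qpoch series_q (- eps i + eps j) * qpoch series_q (- eps i - eps j) *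
      unit_inverse (qpoch t (eps i - eps j) * qpoch t (eps i + eps j) *
        qpoch (t * series_q) (- eps i + eps j) * qpoch (t * series_q) (- eps i - eps j)) =
      asym_pair t i j * sym_pair t (int i) (int j)" if "(i, j) \<in> index_pairs n" for i j
  proof -
    have e: "eps i = signed_eps (int i)" "eps j = signed_eps (int j)" using that by (auto simp: index_pairs_iff eps_eq_signed_eps)
    have ui: "unit_inverse (qpoch t \<kappa> * qpoch t \<iota> * qpoch (t * series_q) \<mu> * qpoch (t * series_q) \<nu>) =
        qinv t \<kappa> * qinv t \<iota> * qinv (series_q * t) \<mu> * qinv (series_q * t) \<nu>" for \<kappa> \<iota> \<mu> \<nu>
      by (simp add: unit_inverse_mult nth_qpoch_0 z qinv_def mult.commute[of t])
    show ?thesis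
      unfolding e step1[OF nz2(1)[OF that]] step1[OF nz2(2)[OF that]] ui qinv_step[OF z(1)]
        asym_pair_def sym_pair_def root_factor_def
      by (simp only: mult_ac)
  qed
  have "inv_kernel n t t0h u0h tnh unh =
     (\<Prod>(i,j)\<in>index_pairs n. asym_pair t i j * sym_pair t (int i) (int j)) *
     (\<Prod>i=1..n. asym_single c d i * sym_single a b c d (int i))"
    unfolding inv_kernel_def Let_def prod_index_pairs a_def[symmetric] b_def[symmetric] c_def[symmetric] d_def[symmetric]
  proof (rule arg_cong2[of _ _ _ _ "(*)"]; rule prod.cong, rule refl)
    fix p assume "p \<in> index_pairs n"
    then obtain i j where p: "p = (i, j)" "(i, j) \<in> index_pairs n" by (cases p) auto
    show "(case p of (i, j) \<Rightarrow> qpoch 1 (eps i - eps j) * qpoch 1 (eps i + eps j) * qpoch series_q (- eps i + eps j) * qpoch series_q (- eps i - eps j) *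
      unit_inverse (qpoch t (eps i - eps j) * qpoch t (eps i + eps j) *
        qpoch (t * series_q) (- eps i + eps j) * qpoch (t * series_q) (- eps i - eps j))) =
      (case p of (i, j) \<Rightarrow> asym_pair t i j * sym_pair t (int i) (int j))"
      unfolding p(1) prod.case by (rule pair[OF p(2)])
  next
    fix i assume "i \<in> {1..n}"
    hence "1 \<le> i" by simp
    then show "qpoch 1 (eps i + eps i) * qpoch series_q (- eps i - eps i) *
      unit_inverse (qpoch c (eps i) * qpoch (series_q * c) (- eps i) * qpoch d (eps i) * qpoch (series_q * d) (- eps i) *
        qpoch a (eps i) * qpoch a (- eps i) * qpoch b (eps i) * qpoch b (- eps i)) =
      asym_single c d i * sym_single a b c d (int i)"
      by (rule single)
  qed
  also have "\<dots> = asym_kernel n t c d * sym_kernel n t a b c d"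
    unfolding asym_kernel_def sym_kernel_def case_prod_unfold prod.distrib by (simp only: mult_ac)
  finally show ?thesis .
qed

section \<open>Constant terms\<close>

lemma ct_add: "ct (h + k) G = ct h G + ct k G"
  unfolding ct_def
  by (rule sum_keys_add[of "\<lambda>\<nu> c. expand c * fps_to_fls (Abs_fps (\<lambda>k. Poly_Mapping.lookup (fps_nth G k) (- \<nu>)))"])
     (simp_all add: expand.hom_zero expand.hom_add distrib_right)

lemma ct_zero: "ct 0 G = 0"
  by (simp add: ct_def)

lemma ct_single:
  "ct (Poly_Mapping.single \<nu> c) G = expand c * fps_to_fls (Abs_fps (\<lambda>k. Poly_Mapping.lookup (fps_nth G k) (- \<nu>)))"
  by (simp add: ct_def expand.hom_zero)

lemma ct_uminus: "ct (- h) G = - ct h G"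
  using ct_add[of h "- h" G] by (simp add: ct_zero eq_neg_iff_add_eq_0 add.commute)

lemma ct_diff: "ct (h - k) G = ct h G - ct k G"
  using ct_add[of h "- k" G] by (simp add: ct_uminus)

lemma ct_sum: "ct (sum F A) G = (\<Sum>i\<in>A. ct (F i) G)"
  by (induction A rule: infinite_finite_induct) (simp_all add: ct_zero ct_add)

lemma ct_scale: "ct (Poly_Mapping.single 0 c * h) G = expand c * ct h G"
  by (induction h rule: poly_mapping_add_induct)
     (simp_all add: distrib_left ct_add ct_zero mult_single ct_single expand.hom_mult mult.assoc)

lemma ct_diff_right: "ct h (G - H) = ct h G - ct h H"
proof (induction h rule: poly_mapping_add_induct)
  case (add \<nu> c f)
  have "Abs_fps (\<lambda>k. Poly_Mapping.lookup (fps_nth (G - H) k) (- \<nu>)) =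
      Abs_fps (\<lambda>k. Poly_Mapping.lookup (fps_nth G k) (- \<nu>)) - Abs_fps (\<lambda>k. Poly_Mapping.lookup (fps_nth H k) (- \<nu>))"
    by (simp add: fps_eq_iff lookup_minus)
  note eq = this
  show ?case
    unfolding ct_add ct_single eq add by (simp add: algebra_simps)
qed (simp add: ct_zero)

text \<open>The coefficients of x^\<nu> in \<open>h\<close> and of x^-\<nu> in \<open>G\<close> are
  transported together, and \<open>G\<close> is fixed.\<close>

lemma ct_signed_act:
  assumes w: "w \<in> W_fin n" and G: "fps_act w G = G"
  shows "ct (signed_act w h) G = ct h G"
proof (induction h rule: poly_mapping_add_induct)
  case (add \<nu> c f)
  have "Poly_Mapping.lookup (fps_nth G k) (- signed_act_expo w \<nu>) = Poly_Mapping.lookup (fps_nth G k) (- \<nu>)" for k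
  proof -
    have "fps_nth G k = signed_act w (fps_nth G k)" using G by (metis nth_fps_act)
    then show ?thesis using lookup_signed_act[OF w, of "fps_nth G k" "- \<nu>"] by (simp add: signed_act_expo_uminus)
  qed
  with add show ?case
    by (simp add: signed_act.hom_add ct_add signed_act_single ct_single)
qed (simp add: ct_zero signed_act.hom_zero)

text \<open>Expresses that \<open>p\<close> and \<open>p'\<close> are the same Laurent polynomial,
  once over the parameter field and once over power series, without a ring containing both. The
  quantification over all \<open>h\<close> and \<open>G\<close> makes it stable under products and
  differences.\<close>

definition has_expansion :: "laurent \<Rightarrow> laurent fps \<Rightarrow> bool" where
  "has_expansion p p' \<longleftrightarrow> (\<forall>h G. ct (h * p) G = ct h (p' * G))"

lemma has_expansion_one: "has_expansion 1 1"
  by (simp add: has_expansion_def)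

lemma has_expansion_mult: "has_expansion p p' \<Longrightarrow> has_expansion r r' \<Longrightarrow> has_expansion (p * r) (p' * r')"
  unfolding has_expansion_def mult.assoc by (simp add: mult.assoc[symmetric, of _ p r])

lemma has_expansion_diff: "has_expansion p p' \<Longrightarrow> has_expansion r r' \<Longrightarrow> has_expansion (p - r) (p' - r')"
  by (simp add: has_expansion_def right_diff_distrib left_diff_distrib ct_diff ct_diff_right)

lemma has_expansion_prod: "(\<And>i. i \<in> A \<Longrightarrow> has_expansion (p i) (p' i)) \<Longrightarrow> has_expansion (\<Prod>i\<in>A. p i) (\<Prod>i\<in>A. p' i)"
  by (induction A rule: infinite_finite_induct) (auto intro: has_expansion_one has_expansion_mult)

lemma has_expansion_single:
  assumes "expand c = fps_to_fls c'"
  shows "has_expansion (Poly_Mapping.single \<nu> c) (xterm c' \<nu>)"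
  unfolding has_expansion_def
proof (intro allI)
  fix h G
  show "ct (h * Poly_Mapping.single \<nu> c) G = ct h (xterm c' \<nu> * G)"
  proof (induction h rule: poly_mapping_add_induct)
    case (add \<mu> e f)
    have "Abs_fps (\<lambda>k. Poly_Mapping.lookup (fps_nth (xterm c' \<nu> * G) k) (- \<mu>)) =
        c' * Abs_fps (\<lambda>k. Poly_Mapping.lookup (fps_nth G k) (- (\<mu> + \<nu>)))"
      by (simp add: fps_eq_iff fps_mult_nth lookup_sum lookup_mult_single)
    hence "ct (Poly_Mapping.single \<mu> e * Poly_Mapping.single \<nu> c) G = ct (Poly_Mapping.single \<mu> e) (xterm c' \<nu> * G)"
      using assms by (simp add: mult_single ct_single expand.hom_mult fls_times_fps_to_fls mult.assoc)
    with add show ?case by (simp add: distrib_right ct_add)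
  qed (simp add: ct_zero)
qed

lemma has_expansion_one_minus: "expand c = fps_to_fls c' \<Longrightarrow> has_expansion (1 - Poly_Mapping.single \<nu> c) (1 - xterm c' \<nu>)"
  by (intro has_expansion_diff has_expansion_one has_expansion_single)

lemma ct_symmetrise:
  assumes F: "\<And>w. w \<in> W_fin n \<Longrightarrow> signed_act w F = F" and G: "\<And>w. w \<in> W_fin n \<Longrightarrow> fps_act w G = G"
  shows "of_nat (card (W_fin n)) * ct (F * weyl_denom n * mac_prod n t c d) G =
    expand (W0 n t (- (c * d))) * ct (F * weyl_denom n * weyl_denom n) G"
proof -
  let ?h = "F * weyl_denom n * mac_prod n t c d"
  have "of_nat (card (W_fin n)) * ct ?h G = (\<Sum>w\<in>W_fin n. ct (signed_act w ?h) G)"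
    by (simp add: ct_signed_act G)
  also have "\<dots> = ct (\<Sum>w\<in>W_fin n. signed_act w ?h) G"
    by (simp add: ct_sum)
  \<comment> \<open>The sign picked up by the explicit \<open>weyl_denom\<close> turns the plain sum
    over the group into the alternating sum of \<open>macdonald_identity\<close>.\<close>
  also have "(\<Sum>w\<in>W_fin n. signed_act w ?h) =
      F * weyl_denom n * (\<Sum>w\<in>W_fin n. Poly_Mapping.single 0 (sign_char n w) * signed_act w (mac_prod n t c d))"
    unfolding sum_distrib_left
    by (intro sum.cong refl) (simp add: signed_act.hom_mult F signed_act_weyl_denom mult_ac)
  also have "\<dots> = Poly_Mapping.single 0 (W0 n t (- (c * d))) * (F * weyl_denom n * weyl_denom n)"
    unfolding macdonald_identity by (simp add: mult_ac)
  finally show ?thesis by (simp add: ct_scale)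
qed

section \<open>Expansion of the kernel\<close>

abbreviation one_minus :: "ratfun \<Rightarrow> expo \<Rightarrow> laurent" where
  "one_minus c \<nu> \<equiv> 1 - Poly_Mapping.single \<nu> c"

definition laurent_asym_single :: "ratfun \<Rightarrow> ratfun \<Rightarrow> nat \<Rightarrow> laurent" where
  "laurent_asym_single c d i = one_minus 1 (signed_eps (int i) + signed_eps (int i)) * one_minus c (- signed_eps (int i)) * one_minus d (- signed_eps (int i))"

definition laurent_asym_pair :: "ratfun \<Rightarrow> nat \<Rightarrow> nat \<Rightarrow> laurent" where
  "laurent_asym_pair t i j = one_minus 1 (signed_eps (int i) - signed_eps (int j)) * one_minus 1 (signed_eps (int i) + signed_eps (int j)) *
     one_minus t (- signed_eps (int i) + signed_eps (int j)) * one_minus t (- signed_eps (int i) - signed_eps (int j))"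

text \<open>The counterpart of \<open>asym_kernel\<close> over the parameter field. Unlike the
  latter it can be evaluated at inverted parameters, as \<open>A_omega_bar\<close> and
  \<open>A_pi_bar\<close> require.\<close>

definition laurent_asym :: "nat \<Rightarrow> ratfun \<Rightarrow> ratfun \<Rightarrow> ratfun \<Rightarrow> laurent" where
  "laurent_asym n t c d = (\<Prod>i=1..n. laurent_asym_single c d i) * (\<Prod>(i,j)\<in>index_pairs n. laurent_asym_pair t i j)"

definition laurent_shift_single :: "ratfun \<Rightarrow> nat \<Rightarrow> laurent" where
  "laurent_shift_single c i = one_minus c (signed_eps (int i)) * one_minus c (- signed_eps (int i))"

definition laurent_shift_pair :: "ratfun \<Rightarrow> nat \<Rightarrow> nat \<Rightarrow> laurent" where
  "laurent_shift_pair t i j = one_minus t (signed_eps (int i) - signed_eps (int j)) * one_minus t (signed_eps (int i) + signed_eps (int j)) *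
     one_minus t (- signed_eps (int i) + signed_eps (int j)) * one_minus t (- signed_eps (int i) - signed_eps (int j))"

lemma expand_one: "expand 1 = fps_to_fls 1"
  by (simp add: expand.hom_one)

lemma has_expansion_asym:
  assumes "expand t = fps_to_fls t'" "expand c = fps_to_fls c'" "expand d = fps_to_fls d'"
  shows "has_expansion (laurent_asym n t c d) (asym_kernel n t' c' d')"
  unfolding laurent_asym_def asym_kernel_def laurent_asym_single_def asym_single_def laurent_asym_pair_def asym_pair_def case_prod_unfold
  by (intro has_expansion_mult has_expansion_prod has_expansion_one_minus assms expand_one)

lemma has_expansion_shift_single:
  assumes "expand c = fps_to_fls c'"
  shows "has_expansion (laurent_shift_single c i) (shift_single c' i)"
  unfolding laurent_shift_single_def shift_single_def
  by (intro has_expansion_mult has_expansion_one_minus assms)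

lemma has_expansion_shift_pair:
  assumes "expand t = fps_to_fls t'"
  shows "has_expansion (laurent_shift_pair t i j) (shift_pair t' i j)"
  unfolding laurent_shift_pair_def shift_pair_def
  by (intro has_expansion_mult has_expansion_one_minus assms)

text \<open>Since 1 - x^2 = - x (x - 1/x), the spare x can be moved to (1 - c/x) (1 - d/x), which
  gives \<open>mac_single c d\<close>.\<close>

lemma laurent_asym_single_eq: "laurent_asym_single c d i = - (mac_single 1 (- 1) (int i) * mac_single c d (int i))"
proof -
  let ?X = "Poly_Mapping.single (signed_eps (int i)) 1 :: laurent" and ?Y = "Poly_Mapping.single (- signed_eps (int i)) 1 :: laurent"
  let ?C = "Poly_Mapping.single 0 c :: laurent" and ?D = "Poly_Mapping.single 0 d :: laurent"
  have XY: "?X * ?Y = 1" by (simp add: mult_single)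
  have e: "Poly_Mapping.single (signed_eps (int i) + signed_eps (int i)) 1 = ?X * ?X"
    "Poly_Mapping.single (- signed_eps (int i)) c = ?C * ?Y" "Poly_Mapping.single (- signed_eps (int i)) d = ?D * ?Y"
    "Poly_Mapping.single (- signed_eps (int i)) (c * d) = ?C * ?D * ?Y"
    "Poly_Mapping.single 0 (c + d) = ?C + ?D"
    "Poly_Mapping.single (- signed_eps (int i)) (1 * - 1) = - ?Y"
    by (simp_all only: mult_single single_add[symmetric] single_uminus[symmetric]) simp_all
  have "(1 - ?X * ?X) * (1 - ?C * ?Y) * (1 - ?D * ?Y) = - ((?X - ?Y) * (?X - (?C + ?D) + ?C * ?D * ?Y))"
    using XY by algebra
  then show ?thesis
    unfolding laurent_asym_single_def mac_single_def signed_eps_uminus e by simp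
qed

text \<open>Since (1 - x_i/x_j) (1 - x_i x_j) = x_i (x_i + 1/x_i - x_j - 1/x_j), the spare x_i
  completes the two factors with t to \<open>mac_pair t\<close>.\<close>

lemma laurent_asym_pair_eq: "laurent_asym_pair t i j = mac_pair 1 (int i) (int j) * mac_pair t (int i) (int j)"
proof -
  let ?X = "Poly_Mapping.single (signed_eps (int i)) 1 :: laurent" and ?Y = "Poly_Mapping.single (- signed_eps (int i)) 1 :: laurent"
  let ?U = "Poly_Mapping.single (signed_eps (int j)) 1 :: laurent" and ?V = "Poly_Mapping.single (- signed_eps (int j)) 1 :: laurent"
  let ?T = "Poly_Mapping.single 0 t :: laurent"
  have XY: "?X * ?Y = 1" "?U * ?V = 1" by (simp_all add: mult_single)
  have e: "Poly_Mapping.single (signed_eps (int i) - signed_eps (int j)) 1 = ?X * ?V"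
    "Poly_Mapping.single (signed_eps (int i) + signed_eps (int j)) 1 = ?X * ?U"
    "Poly_Mapping.single (- signed_eps (int i) + signed_eps (int j)) t = ?T * ?Y * ?U"
    "Poly_Mapping.single (- signed_eps (int i) - signed_eps (int j)) t = ?T * ?Y * ?V"
    "Poly_Mapping.single (signed_eps (int j)) t = ?T * ?U"
    "Poly_Mapping.single (- signed_eps (int j)) t = ?T * ?V"
    "Poly_Mapping.single (- signed_eps (int i)) (t\<^sup>2) = ?T * ?T * ?Y"
    by (simp_all add: mult_single power2_eq_square)
  have "(1 - ?X * ?V) * (1 - ?X * ?U) * (1 - ?T * ?Y * ?U) * (1 - ?T * ?Y * ?V) =
      (?X - ?U - ?V + ?Y) * (?X - ?T * ?U - ?T * ?V + ?T * ?T * ?Y)"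
    using XY by algebra
  then show ?thesis
    unfolding laurent_asym_pair_def mac_pair_def signed_eps_uminus e by simp
qed

lemma laurent_asym_eq: "laurent_asym n t c d = (- 1) ^ n * (weyl_denom n * mac_prod n t c d)"
proof -
  have "(\<Prod>i=1..n. laurent_asym_single c d i) = (- 1) ^ n * ((\<Prod>i=1..n. mac_single 1 (- 1) (int i)) * (\<Prod>i=1..n. mac_single c d (int i)))"
    using prod.distrib[of "\<lambda>_. - 1" "\<lambda>i. mac_single 1 (- 1) (int i) * mac_single c d (int i)" "{1..n}"]
    by (simp add: laurent_asym_single_eq prod.distrib)
  then show ?thesis
    unfolding laurent_asym_def mac_prod_def laurent_asym_pair_eq case_prod_unfold prod.distrib by (simp only: mult_ac)
qed

lemma of_nat_card_W_nonzero: "(of_nat (card (W_fin n)) :: ratfun fls) \<noteq> 0"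
proof -
  have "expand (of_nat m) = of_nat m" for m
    by (induction m) (simp_all add: expand.hom_simps)
  moreover have "card (W_fin n) \<noteq> 0"
    using W_finite[of n] W_id[of n] by auto
  ultimately show ?thesis
    by (metis expand_nonzero of_nat_ratfun_eq_0_iff)
qed

text \<open>The index 1 marks the shifted parameters, 0 the original ones and 2 those after
  inversion; \<open>A\<close> stands for a denominator times its bar. Both constant terms are
  symmetrised against the same invariant series \<open>P' * G\<close> and become multiples of one
  constant term, which cancels.\<close>

lemma going_up:
  assumes F: "\<And>w. w \<in> W_fin n \<Longrightarrow> signed_act w F = F"
    and A: "A * laurent_asym n t0 c0 d0 = P * laurent_asym n t2 c2 d2" and P: "has_expansion P P'"
    and G: "\<And>w. w \<in> W_fin n \<Longrightarrow> fps_act w (P' * G) = P' * G"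
    and nz: "W0 n t2 (- (c2 * d2)) \<noteq> 0"
  shows "ct (F * laurent_asym n t1 c1 d1) (P' * G) =
    expand (W0 n t1 (- (c1 * d1)) / W0 n t2 (- (c2 * d2))) * ct (F * A * laurent_asym n t0 c0 d0) G"
proof -
  define N where "N = (of_nat (card (W_fin n)) :: ratfun fls)"
  \<comment> \<open>Absorbs the sign between \<open>laurent_asym\<close> and
    \<open>weyl_denom n * mac_prod n t c d\<close>.\<close>
  define F' where "F' = (- 1) ^ n * F"
  have F': "signed_act w F' = F'" if "w \<in> W_fin n" for w
    using F[OF that] by (simp add: F'_def signed_act.hom_simps)
  have sym: "N * ct (F * laurent_asym n t c d) (P' * G) = expand (W0 n t (- (c * d))) * ct (F' * weyl_denom n * weyl_denom n) (P' * G)" for t c d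
  proof -
    have "F * laurent_asym n t c d = F' * weyl_denom n * mac_prod n t c d"
      unfolding laurent_asym_eq F'_def by (simp only: mult_ac)
    then show ?thesis
      unfolding N_def using ct_symmetrise[of n F' "P' * G", OF F' G] by simp
  qed
  have "F * A * laurent_asym n t0 c0 d0 = F * laurent_asym n t2 c2 d2 * P"
    unfolding mult.assoc A by (simp only: mult_ac)
  hence "ct (F * A * laurent_asym n t0 c0 d0) G = ct (F * laurent_asym n t2 c2 d2) (P' * G)"
    using P unfolding has_expansion_def by presburger
  hence "N * ct (F * A * laurent_asym n t0 c0 d0) G = expand (W0 n t2 (- (c2 * d2))) * ct (F' * weyl_denom n * weyl_denom n) (P' * G)"
    by (simp add: sym)
  hence Z: "ct (F' * weyl_denom n * weyl_denom n) (P' * G) = N * ct (F * A * laurent_asym n t0 c0 d0) G / expand (W0 n t2 (- (c2 * d2)))"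
    using expand_nonzero[OF nz] by (simp add: field_simps)
  have "N * ct (F * laurent_asym n t1 c1 d1) (P' * G) =
      N * (expand (W0 n t1 (- (c1 * d1)) / W0 n t2 (- (c2 * d2))) * ct (F * A * laurent_asym n t0 c0 d0) G)"
    unfolding sym Z expand_divide by (simp add: field_simps)
  then show ?thesis
    using of_nat_card_W_nonzero[of n] by (simp add: N_def)
qed

section \<open>Nonvanishing of the Poincare polynomials\<close>

abbreviation at_one :: "parampoly \<Rightarrow> complex" where
  "at_one \<equiv> poly_subst (\<lambda>c. c) (\<lambda>_. 1)"

text \<open>\<open>r\<close> is regular at the point where all parameters are \<open>1\<close>, with value \<open>c\<close> there.\<close>

definition spec_one :: "ratfun \<Rightarrow> complex \<Rightarrow> bool" where
  "spec_one r c \<longleftrightarrow> (\<exists>a b. at_one b \<noteq> 0 \<and> r = Fract a b \<and> at_one a = c * at_one b)"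

interpretation at_one: ring_hom_1 at_one
  by (rule poly_subst_hom[OF ring_hom_1_id])

lemma at_one_nonzero: "at_one b \<noteq> 0 \<Longrightarrow> b \<noteq> 0"
  using at_one.hom_zero by auto

lemma spec_one_add: "spec_one r c \<Longrightarrow> spec_one s d \<Longrightarrow> spec_one (r + s) (c + d)"
  unfolding spec_one_def
proof clarify
  fix a b a' b'
  assume *: "at_one b \<noteq> 0" "at_one a = c * at_one b" "at_one b' \<noteq> 0" "at_one a' = d * at_one b'"
  show "\<exists>e f. at_one f \<noteq> 0 \<and> Fract a b + Fract a' b' = Fract e f \<and> at_one e = (c + d) * at_one f"
    using * by (intro exI[of _ "a * b' + a' * b"] exI[of _ "b * b'"])
      (simp add: at_one_nonzero at_one.hom_simps algebra_simps)
qed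

lemma spec_one_mult: "spec_one r c \<Longrightarrow> spec_one s d \<Longrightarrow> spec_one (r * s) (c * d)"
  unfolding spec_one_def
proof clarify
  fix a b a' b'
  assume *: "at_one b \<noteq> 0" "at_one a = c * at_one b" "at_one b' \<noteq> 0" "at_one a' = d * at_one b'"
  show "\<exists>e f. at_one f \<noteq> 0 \<and> Fract a b * Fract a' b' = Fract e f \<and> at_one e = c * d * at_one f"
    using * by (intro exI[of _ "a * a'"] exI[of _ "b * b'"])
      (simp add: at_one_nonzero at_one.hom_simps)
qed

lemma spec_one_const: "spec_one 1 1" "spec_one 0 0"
  unfolding spec_one_def One_fract_def Zero_fract_def
  by (metis at_one.hom_one at_one.hom_zero mult_1 mult_zero_left zero_neq_one)+

lemma spec_one_power: "spec_one r 1 \<Longrightarrow> spec_one (r ^ m) 1"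
proof (induction m)
  case (Suc m)
  then show ?case using spec_one_mult[of r 1 "r ^ m" 1] by simp
qed (simp add: spec_one_const)

lemma spec_one_par: "spec_one (par p) 1" "spec_one (inverse (par p)) 1"
proof -
  have "at_one (Poly_Mapping.single (Poly_Mapping.single p 1) 1) = 1"
    by (simp add: poly_subst_single[OF ring_hom_1_id])
  then show "spec_one (par p) 1" "spec_one (inverse (par p)) 1"
    unfolding spec_one_def par_def inverse_fract
    by (metis at_one.hom_one mult_1 zero_neq_one)+
qed

lemma spec_one_zero: "spec_one 0 c \<Longrightarrow> c = 0"
  by (auto simp: spec_one_def Zero_fract_def eq_fract at_one_nonzero at_one.hom_zero)

text \<open>Every summand specialises to 1 when all parameters are set to 1, so the sum specialises
  to the group order, which is nonzero in the complex numbers.\<close>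

lemma W0_nonzero:
  assumes "spec_one z1 1" "spec_one z2 1"
  shows "W0 n z1 z2 \<noteq> 0"
proof
  assume "W0 n z1 z2 = 0"
  have "spec_one (\<Sum>w\<in>A. z1 ^ ell_s n w * z2 ^ ell_d n w) (of_nat (card A))" if "finite A" for A
    using that
  proof induction
    case (insert w A)
    have "spec_one (z1 ^ ell_s n w * z2 ^ ell_d n w) 1"
      using spec_one_mult[OF spec_one_power[OF assms(1)] spec_one_power[OF assms(2)]] by simp
    from spec_one_add[OF this insert.IH] insert.hyps show ?case by simp
  qed (simp add: spec_one_const)
  from this[OF W_finite] have "spec_one (W0 n z1 z2) (of_nat (card (W_fin n)))"
    by (simp add: W0_eq)
  with \<open>W0 n z1 z2 = 0\<close> have "card (W_fin n) = 0"
    using spec_one_zero[of "of_nat (card (W_fin n))"] by simp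
  then show False
    using W_finite[of n] W_id[of n] by auto
qed

section \<open>Norms of the Weyl denominators\<close>

abbreviation par_c :: ratfun where "par_c \<equiv> par Tnh * par Unh"
abbreviation par_d :: ratfun where "par_d \<equiv> - (par Tnh * inverse (par Unh))"

text \<open>Used for the monomial in front of a Weyl denominator and its image under
  \<open>bar\<close>, which are inverse to each other.\<close>

lemma unit_pair_cancel: "s * s' = 1 \<Longrightarrow> (s * p) * (s' * r) = p * r" for s :: "'a::comm_ring_1"
proof -
  assume "s * s' = 1"
  moreover have "(s * p) * (s' * r) = (s * s') * (p * r)" by (simp only: mult_ac)
  ultimately show ?thesis by simp
qed

text \<open>The factor 1 - c x_i of the denominator joins 1 - c/x_i from \<open>laurent_asym\<close>
  to form the invariant shift factor, while its bar, 1 - 1/(c x_i), takes the vacated place with c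
  inverted; likewise for d.\<close>

lemma A_omega_bar:
  "A_omega n * bar (A_omega n) * laurent_asym n t par_c par_d =
     (\<Prod>i=1..n. laurent_shift_single par_c i * laurent_shift_single par_d i) * laurent_asym n t (inverse par_c) (inverse par_d)"
proof -
  let ?m = "\<Sum>i=1..n. eps i"
  have "A_omega n = Poly_Mapping.single (- ?m) 1 * (\<Prod>i=1..n. one_minus par_c (signed_eps (int i)) * one_minus par_d (signed_eps (int i)))"
    by (simp add: A_omega_def eps_eq_signed_eps single_uminus)
  moreover from this have "bar (A_omega n) =
      Poly_Mapping.single ?m 1 * (\<Prod>i=1..n. one_minus (inverse par_c) (- signed_eps (int i)) * one_minus (inverse par_d) (- signed_eps (int i)))"
    by (simp add: bar.hom_simps bar_single bar_par.hom_simps bar_par_par ring_hom_1_inverse[OF bar_par_hom])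
  moreover have "Poly_Mapping.single (- ?m) 1 * Poly_Mapping.single ?m 1 = (1 :: laurent)"
    by (simp add: mult_single)
  ultimately have A: "A_omega n * bar (A_omega n) =
      (\<Prod>i=1..n. one_minus par_c (signed_eps (int i)) * one_minus par_d (signed_eps (int i))) *
      (\<Prod>i=1..n. one_minus (inverse par_c) (- signed_eps (int i)) * one_minus (inverse par_d) (- signed_eps (int i)))"
    by (simp only: unit_pair_cancel)
  show ?thesis
    unfolding A laurent_asym_def laurent_asym_single_def laurent_shift_single_def prod.distrib by (simp only: mult_ac)
qed

lemma A_pi_bar:
  "A_pi n * bar (A_pi n) * laurent_asym n par_t c d =
     (\<Prod>(i,j)\<in>index_pairs n. laurent_shift_pair par_t i j) * laurent_asym n (inverse par_t) c d"
proof -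
  let ?m = "\<Sum>i=1..n. Poly_Mapping.single i (int n - int i)"
  have "(\<Prod>i=1..n. \<Prod>j=i+1..n. one_minus par_t (eps i + eps j) * one_minus par_t (eps i - eps j)) =
    (\<Prod>(i,j)\<in>index_pairs n. one_minus par_t (signed_eps (int i) + signed_eps (int j)) * one_minus par_t (signed_eps (int i) - signed_eps (int j)))"
    unfolding prod_index_pairs by (intro prod.cong) (auto simp: index_pairs_iff eps_eq_signed_eps)
  hence "A_pi n = Poly_Mapping.single (- ?m) 1 *
     (\<Prod>(i,j)\<in>index_pairs n. one_minus par_t (signed_eps (int i) + signed_eps (int j)) * one_minus par_t (signed_eps (int i) - signed_eps (int j)))"
    by (simp only: A_pi_def)
  moreover from this have "bar (A_pi n) = Poly_Mapping.single ?m 1 *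
     (\<Prod>(i,j)\<in>index_pairs n. one_minus (inverse par_t) (- signed_eps (int i) - signed_eps (int j)) * one_minus (inverse par_t) (- signed_eps (int i) + signed_eps (int j)))"
    by (simp add: bar.hom_simps bar_single bar_par.hom_simps bar_par_par case_prod_unfold power_inverse
        ring_hom_1_inverse[OF bar_par_hom] add.commute)
  moreover have "Poly_Mapping.single (- ?m) 1 * Poly_Mapping.single ?m 1 = (1 :: laurent)"
    by (simp add: mult_single)
  ultimately have A: "A_pi n * bar (A_pi n) =
     (\<Prod>(i,j)\<in>index_pairs n. one_minus par_t (signed_eps (int i) + signed_eps (int j)) * one_minus par_t (signed_eps (int i) - signed_eps (int j))) *
     (\<Prod>(i,j)\<in>index_pairs n. one_minus (inverse par_t) (- signed_eps (int i) - signed_eps (int j)) * one_minus (inverse par_t) (- signed_eps (int i) + signed_eps (int j)))"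
    by (simp only: unit_pair_cancel)
  show ?thesis
    unfolding A laurent_asym_def laurent_asym_pair_def laurent_shift_pair_def case_prod_unfold prod.distrib by (simp only: mult_ac)
qed

text \<open>\<open>A_omega_bar\<close> holds for every \<open>t\<close> and \<open>A_pi_bar\<close>
  for all \<open>c\<close> and \<open>d\<close>, so the two inversions can be carried out one after
  the other.\<close>

lemma A_rho_bar:
  "A_rho n * bar (A_rho n) * laurent_asym n par_t par_c par_d =
     ((\<Prod>(i,j)\<in>index_pairs n. laurent_shift_pair par_t i j) * (\<Prod>i=1..n. laurent_shift_single par_c i * laurent_shift_single par_d i)) *
     laurent_asym n (inverse par_t) (inverse par_c) (inverse par_d)"
proof -
  have "A_rho n * bar (A_rho n) * laurent_asym n par_t par_c par_d =
      A_pi n * bar (A_pi n) * (A_omega n * bar (A_omega n) * laurent_asym n par_t par_c par_d)"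
    unfolding A_rho_def bar.hom_mult by (simp only: mult_ac)
  also have "\<dots> = (\<Prod>i=1..n. laurent_shift_single par_c i * laurent_shift_single par_d i) *
      (A_pi n * bar (A_pi n) * laurent_asym n par_t (inverse par_c) (inverse par_d))"
    unfolding A_omega_bar by (simp only: mult_ac)
  also have "\<dots> = ((\<Prod>(i,j)\<in>index_pairs n. laurent_shift_pair par_t i j) * (\<Prod>i=1..n. laurent_shift_single par_c i * laurent_shift_single par_d i)) *
     laurent_asym n (inverse par_t) (inverse par_c) (inverse par_d)"
    unfolding A_pi_bar by (simp only: mult_ac)
  finally show ?thesis .
qed

section \<open>The four inner products in terms of the symmetric kernel\<close>

abbreviation series_c :: "ratfun fps" where "series_c \<equiv> gpar Tnh * gpar Unh"
abbreviation series_d :: "ratfun fps" where "series_d \<equiv> - (gpar Tnh * inverse (gpar Unh))"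

definition sym_kernel0 :: "nat \<Rightarrow> ratfun fps \<Rightarrow> ratfun fps \<Rightarrow> ratfun fps \<Rightarrow> laurent fps" where
  "sym_kernel0 n t c d = sym_kernel n t (gpar Qh * gpar T0h * gpar U0h) (- (gpar Qh * gpar T0h * inverse (gpar U0h))) c d"

lemma gpar_small_0: "p \<noteq> U0h \<Longrightarrow> p \<noteq> Unh \<Longrightarrow> fps_nth (gpar p) 0 = 0"
  by (simp add: gpar_def)

lemma fps_act_sym_kernel0:
  "w \<in> W_fin n \<Longrightarrow> fps_nth t 0 = 0 \<Longrightarrow> fps_nth c 0 = 0 \<Longrightarrow> fps_nth d 0 = 0 \<Longrightarrow> fps_act w (sym_kernel0 n t c d) = sym_kernel0 n t c d"
  unfolding sym_kernel0_def by (rule fps_act_sym_kernel) (simp_all add: gpar_small_0)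

lemma expand_par_c: "expand par_c = fps_to_fls series_c"
  by (simp add: expand.hom_mult expand_par fls_times_fps_to_fls)

lemma expand_par_d: "expand par_d = fps_to_fls series_d"
proof -
  have "fps_to_fls (inverse (gpar Unh)) = inverse (fps_to_fls (gpar Unh))"
    by (simp add: gpar_def fps_const_inverse fls_inverse_const)
  then show ?thesis
    by (simp add: expand.hom_simps expand_par fls_times_fps_to_fls ring_hom_1_inverse[OF expand_hom])
qed

lemma expand_par_power: "expand (par p ^ m) = fps_to_fls (gpar p ^ m)"
  by (simp add: expand.hom_power expand_par fps_to_fls_power)

lemma expand_shift: "expand x = fps_to_fls y \<Longrightarrow> expand (par_q * x) = fps_to_fls (series_q * y)"
  by (simp add: expand.hom_mult expand_par_power fls_times_fps_to_fls)

text \<open>Brings the asymmetric factor of the kernel to the polynomial side, where it can be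
  combined with a Weyl denominator and its bar.\<close>

lemma ct_inv_kernel:
  assumes "expand t = fps_to_fls t'" "expand c = fps_to_fls (tnh * gpar Unh)"
    "expand d = fps_to_fls (- (tnh * inverse (gpar Unh)))" "fps_nth t' 0 = 0" "fps_nth tnh 0 = 0"
  shows "ct h (inv_kernel n t' (gpar T0h) (gpar U0h) tnh (gpar Unh)) =
    ct (h * laurent_asym n t c d) (sym_kernel0 n t' (tnh * gpar Unh) (- (tnh * inverse (gpar Unh))))"
  using inv_kernel_eq[of t' "gpar T0h" tnh n "gpar U0h" "gpar Unh"] assms(4,5) has_expansion_asym[OF assms(1-3), of n]
  by (simp add: gpar_small_0 has_expansion_def sym_kernel0_def)

lemma ip_plus_eq: "ip_plus n f g = ct (f * bar g * laurent_asym n par_t par_c par_d) (sym_kernel0 n (gpar Th ^ 2) series_c series_d)"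
  unfolding ip_plus_def
  by (rule ct_inv_kernel) (simp_all only: expand_par_power expand_par_c expand_par_d, simp_all add: gpar_small_0)

lemma ip_pm_eq: "ip_pm n f g = ct (f * bar g * laurent_asym n par_t (par_q * par_c) (par_q * par_d)) (sym_kernel0 n (gpar Th ^ 2) (series_q * series_c) (series_q * series_d))"
proof -
  \<comment> \<open>Replacing t_n^(1/2) by q t_n^(1/2) multiplies both c and d by q, since both are
    linear in t_n^(1/2).\<close>
  have e: "series_q * series_c = series_q * gpar Tnh * gpar Unh" "series_q * series_d = - (series_q * gpar Tnh * inverse (gpar Unh))"
    by (simp_all add: mult.assoc)
  show ?thesis
    unfolding ip_pm_def e
    by (rule ct_inv_kernel)
       (simp_all only: expand_par_power expand_shift[OF expand_par_c] expand_shift[OF expand_par_d] e[symmetric], simp_all add: gpar_small_0)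
qed

lemma ip_mp_eq: "ip_mp n f g = ct (f * bar g * laurent_asym n (par_q * par_t) par_c par_d) (sym_kernel0 n (series_q * gpar Th ^ 2) series_c series_d)"
  unfolding ip_mp_def
  by (rule ct_inv_kernel)
     (simp_all only: expand_shift[OF expand_par_power] expand_par_c expand_par_d, simp_all add: gpar_small_0)

lemma ip_minus_eq: "ip_minus n f g = ct (f * bar g * laurent_asym n (par_q * par_t) (par_q * par_c) (par_q * par_d))
    (sym_kernel0 n (series_q * gpar Th ^ 2) (series_q * series_c) (series_q * series_d))"
proof -
  have e: "series_q * series_c = series_q * gpar Tnh * gpar Unh" "series_q * series_d = - (series_q * gpar Tnh * inverse (gpar Unh))"
    by (simp_all add: mult.assoc)
  show ?thesis
    unfolding ip_minus_def e
    by (rule ct_inv_kernel)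
       (simp_all only: expand_shift[OF expand_par_power] expand_shift[OF expand_par_c] expand_shift[OF expand_par_d] e[symmetric],
        simp_all add: gpar_small_0)
qed

theorem proposition5p6:
  fixes n :: nat and f g :: laurent
  assumes "n \<ge> 1" and "f \<in> invariants n" and "g \<in> invariants n"
  shows
    "ip_plus n f g =
       expand (W0 n par_t par_tn / W0 n par_t par_tn) * ip_plus n (P_zero * f) (P_zero * g) \<and>
     ip_pm n f g =
       expand (W0 n par_t ((par_q * par Tnh) ^ 2) / W0 n par_t (inverse par_tn)) *
         ip_plus n (A_omega n * f) (A_omega n * g) \<and>
     ip_minus n f g =
       expand (W0 n (par_q * par_t) ((par_q * par Tnh) ^ 2) / W0 n (inverse par_t) (inverse par_tn)) *
         ip_plus n (A_rho n * f) (A_rho n * g) \<and>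
     ip_mp n f g =
       expand (W0 n (par_q * par_t) par_tn / W0 n (inverse par_t) par_tn) *
         ip_plus n (A_pi n * f) (A_pi n * g)"
proof -
  have inv: "signed_act w h = h" if "h \<in> invariants n" "w \<in> W_fin n" for h w
    using that act_eq_signed_act[of h n w] by (simp add: invariants_def)
  define F where "F = f * bar g"
  have F: "signed_act w F = F" if "w \<in> W_fin n" for w
    using inv[OF assms(2) that] inv[OF assms(3) that] by (simp add: F_def signed_act.hom_mult signed_act_bar)
  have plus: "ip_plus n (A * f) (A * g) = ct (F * (A * bar A) * laurent_asym n par_t par_c par_d) (sym_kernel0 n (gpar Th ^ 2) series_c series_d)" for A
  proof -
    have "A * f * bar (A * g) = F * (A * bar A)"
      unfolding F_def bar.hom_mult by (simp only: mult_ac)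
    then show ?thesis by (simp only: ip_plus_eq)
  qed
  have z: "fps_nth (gpar Th ^ 2) 0 = 0" "fps_nth series_c 0 = 0" "fps_nth series_d 0 = 0"
    by (simp_all add: gpar_small_0)
  define PC where "PC = (\<Prod>i=1..n. shift_single series_c i * shift_single series_d i)"
  define PT where "PT = (\<Prod>(i,j)\<in>index_pairs n. shift_pair (gpar Th ^ 2) i j)"
  have PC: "has_expansion (\<Prod>i=1..n. laurent_shift_single par_c i * laurent_shift_single par_d i) PC"
    unfolding PC_def by (intro has_expansion_prod has_expansion_mult has_expansion_shift_single expand_par_c expand_par_d)
  have PT: "has_expansion (\<Prod>(i,j)\<in>index_pairs n. laurent_shift_pair par_t i j) PT"
    unfolding PT_def case_prod_unfold by (intro has_expansion_prod has_expansion_shift_pair expand_par_power)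
  have shC: "sym_kernel0 n t (series_q * series_c) (series_q * series_d) = PC * sym_kernel0 n t series_c series_d" for t
    unfolding sym_kernel0_def PC_def by (rule sym_kernel_shift_single[OF z(2,3)])
  have shT: "sym_kernel0 n (series_q * gpar Th ^ 2) c d = PT * sym_kernel0 n (gpar Th ^ 2) c d" for c d
    unfolding sym_kernel0_def PT_def by (rule sym_kernel_shift_pair[OF z(1)])
  have shTC: "sym_kernel0 n (series_q * gpar Th ^ 2) (series_q * series_c) (series_q * series_d) = PT * PC * sym_kernel0 n (gpar Th ^ 2) series_c series_d"
    unfolding shC shT by (simp only: mult_ac)
  \<comment> \<open>The second arguments of the Poincare polynomials. Both c and d carry the shift
    by q, which is why the square of q t_n^(1/2) appears.\<close>
  have cd: "- (par_c * par_d) = par_tn" "- (inverse par_c * inverse par_d) = inverse par_tn"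
    "- ((par_q * par_c) * (par_q * par_d)) = (par_q * par Tnh) ^ 2"
    by (simp_all add: field_simps power2_eq_square)
  have specs: "spec_one par_t 1" "spec_one par_tn 1" "spec_one (inverse par_t) 1" "spec_one (inverse par_tn) 1"
    using spec_one_power[OF spec_one_par(1)] spec_one_power[OF spec_one_par(2)]
    by (auto simp: power_inverse)
  \<comment> \<open>Division by zero yields 0, so even the quotient of two equal Poincare
    polynomials is 1 only because they do not vanish.\<close>
  have "ip_plus n f g = expand (W0 n par_t par_tn / W0 n par_t par_tn) * ip_plus n (P_zero * f) (P_zero * g)"
    using W0_nonzero[OF specs(1,2)] by (simp add: P_zero_def expand.hom_one)
  moreover have "ip_pm n f g =
       expand (W0 n par_t ((par_q * par Tnh) ^ 2) / W0 n par_t (inverse par_tn)) *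
         ip_plus n (A_omega n * f) (A_omega n * g)"
    unfolding ip_pm_eq plus F_def[symmetric] shC
    by (rule going_up[OF F A_omega_bar PC, where ?t1.0 = "par_t" and ?c1.0 = "par_q * par_c" and ?d1.0 = "par_q * par_d", unfolded cd])
       (simp_all add: shC[symmetric] fps_act_sym_kernel0 z cd W0_nonzero specs)
  moreover have "ip_minus n f g =
       expand (W0 n (par_q * par_t) ((par_q * par Tnh) ^ 2) / W0 n (inverse par_t) (inverse par_tn)) *
         ip_plus n (A_rho n * f) (A_rho n * g)"
    unfolding ip_minus_eq plus F_def[symmetric] shTC
    by (rule going_up[OF F A_rho_bar has_expansion_mult[OF PT PC], where ?t1.0 = "par_q * par_t" and ?c1.0 = "par_q * par_c" and ?d1.0 = "par_q * par_d", unfolded cd])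
       (simp_all add: shTC[symmetric] fps_act_sym_kernel0 z cd W0_nonzero specs)
  moreover have "ip_mp n f g =
       expand (W0 n (par_q * par_t) par_tn / W0 n (inverse par_t) par_tn) *
         ip_plus n (A_pi n * f) (A_pi n * g)"
    unfolding ip_mp_eq plus F_def[symmetric] shT
    by (rule going_up[OF F A_pi_bar[of n par_c par_d] PT, where ?t1.0 = "par_q * par_t" and ?c1.0 = "par_c" and ?d1.0 = "par_d", unfolded cd])
       (simp_all add: shT[symmetric] fps_act_sym_kernel0 gpar_small_0 cd W0_nonzero specs)
  ultimately show ?thesis by blast
qed

end
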